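(* There exists an absolute constant $c>0$ such that the following holds. Let $\mathbb{F}$ be a field of characteristic $p$, where $p$ is an odd prime, and let $\omega$ be a non-degenerate symmetric or skew-symmetric bilinear form on $\mathbb{F}^2$. Let $S\subseteq\mathbb{F}^2$ be a set of $N$ points not contained in a single line. Then $$|\omega(S)|\geq c\min\left(N^{2/3},p\right),\qquad \omega(S)=\{\omega(s,s'): s,s'\in S\}.$$ Moreover, if $S$ has a subset $S'$ of $N'<p$ points lying on pairwise distinct lines through the origin, then $|\omega(S)|\geq cN'$. *)

theory Defs
  imports Complex_Main "HOL-Computational_Algebra.Primes" "HOL-Algebra.Multiplicative_Group"
    "HOL-Algebra.Module"
begin

text \<open>The vector space \<open>F\<^sup>2\<close>. The multiplicative fields of the module record are irrelevant.\<close>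

definition plane :: "'a ring \<Rightarrow> ('a, 'a \<times> 'a) module" where
  "plane F = \<lparr>carrier = carrier F \<times> carrier F,
    mult = undefined, one = undefined,
    zero = (\<zero>\<^bsub>F\<^esub>, \<zero>\<^bsub>F\<^esub>),
    add = (\<lambda>(x, y) (x', y'). (x \<oplus>\<^bsub>F\<^esub> x', y \<oplus>\<^bsub>F\<^esub> y')),
    smult = (\<lambda>t (x, y). (t \<otimes>\<^bsub>F\<^esub> x, t \<otimes>\<^bsub>F\<^esub> y))\<rparr>"

lemma module_plane:
  assumes "field F"
  shows "module F (plane F)"
proof -
  interpret field F by fact
  have "abelian_group (plane F)"
  proof (rule abelian_groupI)
    fix u assume "u \<in> carrier (plane F)"
    then show "\<exists>v\<in>carrier (plane F). v \<oplus>\<^bsub>plane F\<^esub> u = \<zero>\<^bsub>plane F\<^esub>"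
      by (intro bexI[of _ "(\<ominus>\<^bsub>F\<^esub> fst u, \<ominus>\<^bsub>F\<^esub> snd u)"]) (auto simp: plane_def l_neg)
  qed (auto simp: plane_def a_ac)
  then show ?thesis
    by (intro moduleI) (auto simp: plane_def l_distr r_distr m_assoc is_cring)
qed

text \<open>The additive order of \<open>1\<close> is \<open>0\<close> if it is infinite, so this is the usual convention.\<close>

definition characteristic :: "'a ring \<Rightarrow> nat" where
  "characteristic F = group.ord (add_monoid F) \<one>\<^bsub>F\<^esub>"

definition plane_lines :: "'a ring \<Rightarrow> ('a \<times> 'a) set set" where
  "plane_lines F = {{a \<oplus>\<^bsub>plane F\<^esub> (t \<odot>\<^bsub>plane F\<^esub> d) | t. t \<in> carrier F} | a d.
     a \<in> carrier (plane F) \<and> d \<in> carrier (plane F) \<and> d \<noteq> \<zero>\<^bsub>plane F\<^esub>}"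

definition lines_through_origin :: "'a ring \<Rightarrow> ('a \<times> 'a) set set" where
  "lines_through_origin F = {l \<in> plane_lines F. \<zero>\<^bsub>plane F\<^esub> \<in> l}"

definition on_distinct_lines_through_origin :: "'a ring \<Rightarrow> ('a \<times> 'a) set \<Rightarrow> bool" where
  "on_distinct_lines_through_origin F T \<longleftrightarrow>
    (\<exists>l. inj_on l T \<and> (\<forall>s\<in>T. l s \<in> lines_through_origin F \<and> s \<in> l s))"

definition bilinear_form :: "'a ring \<Rightarrow> ('a \<times> 'a \<Rightarrow> 'a \<times> 'a \<Rightarrow> 'a) \<Rightarrow> bool" where
  "bilinear_form F \<omega> \<longleftrightarrow>
    (\<forall>u\<in>carrier (plane F). \<forall>v\<in>carrier (plane F). \<omega> u v \<in> carrier F) \<and>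
    (\<forall>u\<in>carrier (plane F). \<forall>v\<in>carrier (plane F). \<forall>w\<in>carrier (plane F).
      \<omega> (u \<oplus>\<^bsub>plane F\<^esub> v) w = \<omega> u w \<oplus>\<^bsub>F\<^esub> \<omega> v w \<and>
      \<omega> w (u \<oplus>\<^bsub>plane F\<^esub> v) = \<omega> w u \<oplus>\<^bsub>F\<^esub> \<omega> w v) \<and>
    (\<forall>t\<in>carrier F. \<forall>u\<in>carrier (plane F). \<forall>v\<in>carrier (plane F).
      \<omega> (t \<odot>\<^bsub>plane F\<^esub> u) v = t \<otimes>\<^bsub>F\<^esub> \<omega> u v \<and>
      \<omega> u (t \<odot>\<^bsub>plane F\<^esub> v) = t \<otimes>\<^bsub>F\<^esub> \<omega> u v)"

definition nondegenerate_form :: "'a ring \<Rightarrow> ('a \<times> 'a \<Rightarrow> 'a \<times> 'a \<Rightarrow> 'a) \<Rightarrow> bool" where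
  "nondegenerate_form F \<omega> \<longleftrightarrow>
    (\<forall>u\<in>carrier (plane F).
      (\<forall>v\<in>carrier (plane F). \<omega> u v = \<zero>\<^bsub>F\<^esub>) \<longrightarrow> u = \<zero>\<^bsub>plane F\<^esub>) \<and>
    (\<forall>v\<in>carrier (plane F).
      (\<forall>u\<in>carrier (plane F). \<omega> u v = \<zero>\<^bsub>F\<^esub>) \<longrightarrow> v = \<zero>\<^bsub>plane F\<^esub>)"

definition symmetric_form :: "'a ring \<Rightarrow> ('a \<times> 'a \<Rightarrow> 'a \<times> 'a \<Rightarrow> 'a) \<Rightarrow> bool" where
  "symmetric_form F \<omega> \<longleftrightarrow>
    (\<forall>u\<in>carrier (plane F). \<forall>v\<in>carrier (plane F). \<omega> u v = \<omega> v u)"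

definition skew_symmetric_form :: "'a ring \<Rightarrow> ('a \<times> 'a \<Rightarrow> 'a \<times> 'a \<Rightarrow> 'a) \<Rightarrow> bool" where
  "skew_symmetric_form F \<omega> \<longleftrightarrow>
    (\<forall>u\<in>carrier (plane F). \<forall>v\<in>carrier (plane F). \<omega> u v = \<ominus>\<^bsub>F\<^esub> \<omega> v u)"

definition form_values :: "('a \<times> 'a \<Rightarrow> 'a \<times> 'a \<Rightarrow> 'a) \<Rightarrow> ('a \<times> 'a) set \<Rightarrow> 'a set" where
  "form_values \<omega> S = {\<omega> s s' | s s'. s \<in> S \<and> s' \<in> S}"

definition form_values_bound :: "real \<Rightarrow> 'a ring \<Rightarrow> bool" where
  "form_values_bound c F \<longleftrightarrow>
    (\<forall>p \<omega> S.
      prime p \<and> odd p \<and> characteristic F = p \<and>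
      bilinear_form F \<omega> \<and> nondegenerate_form F \<omega> \<and>
      (symmetric_form F \<omega> \<or> skew_symmetric_form F \<omega>) \<and>
      finite S \<and> S \<subseteq> carrier (plane F) \<and> \<not> (\<exists>l\<in>plane_lines F. S \<subseteq> l) \<longrightarrow>
        c * min (real (card S) powr (2/3)) (real p) \<le> real (card (form_values \<omega> S)) \<and>
        (\<forall>S'. S' \<subseteq> S \<and> card S' < p \<and> on_distinct_lines_through_origin F S' \<longrightarrow>
          c * real (card S') \<le> real (card (form_values \<omega> S))))"

text \<open>
  HOL cannot quantify over types below an existential quantifier, and in
  \<open>\<exists>c>0. \<forall>F :: 'a ring. field F \<longrightarrow> form_values_bound c F\<close> the number \<open>c\<close> could depend on the
  type \<open>'a\<close>. To have one number that serves the fields on all types, it is named by a closed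
  term: a positive number that works for every field whose carrier is a set of natural numbers
  (that is, up to isomorphism, for every countable field). If there is no such number, this is
  an unspecified real about which nothing can be proved. The main statement is that this number
  is positive and works for every field on every type.
\<close>

definition absolute_constant :: real where
  "absolute_constant =
    (SOME c. 0 < c \<and> (\<forall>F :: nat ring. field F \<longrightarrow> form_values_bound c F))"

end

theory Submission
  imports Defs "HOL-Computational_Algebra.Polynomial" "HOL-Algebra.Algebraic_Closure_Type"
    "HOL-Algebra.Generated_Fields" "HOL-Algebra.Weak_Morphisms" "HOL-Library.Countable_Set"
begin

text \<open>For the second bound, the fibres of \<open>\<omega>(s, -)\<close> are parallel lines in a direction determined by
  that of \<open>s\<close>, and Cauchy--Schwarz applies. The first bound counts the solutions of
  \<open>\<omega>(s, s') = \<omega>(t, t')\<close>. These are incidences of points and planes in projective space and, after a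
  generic change of coordinates over an infinite field, meetings of lines with directions
  \<open>(\<beta>\<^sup>2, \<beta>, 1)\<close> in affine space. If there were too many, one could prune to two families in
  which every line meets many lines of the other family. Let \<open>f\<close> be a nonzero polynomial of least
  degree that vanishes on all of the lines; this degree is below \<open>p\<close> and below the number of
  meetings on each line. Where two lines meet, \<open>t \<mapsto> f\<^sub>1 t\<^sup>2 + f\<^sub>2 t + f\<^sub>3\<close>, the first derivative of
  \<open>f\<close> in the direction of the line of slope \<open>t\<close>, has two roots that are also roots of the second
  derivative in that direction. So the remainder of the latter modulo the former vanishes at the
  meetings, hence on all lines. Differentiating the remainder along the surface gives a
  differential equation on a line whose solution says that the tangent planes along the line vary
  linearly. The neighbours of the line then come from collinear points, of which there are few.\<close>

hide_const (open) Polynomials.degree Divisibility.prime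

text \<open>A pair (s, t) enters the incidence problem only up to a common factor, so one projective
  point may stand for many pairs. This is why the set is thinned to D directions with exactly k
  points each: multiplicities are then at most k, and cutting them into layers costs a sum of 1 /
  sqrt i, of order sqrt k. The outcome is a bound by D * sqrt k. No direction carries more points
  than there are values, and a pigeonhole over the possible k then yields the exponent 2/3. The
  value 0 is left out of the count. With it, a point (s, t) could have many collinear neighbours
  (s', r t'), orthogonal in both components; for nonzero values, collinear neighbours are at most as
  many as directions. The vanishing degree grows like the square root of the number of points and
  must stay below p, so only about p^2 / 108 points can be treated directly. A larger family is
  replaced by a part with its share of the incidences; this produces a term with 1 / p and finally
  the p in the minimum. The infinite field that generic coordinates require is the algebraic
  closure.\<close>

section \<open>Derivations and ring homomorphisms on iterated polynomials\<close>

definition derivation :: "('r::comm_ring_1 \<Rightarrow> 'r) \<Rightarrow> bool" where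
  "derivation D \<longleftrightarrow> (\<forall>x y. D (x + y) = D x + D y \<and> D (x * y) = D x * y + x * D y)"

lemma derivationD:
  assumes "derivation D"
  shows "D (x + y) = D x + D y" "D (x * y) = D x * y + x * D y" "D 0 = 0" "D 1 = 0"
    "D (- x) = - D x" "D (x - y) = D x - D y" "D (sum g I) = (\<Sum>i\<in>I. D (g i))"
    "D (of_nat n * x) = of_nat n * D x"
proof -
  show a: "D (x + y) = D x + D y" and m: "D (x * y) = D x * y + x * D y" for x y
    using assms by (auto simp: derivation_def)
  show z: "D 0 = 0"
    using a[of 0 0] by simp
  show "D 1 = 0"
    using m[of 1 1] by simp
  show neg: "D (- x) = - D x" for x
    using a[of x "- x"] z by (simp add: add_eq_0_iff)
  show "D (x - y) = D x - D y"
    using a[of x "- y"] neg by simp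
  show "D (sum g I) = (\<Sum>i\<in>I. D (g i))"
    by (induction I rule: infinite_finite_induct) (auto simp: a z)
  show "D (of_nat n * x) = of_nat n * D x"
    by (induction n) (auto simp: z a algebra_simps)
qed

lemma derivation_add:
  assumes "derivation D" "derivation D'"
  shows "derivation (\<lambda>x. D x + D' x)"
  using assms unfolding derivation_def by (simp add: algebra_simps)

lemma derivation_scale:
  assumes "derivation D"
  shows "derivation (\<lambda>x. k * D x)"
  using assms unfolding derivation_def by (simp add: algebra_simps)

lemma derivation_pderiv: "derivation (pderiv :: 'a::idom poly \<Rightarrow> _)"
  by (simp add: derivation_def pderiv_add pderiv_mult algebra_simps)

text \<open>The Leibniz rule holds term by term in the convolution that defines a product. This
  makes partial derivatives in the inner variables of iterated polynomials available.\<close>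

lemma derivation_map_poly:
  assumes "derivation D"
  shows "derivation (map_poly D)"
proof -
  note d = derivationD[OF assms]
  have c: "coeff (map_poly D p) n = D (coeff p n)" for p n
    by (simp add: coeff_map_poly d)
  show ?thesis
    unfolding derivation_def
    by (auto simp: poly_eq_iff c d coeff_mult sum.distrib)
qed

lemma pderiv_map_poly_derivation:
  assumes "derivation (D :: 'a::idom \<Rightarrow> 'a)"
  shows "pderiv (map_poly D p) = map_poly D (pderiv p)"
  by (simp only: poly_eq_iff coeff_pderiv coeff_map_poly derivationD(3,8)[OF assms]) simp

lemma map_poly_derivation_commute:
  assumes "\<And>x. D (D' x) = D' (D x)" "derivation D" "derivation D'"
  shows "map_poly D (map_poly D' p) = map_poly D' (map_poly D p)"
  by (simp add: poly_eq_iff coeff_map_poly derivationD(3)[OF assms(2)] derivationD(3)[OF assms(3)] assms(1))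

definition ring_map :: "('r::comm_ring_1 \<Rightarrow> 's::comm_ring_1) \<Rightarrow> bool" where
  "ring_map g \<longleftrightarrow> g 1 = 1 \<and> (\<forall>x y. g (x + y) = g x + g y \<and> g (x * y) = g x * g y)"

lemma ring_mapD:
  assumes "ring_map g"
  shows "g (x + y) = g x + g y" "g (x * y) = g x * g y" "g 0 = 0" "g 1 = 1"
    "g (- x) = - g x" "g (x - y) = g x - g y" "g (x ^ n) = g x ^ n" "g (sum h I) = (\<Sum>i\<in>I. g (h i))"
    "g (numeral k) = numeral k"
proof -
  show a: "g (x + y) = g x + g y" and "g (x * y) = g x * g y" and o: "g 1 = 1" for x y
    using assms by (auto simp: ring_map_def)
  then have m: "\<And>x y. g (x * y) = g x * g y"
    using assms by (auto simp: ring_map_def)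
  show z: "g 0 = 0"
    using a[of 0 0] by simp
  show neg: "g (- x) = - g x" for x
    using a[of x "- x"] z by (simp add: add_eq_0_iff)
  show "g (x - y) = g x - g y"
    using a[of x "- y"] neg by simp
  show "g (x ^ n) = g x ^ n"
    by (induction n) (auto simp: o m)
  show "g (sum h I) = (\<Sum>i\<in>I. g (h i))"
    by (induction I rule: infinite_finite_induct) (auto simp: a z)
  have "g (of_nat n) = of_nat n" for n
    by (induction n) (auto simp: z a o)
  from this[of "numeral k"] show "g (numeral k) = numeral k"
    by simp
qed

lemma ring_map_poly_map_poly:
  assumes "ring_map g"
  shows "ring_map (\<lambda>p. poly (map_poly g p) c)"
proof -
  note h = ring_mapD[OF assms]
  have c: "coeff (map_poly g p) n = g (coeff p n)" for p n
    by (simp add: coeff_map_poly h)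
  have "map_poly g (p + q) = map_poly g p + map_poly g q"
    "map_poly g (p * q) = map_poly g p * map_poly g q" "map_poly g 1 = 1" for p q
    by (auto simp: poly_eq_iff c h coeff_mult)
  then show ?thesis
    by (simp add: ring_map_def)
qed

lemma ring_map_pcompose: "ring_map (\<lambda>p. pcompose p q)"
proof -
  have "pcompose 1 q = 1"
    by (simp add: one_pCons)
  then show ?thesis
    by (simp add: ring_map_def pcompose_add pcompose_mult)
qed

lemma poly_poly_map_poly:
  assumes "ring_map g"
  shows "poly (poly (map_poly g p) c) u = poly (map_poly (\<lambda>x. poly (g x) u) p) (poly c u)"
  using assms by (induction p) (auto simp: map_poly_pCons ring_mapD)

section \<open>Polynomials in three variables, their partial derivatives and restrictions to
  curves\<close>

type_synonym 'k poly3 = "'k poly poly poly"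

definition const3 :: "'k::field \<Rightarrow> 'k poly3" where
  "const3 k = [:[:[:k:]:]:]"

text \<open>The outermost variable of \<open>'k poly3\<close> is z and the innermost is x, so
  derivatives in y and x are mapped over one or two levels of coefficients.\<close>

definition dz :: "'k::field poly3 \<Rightarrow> 'k poly3" where "dz = pderiv"
definition dy :: "'k::field poly3 \<Rightarrow> 'k poly3" where "dy = map_poly pderiv"
definition dx :: "'k::field poly3 \<Rightarrow> 'k poly3" where "dx = map_poly (map_poly pderiv)"

lemma derivation_dx: "derivation dx" and derivation_dy: "derivation dy" and derivation_dz: "derivation dz"
  by (simp_all add: dx_def dy_def dz_def derivation_map_poly derivation_pderiv)

lemma dx_dy: "dx (dy h) = dy (dx h)" and dx_dz: "dx (dz h) = dz (dx h)" and dy_dz: "dy (dz h) = dz (dy h)"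
  by (simp_all add: dx_def dy_def dz_def derivation_map_poly derivation_pderiv
      pderiv_map_poly_derivation map_poly_derivation_commute)

lemma deriv_const3 [simp]: "dx (const3 k) = 0" "dy (const3 k) = 0" "dz (const3 k) = 0"
  by (simp_all add: dx_def dy_def dz_def const3_def map_poly_pCons pderiv_pCons)

definition eval3 :: "'k::field \<Rightarrow> 'k \<Rightarrow> 'k \<Rightarrow> 'k poly3 \<Rightarrow> 'k" where
  "eval3 x y z h = poly (map_poly (\<lambda>g. poly (map_poly (\<lambda>e. poly e x) g) y) h) z"

definition subst3 :: "'k::field poly \<Rightarrow> 'k poly \<Rightarrow> 'k poly \<Rightarrow> 'k poly3 \<Rightarrow> 'k poly" where
  "subst3 px py pz h = poly (map_poly (\<lambda>g. poly (map_poly (\<lambda>e. pcompose e px) g) py) h) pz"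

lemma ring_map_subst3: "ring_map (subst3 px py pz)"
  unfolding subst3_def by (intro ring_map_poly_map_poly ring_map_pcompose)

lemma poly_subst3: "poly (subst3 px py pz h) u = eval3 (poly px u) (poly py u) (poly pz u) h"
  by (simp add: subst3_def eval3_def poly_poly_map_poly ring_map_poly_map_poly ring_map_pcompose poly_pcompose)

lemma subst3_const3 [simp]: "subst3 px py pz (const3 k) = [:k:]"
  by (simp add: subst3_def const3_def map_poly_pCons)

text \<open>Chain rule in the two inner variables; it is the coefficient step in the induction over
  the outer variable that gives the full rule.\<close>

lemma pderiv_subst3_1:
  fixes px py :: "'k::field poly"
  shows "pderiv (poly (map_poly (\<lambda>e. pcompose e px) g) py)
    = pderiv px * poly (map_poly (\<lambda>e. pcompose e px) (map_poly pderiv g)) py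
      + pderiv py * poly (map_poly (\<lambda>e. pcompose e px) (pderiv g)) py"
proof (induction g)
  case 0
  then show ?case
    by simp
next
  case (pCons x p)
  note g = ring_mapD(1)[OF ring_map_poly_map_poly[OF ring_map_pcompose]]
  show ?case
    by (simp add: map_poly_pCons pderiv_add pderiv_mult pCons.IH pderiv_pCons pderiv_pcompose g
        algebra_simps)
qed

lemma pderiv_subst3:
  "pderiv (subst3 px py pz h) = pderiv px * subst3 px py pz (dx h) + pderiv py * subst3 px py pz (dy h)
     + pderiv pz * subst3 px py pz (dz h)"
  unfolding subst3_def dx_def dy_def dz_def
proof (induction h)
  case 0
  then show ?case
    by simp
next
  case (pCons x p)
  note g = ring_mapD(1)[OF ring_map_poly_map_poly[OF ring_map_poly_map_poly[OF ring_map_pcompose]]]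
  show ?case
    by (simp add: map_poly_pCons pderiv_add pderiv_mult pCons.IH pderiv_pCons pderiv_subst3_1 g
        algebra_simps)
qed

section \<open>Total degree\<close>

text \<open>Only upper bounds on the total degree are ever required. Generating the bounded
  polynomials from constants and variables reduces every closure property to rule induction.\<close>

inductive total_degree_le :: "'k::field poly3 \<Rightarrow> nat \<Rightarrow> bool" where
  const: "total_degree_le (const3 k) n"
| x: "total_degree_le [:[:[:0, 1:]:]:] (Suc n)"
| y: "total_degree_le [:[:0, 1:]:] (Suc n)"
| z: "total_degree_le [:0, 1:] (Suc n)"
| add: "total_degree_le g n \<Longrightarrow> total_degree_le h n \<Longrightarrow> total_degree_le (g + h) n"
| mult: "total_degree_le g m \<Longrightarrow> total_degree_le h n \<Longrightarrow> total_degree_le (g * h) (m + n)"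

lemma total_degree_le_mono: "total_degree_le g m \<Longrightarrow> m \<le> n \<Longrightarrow> total_degree_le g n"
proof (induction arbitrary: n rule: total_degree_le.induct)
  case (mult g m1 h m2)
  from mult.prems have "total_degree_le (g * h) (m1 + (n - m1))"
    by (intro total_degree_le.mult mult) auto
  then show ?case
    using mult.prems by simp
next
  case (x m n) then show ?case by (cases n) (auto intro: total_degree_le.intros)
next
  case (y m n) then show ?case by (cases n) (auto intro: total_degree_le.intros)
next
  case (z m n) then show ?case by (cases n) (auto intro: total_degree_le.intros)
qed (auto intro: total_degree_le.intros)

lemma total_degree_le_0 [simp]: "total_degree_le 0 n"
  using total_degree_le.const[of 0] by (simp add: const3_def)

lemma total_degree_le_1 [simp]: "total_degree_le 1 n"
  using total_degree_le.const[of 1] by (simp add: const3_def one_pCons)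

lemma total_degree_le_minus: "total_degree_le g n \<Longrightarrow> total_degree_le (- g) n"
proof -
  assume g: "total_degree_le g n"
  have "const3 (-1) = (-1 :: 'a poly3)"
    by (simp add: const3_def one_pCons)
  then show ?thesis
    using total_degree_le.mult[OF total_degree_le.const[of "-1" 0] g] by simp
qed

lemma total_degree_le_diff: "total_degree_le g n \<Longrightarrow> total_degree_le h n \<Longrightarrow> total_degree_le (g - h) n"
  using total_degree_le.add[of g n "- h"] total_degree_le_minus[of h n] by simp

lemma total_degree_le_numeral_mult:
  "total_degree_le g n \<Longrightarrow> total_degree_le (numeral k * g) n"
  using total_degree_le.mult[OF total_degree_le.const[of "numeral k" 0], of g n]
  by (simp add: const3_def numeral_poly)

lemma total_degree_le_sum: "(\<And>i. i \<in> I \<Longrightarrow> total_degree_le (g i) n) \<Longrightarrow> total_degree_le (sum g I) n"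
  by (induction I rule: infinite_finite_induct) (auto intro: total_degree_le.add)

lemma total_degree_le_power: "total_degree_le g n \<Longrightarrow> total_degree_le (g ^ k) (k * n)"
  by (induction k) (auto intro: total_degree_le.mult)

text \<open>The conjunct for \<open>n = 0\<close> is forced by truncated subtraction: in
  \<open>D g * h\<close> with bound 0 on \<open>g\<close>, the bound \<open>m + n - 1\<close> holds
  only because \<open>D g\<close> is zero.\<close>

lemma total_degree_le_deriv_aux:
  fixes D :: "'k::field poly3 \<Rightarrow> 'k poly3"
  assumes D: "derivation D" "\<And>k. D (const3 k) = 0"
    and vars: "\<And>n. total_degree_le (D [:[:[:0, 1:]:]:]) n" "\<And>n. total_degree_le (D [:[:0, 1:]:]) n"
      "\<And>n. total_degree_le (D [:0, 1:]) n"
    and g: "total_degree_le g n"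
  shows "(n = 0 \<longrightarrow> D g = 0) \<and> total_degree_le (D g) (n - 1)"
  using g
proof induction
  case (mult g m h n)
  have "total_degree_le (D g * h) (m + n - 1)"
  proof (cases "m = 0")
    case True
    then show ?thesis
      using mult.IH by simp
  next
    case False
    then show ?thesis
      using mult total_degree_le.mult[of "D g" "m - 1" h n] by simp
  qed
  moreover have "total_degree_le (g * D h) (m + n - 1)"
  proof (cases "n = 0")
    case True
    then show ?thesis
      using mult.IH by simp
  next
    case False
    then show ?thesis
      using mult total_degree_le.mult[of g m "D h" "n - 1"] by simp
  qed
  ultimately show ?case
    using mult.IH by (auto simp: derivationD[OF D(1)] intro: total_degree_le.add)
qed (auto simp: derivationD[OF D(1)] D(2) vars intro: total_degree_le.intros)

lemma total_degree_le_deriv: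
  assumes "total_degree_le g n"
  shows "total_degree_le (dx g) (n - 1)" "total_degree_le (dy g) (n - 1)" "total_degree_le (dz g) (n - 1)"
proof -
  have x: "dx [:[:[:0, 1:]:]:] = (1 :: 'a poly3)" "dy [:[:[:0, 1:]:]:] = (0 :: 'a poly3)"
      "dz [:[:[:0, 1:]:]:] = (0 :: 'a poly3)"
    by (simp_all add: dx_def dy_def dz_def map_poly_pCons pderiv_pCons one_pCons)
  have y: "dx [:[:0, 1:]:] = (0 :: 'a poly3)" "dy [:[:0, 1:]:] = (1 :: 'a poly3)"
      "dz [:[:0, 1:]:] = (0 :: 'a poly3)"
    by (simp_all add: dx_def dy_def dz_def map_poly_pCons pderiv_pCons one_pCons)
  have z: "dx [:0, 1:] = (0 :: 'a poly3)" "dy [:0, 1:] = (0 :: 'a poly3)"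
      "dz [:0, 1:] = (1 :: 'a poly3)"
    by (simp_all add: dx_def dy_def dz_def map_poly_pCons pderiv_pCons one_pCons)
  show "total_degree_le (dx g) (n - 1)"
    by (rule total_degree_le_deriv_aux[OF derivation_dx _ _ _ _ assms, THEN conjunct2])
      (simp_all add: x y z)
  show "total_degree_le (dy g) (n - 1)"
    by (rule total_degree_le_deriv_aux[OF derivation_dy _ _ _ _ assms, THEN conjunct2])
      (simp_all add: x y z)
  show "total_degree_le (dz g) (n - 1)"
    by (rule total_degree_le_deriv_aux[OF derivation_dz _ _ _ _ assms, THEN conjunct2])
      (simp_all add: x y z)
qed

lemma degree_subst3_le:
  assumes "degree px \<le> 1" "degree py \<le> 1" "degree pz \<le> 1" "total_degree_le h n"
  shows "degree (subst3 px py pz h) \<le> n"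
  using assms(4)
proof induction
  case (add g n h)
  then show ?case
    by (simp add: ring_mapD[OF ring_map_subst3] degree_add_le)
next
  case (mult g m h n)
  then show ?case
    by (simp add: ring_mapD[OF ring_map_subst3]) (meson add_mono degree_mult_le le_trans)
qed (use assms(1-3) in \<open>auto simp: subst3_def map_poly_pCons const3_def pcompose_pCons one_pCons\<close>)

lemma total_degree_le_degrees:
  assumes "total_degree_le h n"
  shows "degree h \<le> n \<and> degree (coeff h i) \<le> n \<and> degree (coeff (coeff h i) j) \<le> n"
  using assms
proof (induction arbitrary: i j)
  case (add g n h)
  then show ?case
    by (simp add: degree_add_le)
next
  case (mult g m h n)
  have 1: "degree (g * h) \<le> m + n"
    by (rule order.trans[OF degree_mult_le]) (simp add: add_mono mult.IH)
  have 2: "degree (coeff (g * h) i) \<le> m + n"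
    unfolding coeff_mult by (intro degree_sum_le order.trans[OF degree_mult_le]) (auto simp: add_mono mult.IH)
  have 3: "degree (coeff (coeff (g * h) i) j) \<le> m + n"
    unfolding coeff_mult coeff_sum
    by (intro degree_sum_le order.trans[OF degree_mult_le]) (auto simp: add_mono mult.IH)
  from 1 2 3 show ?case
    by simp
qed (auto simp: const3_def coeff_pCons split: nat.split)

section \<open>Vanishing derivatives in positive characteristic\<close>

lemma pderiv_eq_0_imp_degree_0:
  fixes g :: "'a::idom poly"
  assumes "pderiv g = 0" "degree g < CHAR('a)"
  shows "degree g = 0"
proof (rule ccontr)
  assume "degree g \<noteq> 0"
  then obtain k where k: "degree g = Suc k"
    using not0_implies_Suc by blast
  have "of_nat (Suc k) * coeff g (Suc k) = 0"
    using arg_cong[OF assms(1), of "\<lambda>h. coeff h k"] by (simp add: coeff_pderiv)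
  moreover have "of_nat (Suc k) \<noteq> (0::'a)"
    using assms(2) k by (simp del: of_nat_Suc add: of_nat_eq_0_iff_char_dvd nat_dvd_not_less)
  ultimately show False
    using k by (metis leading_coeff_0_iff degree_0 mult_eq_0_iff nat.distinct(1))
qed

text \<open>The variables are peeled off from the outside: each vanishing derivative forces degree 0
  in its variable, because degrees below the characteristic exclude p-th powers.\<close>

lemma all_derivs_0_imp_const3:
  fixes h :: "'k::field poly3"
  assumes "dx h = 0" "dy h = 0" "dz h = 0" "total_degree_le h n" "n < CHAR('k)"
  shows "\<exists>k. h = const3 k"
proof -
  note deg = total_degree_le_degrees[OF assms(4)]
  have "degree h = 0"
    using assms deg by (intro pderiv_eq_0_imp_degree_0) (auto simp: dz_def intro: le_less_trans)
  then obtain h1 where h1: "h = [:h1:]"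
    using degree_eq_zeroE by blast
  have "degree h1 = 0"
    using assms deg[of 0] h1
    by (intro pderiv_eq_0_imp_degree_0) (auto simp: dy_def map_poly_pCons intro: le_less_trans)
  then obtain h2 where h2: "h1 = [:h2:]"
    using degree_eq_zeroE by blast
  have "degree h2 = 0"
    using assms deg[of 0 0] h1 h2
    by (intro pderiv_eq_0_imp_degree_0) (auto simp: dx_def map_poly_pCons intro: le_less_trans)
  then obtain k where "h2 = [:k:]"
    using degree_eq_zeroE by blast
  then show ?thesis
    using h1 h2 by (auto simp: const3_def)
qed

text \<open>In characteristic \<open>p\<close> a vanishing derivative of \<open>g / h\<close> forces \<open>g / h\<close> to be constant only
  for degrees below \<open>p\<close>.\<close>

lemma wronskian_eq_0_imp_smult:
  fixes g h :: "'k::field poly"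
  assumes W: "pderiv g * h = g * pderiv h" and h: "h \<noteq> 0"
    and deg: "degree g < CHAR('k)" "degree h < CHAR('k)"
  shows "\<exists>k. g = smult k h"
proof -
  \<comment> \<open>Comparing the coefficients of degree \<open>?m + ?n - 1\<close> gives
    \<open>?m = ?n\<close> in the field; as both are below the characteristic, they are equal as
    numbers.\<close>
  have key: "degree g' = degree h" if W: "pderiv g' * h = g' * pderiv h" and "g' \<noteq> 0"
    and deg': "degree g' < CHAR('k)" for g' :: "'k poly"
  proof (rule ccontr)
    assume ne: "degree g' \<noteq> degree h"
    let ?m = "degree g'" and ?n = "degree h"
    have c: "coeff (pderiv u * v) (degree u + degree v - 1) = of_nat (degree u) * lead_coeff u * lead_coeff v"
      if "degree u + degree v > 0" for u v :: "'k poly"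
    proof (cases "degree u = 0")
      case True
      then show ?thesis
        by (metis degree_eq_zeroE mult_zero_left of_nat_0 coeff_0 pderiv_pCons pderiv_0 pCons_0_0 add_0)
    next
      case False
      then have "degree (pderiv u) \<le> degree u - 1"
        by (intro degree_le allI impI) (simp add: coeff_pderiv coeff_eq_0)
      then have "coeff (pderiv u * v) (degree u - 1 + degree v) = coeff (pderiv u) (degree u - 1) * lead_coeff v"
      proof (cases "degree (pderiv u) = degree u - 1")
        case True
        then show ?thesis
          by (metis coeff_mult_degree_sum)
      next
        case False
        with \<open>degree (pderiv u) \<le> degree u - 1\<close> have "degree (pderiv u) < degree u - 1"
          by simp
        then show ?thesis
          by (simp add: coeff_eq_0 le_less_trans[OF degree_mult_le])
      qed
      then show ?thesis
        using False by (simp add: coeff_pderiv flip: of_nat_Suc)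
    qed
    from ne have pos: "?m + ?n > 0"
      by auto
    have "of_nat ?m * lead_coeff g' * lead_coeff h = of_nat ?n * lead_coeff h * lead_coeff g'"
      using c[OF pos] c[of h g'] pos W by (auto simp: mult.commute add.commute)
    then have "of_nat ?m = (of_nat ?n :: 'k)"
      using h \<open>g' \<noteq> 0\<close> by (simp add: mult.assoc mult.commute[of "lead_coeff h"])
    then show False
    proof (cases "?m < ?n")
      case True
      then have "of_nat (?n - ?m) = (0::'k)"
        using \<open>of_nat ?m = (of_nat ?n :: 'k)\<close> by (simp add: of_nat_diff)
      then have "CHAR('k) dvd ?n - ?m"
        by (simp only: of_nat_eq_0_iff_char_dvd)
      then show False
        using True deg(2) by (auto dest: dvd_imp_le)
    next
      case False
      then have "of_nat (?m - ?n) = (0::'k)"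
        using \<open>of_nat ?m = (of_nat ?n :: 'k)\<close> by (simp add: of_nat_diff)
      then have "CHAR('k) dvd ?m - ?n"
        by (simp only: of_nat_eq_0_iff_char_dvd)
      then show False
        using False ne deg' by (auto dest: dvd_imp_le)
    qed
  qed
  \<comment> \<open>Cancelling the leading term leaves a solution of the same equation whose degree
    differs from that of \<open>h\<close>. By \<open>key\<close> only 0 is such a solution.\<close>
  define k where "k = lead_coeff g / lead_coeff h"
  define r where "r = g - smult k h"
  have "r = 0"
  proof (rule ccontr)
    assume r: "r \<noteq> 0"
    have g0: "g \<noteq> 0"
      using r by (auto simp: r_def k_def)
    then have gh: "degree g = degree h"
      using key W deg by blast
    have "degree r \<le> degree h"
      using gh by (simp add: r_def degree_diff_le)
    moreover have "coeff r (degree h) = 0"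
      using h gh by (simp add: r_def k_def)
    ultimately have "degree r \<noteq> degree h"
      using r by (metis leading_coeff_0_iff)
    moreover have "pderiv r * h = r * pderiv h"
      using W by (simp add: r_def pderiv_diff pderiv_smult algebra_simps)
    moreover have "degree r < CHAR('k)"
      using \<open>degree r \<le> degree h\<close> deg by simp
    ultimately show False
      using key r by blast
  qed
  then show ?thesis
    by (auto simp: r_def)
qed

text \<open>Gaussian elimination, one equation at a time: the unknown \<open>i0\<close> with a
  nonzero coefficient is solved for, and \<open>M'\<close> is the system after substituting
  it.\<close>

lemma exists_nontrivial_solution:
  fixes M :: "'j \<Rightarrow> 'i \<Rightarrow> 'k::field"
  assumes "finite J" "finite I" "card J < card I"
  shows "\<exists>c. (\<exists>i\<in>I. c i \<noteq> 0) \<and> (\<forall>j\<in>J. (\<Sum>i\<in>I. c i * M j i) = 0)"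
  using assms
proof (induction J arbitrary: I M rule: finite_induct)
  case empty
  then obtain i where "i \<in> I"
    by (metis card_gt_0_iff card.empty all_not_in_conv)
  then show ?case
    by (intro exI[of _ "\<lambda>_. 1"]) auto
next
  case (insert j J)
  show ?case
  proof (cases "\<forall>i\<in>I. M j i = 0")
    case True
    obtain c where c: "\<exists>i\<in>I. c i \<noteq> 0" "\<forall>j\<in>J. (\<Sum>i\<in>I. c i * M j i) = 0"
      using insert.IH[of I M] insert.prems insert.hyps by auto
    then show ?thesis
      using True by (intro exI[of _ c]) auto
  next
    case False
    then obtain i0 where i0: "i0 \<in> I" "M j i0 \<noteq> 0"
      by blast
    define I' where "I' = I - {i0}"
    define M' where "M' j' i = M j' i - M j i / M j i0 * M j' i0" for j' i
    have "card J < card I'"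
      using insert.prems insert.hyps i0 by (simp add: I'_def)
    then obtain c where c: "\<exists>i\<in>I'. c i \<noteq> 0" "\<forall>j\<in>J. (\<Sum>i\<in>I'. c i * M' j i) = 0"
      using insert.IH[of I' M'] insert.prems by (auto simp: I'_def)
    define s where "s = (\<Sum>i\<in>I'. c i * M j i) / M j i0"
    define c' where "c' = c(i0 := - s)"
    have split: "(\<Sum>i\<in>I. c' i * M j' i) = (\<Sum>i\<in>I'. c i * M j' i) - s * M j' i0" for j'
    proof -
      have "(\<Sum>i\<in>I. c' i * M j' i) = c' i0 * M j' i0 + (\<Sum>i\<in>I'. c' i * M j' i)"
        unfolding I'_def using i0 insert.prems by (simp add: sum.remove)
      also have "(\<Sum>i\<in>I'. c' i * M j' i) = (\<Sum>i\<in>I'. c i * M j' i)"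
        by (rule sum.cong) (auto simp: c'_def I'_def)
      finally show ?thesis
        by (simp add: c'_def)
    qed
    have "(\<Sum>i\<in>I. c' i * M j' i) = 0" if "j' \<in> J" for j'
    proof -
      have "(\<Sum>i\<in>I'. c i * M' j' i) = (\<Sum>i\<in>I'. c i * M j' i) - s * M j' i0"
        by (simp add: M'_def s_def algebra_simps sum_subtractf sum_distrib_left sum_divide_distrib)
      then show ?thesis
        using split c(2) that by simp
    qed
    moreover have "(\<Sum>i\<in>I. c' i * M j i) = 0"
      using i0 by (simp add: split s_def)
    moreover have "\<exists>i\<in>I. c' i \<noteq> 0"
      using c(1) by (auto simp: c'_def I'_def)
    ultimately show ?thesis
      by (intro exI[of _ c']) auto
  qed
qed

section \<open>Isotropic lines in affine space and their meetings\<close>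

text \<open>The triple \<open>(\<beta>, b, e)\<close> stands for the line through \<open>(e + \<beta> b, b, 0)\<close> with the
  isotropic direction \<open>(\<beta>\<^sup>2, \<beta>, 1)\<close>, and for the point \<open>(1, \<beta>, b, e)\<close> of projective space. Two
  lines of different slopes meet iff the points are orthogonal for the standard symplectic form.\<close>

type_synonym 'k line = "'k \<times> 'k \<times> 'k"

definition slope :: "'k line \<Rightarrow> 'k" where "slope l = fst l"
definition yint :: "'k line \<Rightarrow> 'k" where "yint l = fst (snd l)"

definition line_symp :: "'k::field line \<Rightarrow> 'k line \<Rightarrow> 'k" where
  "line_symp = (\<lambda>(\<beta>, b, e) (\<beta>', b', e'). e - b * \<beta>' + \<beta> * b' - e')"

text \<open>The third coordinate serves as the parameter. Hence two meeting lines reach their common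
  point at the same parameter, and \<open>meet_at\<close> can be read on either of them.\<close>

definition on_line :: "'k::field line \<Rightarrow> 'k poly3 \<Rightarrow> 'k poly" where
  "on_line = (\<lambda>(\<beta>, b, e). subst3 [:e + \<beta> * b, \<beta>\<^sup>2:] [:b, \<beta>:] [:0, 1:])"

definition meet_at :: "'k::field line \<Rightarrow> 'k line \<Rightarrow> 'k" where
  "meet_at l m = (yint l - yint m) / (slope m - slope l)"

lemma ring_map_on_line: "ring_map (on_line l)"
  by (auto simp: on_line_def ring_map_subst3 split: prod.split)

lemmas on_line_hom = ring_mapD[OF ring_map_on_line]

lemma on_line_const3 [simp]: "on_line l (const3 k) = [:k:]"
  by (auto simp: on_line_def split: prod.split)

lemma degree_on_line_le: "total_degree_le h n \<Longrightarrow> degree (on_line l h) \<le> n"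
  by (auto simp: on_line_def split: prod.split intro!: degree_subst3_le)

lemma poly_on_line_meet_at:
  assumes "line_symp l m = 0" "slope l \<noteq> slope m"
  shows "poly (on_line l h) (meet_at l m) = poly (on_line m h) (meet_at l m)"
proof -
  obtain \<beta> b e where l: "l = (\<beta>, b, e)"
    by (cases l)
  obtain \<beta>' b' e' where m: "m = (\<beta>', b', e')"
    by (cases m)
  define u where "u = meet_at l m"
  have ne: "\<beta>' - \<beta> \<noteq> 0" and om: "e - b * \<beta>' + \<beta> * b' - e' = 0"
    using assms by (auto simp: l m line_symp_def slope_def)
  have u: "u * (\<beta>' - \<beta>) = b - b'"
    using ne by (simp add: u_def meet_at_def l m slope_def yint_def)
  have y: "b + \<beta> * u = b' + \<beta>' * u"
    using u by (simp add: algebra_simps)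
  have "(e + \<beta> * b + \<beta>\<^sup>2 * u) - (e' + \<beta>' * b' + \<beta>'\<^sup>2 * u)
      = (e - b * \<beta>' + \<beta> * b' - e') + (\<beta> + \<beta>') * ((b - b') - u * (\<beta>' - \<beta>))"
    by (simp add: algebra_simps power2_eq_square)
  then have x: "e + \<beta> * b + \<beta>\<^sup>2 * u = e' + \<beta>' * b' + \<beta>'\<^sup>2 * u"
    using om u by simp
  show ?thesis
    unfolding u_def[symmetric] using x y
    by (simp add: l m on_line_def poly_subst3 mult.commute)
qed

text \<open>Isotropic lines through one point are pairwise orthogonal. Used in the contrapositive:
  pairwise non-orthogonal neighbours of a line meet it in distinct points.\<close>

lemma meet_eq_imp_symp:
  assumes "line_symp l m = 0" "slope l \<noteq> slope m" "line_symp l m' = 0" "slope l \<noteq> slope m'" "meet_at l m = meet_at l m'"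
  shows "line_symp m m' = 0"
proof -
  obtain \<beta> b e where l: "l = (\<beta>, b, e)"
    by (cases l)
  obtain \<beta>1 b1 e1 where m: "m = (\<beta>1, b1, e1)"
    by (cases m)
  obtain \<beta>2 b2 e2 where m': "m' = (\<beta>2, b2, e2)"
    by (cases m')
  define u where "u = meet_at l m"
  have ne: "\<beta>1 - \<beta> \<noteq> 0" "\<beta>2 - \<beta> \<noteq> 0" and om: "e - b * \<beta>1 + \<beta> * b1 - e1 = 0" "e - b * \<beta>2 + \<beta> * b2 - e2 = 0"
    using assms by (auto simp: l m m' line_symp_def slope_def)
  have "u * (\<beta>1 - \<beta>) = b - b1"
    using ne by (simp add: u_def meet_at_def l m slope_def yint_def)
  moreover have "u * (\<beta>2 - \<beta>) = b - b2"
    using ne assms(5) by (simp add: u_def meet_at_def l m' slope_def yint_def)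
  ultimately have b: "b1 = b - u * (\<beta>1 - \<beta>)" "b2 = b - u * (\<beta>2 - \<beta>)"
    by auto
  have e: "e1 = e - b * \<beta>1 + \<beta> * b1" "e2 = e - b * \<beta>2 + \<beta> * b2"
    using om by (auto simp: algebra_simps)
  show ?thesis
    by (simp add: m m' line_symp_def e b algebra_simps)
qed

lemma pderiv_on_line:
  "pderiv (on_line l h) = on_line l (const3 ((slope l)\<^sup>2) * dx h + const3 (slope l) * dy h + dz h)"
  by (cases l) (simp add: on_line_hom, simp add: on_line_def slope_def pderiv_subst3 pderiv_pCons algebra_simps)

text \<open>Parameter counting: degree at most \<open>m\<close> in each variable leaves
  \<open>(m + 1) ^ 3\<close> coefficients, and each line imposes \<open>3 * m + 1\<close> linear
  conditions, one per coefficient of the restriction. The degree is thus of the order of the square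
  root of \<open>card A\<close>.\<close>

lemma exists_poly3_vanishing_on_lines:
  fixes A :: "'k::field line set"
  assumes A: "finite A" and m: "3 * card A \<le> (m + 1)\<^sup>2"
  shows "\<exists>f. f \<noteq> 0 \<and> total_degree_le f (3 * m) \<and> (\<forall>l\<in>A. on_line l f = 0)"
proof -
  define I where "I = {..m} \<times> {..m} \<times> {..m}"
  define mon :: "nat \<times> nat \<times> nat \<Rightarrow> 'k poly3" where
    "mon = (\<lambda>(i, j, k). [:[:[:0, 1:]:]:] ^ i * [:[:0, 1:]:] ^ j * [:0, 1:] ^ k)"
  have mon: "mon (i, j, k) = monom (monom (monom 1 i) j) k" for i j k
  proof -
    have "[:[:[:0, 1:]:]:] ^ i = ([:[:monom 1 i:]:] :: 'k poly3)"
      by (induction i) (simp_all add: monom_Suc monom_0 flip: one_pCons)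
    moreover have "[:[:0, 1:]:] ^ j = ([:monom 1 j:] :: 'k poly3)"
      by (induction j) (simp_all add: monom_Suc monom_0 flip: one_pCons)
    moreover have "[:0, 1:] ^ k = (monom 1 k :: 'k poly3)"
      by (induction k) (simp_all add: monom_Suc monom_0 flip: one_pCons)
    ultimately show ?thesis
      by (simp add: mon_def smult_monom)
  qed
  define M where "M = (\<lambda>(l, r) x. coeff (on_line l (mon x)) r)"
  have "card (A \<times> {..3 * m}) < card I"
  proof (cases "card A = 0")
    case True
    then show ?thesis
      by (simp add: I_def card_cartesian_product)
  next
    case False
    have "card (A \<times> {..3 * m}) = card A * (3 * m + 1)"
      by (simp add: card_cartesian_product)
    also have "\<dots> < card A * (3 * (m + 1))"
      using False by (intro mult_strict_left_mono) auto
    also have "\<dots> \<le> (m + 1)\<^sup>2 * (m + 1)"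
      using mult_le_mono1[OF m, of "m + 1"] by (simp add: mult.commute mult.left_commute)
    also have "\<dots> = card I"
      by (simp add: I_def card_cartesian_product power2_eq_square)
    finally show ?thesis .
  qed
  then obtain c where c: "\<exists>x\<in>I. c x \<noteq> 0" "\<forall>j\<in>A \<times> {..3 * m}. (\<Sum>x\<in>I. c x * M j x) = 0"
    using exists_nontrivial_solution[of "A \<times> {..3 * m}" I M] A by (auto simp: I_def)
  define f where "f = (\<Sum>x\<in>I. const3 (c x) * mon x)"
  have deg: "total_degree_le (mon x) (3 * m)" if "x \<in> I" for x
  proof -
    obtain i j k where x: "x = (i, j, k)" "i \<le> m" "j \<le> m" "k \<le> m"
      using \<open>x \<in> I\<close> by (auto simp: I_def)
    have "total_degree_le (mon x) (i * Suc 0 + j * Suc 0 + k * Suc 0)"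
      unfolding x mon_def prod.case
      by (intro total_degree_le.mult total_degree_le_power total_degree_le.intros)
    then show ?thesis
      by (rule total_degree_le_mono) (use x in auto)
  qed
  have f_deg: "total_degree_le f (3 * m)"
    unfolding f_def
    using total_degree_le.mult[OF total_degree_le.const[of _ 0] deg]
    by (intro total_degree_le_sum) simp
  have "on_line l f = 0" if "l \<in> A" for l
  proof (rule poly_eqI)
    fix r
    show "coeff (on_line l f) r = coeff 0 r"
    proof (cases "r \<le> 3 * m")
      case True
      have "coeff (on_line l f) r = (\<Sum>x\<in>I. c x * M (l, r) x)"
        by (simp add: f_def on_line_hom M_def coeff_sum)
      then show ?thesis
        using c(2) that True by simp
    next
      case False
      then show ?thesis
        using degree_on_line_le[OF f_deg, of l] by (simp add: coeff_eq_0)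
    qed
  qed
  moreover have "f \<noteq> 0"
  proof -
    obtain i j k where x: "(i, j, k) \<in> I" "c (i, j, k) \<noteq> 0"
      using c(1) by auto
    have "coeff (coeff (coeff f k) j) i = (\<Sum>x\<in>I. if x = (i, j, k) then c x else 0)"
      unfolding f_def coeff_sum
    proof (intro sum.cong refl)
      fix x
      assume "x \<in> I"
      obtain i' j' k' where x': "x = (i', j', k')"
        by (cases x)
      show "coeff (coeff (coeff (const3 (c x) * mon x) k) j) i = (if x = (i, j, k) then c x else 0)"
        by (auto simp: x' mon const3_def smult_monom)
    qed
    also have "\<dots> = c (i, j, k)"
      using x by (simp add: I_def)
    finally show ?thesis
      using x by auto
  qed
  ultimately show ?thesis
    using f_deg by blast
qed

section \<open>First and second derivatives of a surface in directions of varying slope\<close>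

text \<open>Pseudo-division of the quartic by the quadratic: the factor \<open>F1 ^ 3\<close> clears
  the denominators, so that \<open>F1 = 0\<close> is covered too. The remainder
  \<open>?R1 * t + ?R0\<close> is linear with two distinct roots.\<close>

lemma remainder_vanishes_at_two_roots:
  fixes t :: "'k::field"
  assumes "t \<noteq> t'" "F1 * t\<^sup>2 + F2 * t + F3 = 0" "F1 * t'\<^sup>2 + F2 * t' + F3 = 0"
    and "c4 * t ^ 4 + c3 * t ^ 3 + c2 * t\<^sup>2 + c1 * t + c0 = 0"
    and "c4 * t' ^ 4 + c3 * t' ^ 3 + c2 * t'\<^sup>2 + c1 * t' + c0 = 0"
  shows "F1 ^ 3 * c0 - F3 * (c4 * (F2\<^sup>2 - F1 * F3) - c3 * F1 * F2 + c2 * F1\<^sup>2) = 0" (is "?R0 = 0")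
    and "c4 * (2 * F1 * F2 * F3 - F2 ^ 3) + c3 * F1 * (F2\<^sup>2 - F1 * F3) - c2 * F1\<^sup>2 * F2 + c1 * F1 ^ 3 = 0"
      (is "?R1 = 0")
proof -
  have div: "?R1 * t + ?R0 = F1 ^ 3 * (c4 * t ^ 4 + c3 * t ^ 3 + c2 * t\<^sup>2 + c1 * t + c0)
    - (F1 * t\<^sup>2 + F2 * t + F3) * (F1\<^sup>2 * c4 * t\<^sup>2 + F1 * (F1 * c3 - c4 * F2) * t
      + (F1\<^sup>2 * c2 - F1 * F2 * c3 + c4 * F2\<^sup>2 - c4 * F1 * F3))" for t
    by (simp add: algebra_simps power2_eq_square power3_eq_cube power4_eq_xxxx)
  have 1: "?R1 * t + ?R0 = 0" and 2: "?R1 * t' + ?R0 = 0"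
    unfolding div using assms by simp_all
  have "?R1 * (t - t') = (?R1 * t + ?R0) - (?R1 * t' + ?R0)"
    by (simp only: algebra_simps)
  then show R1: "?R1 = 0"
    using 1 2 \<open>t \<noteq> t'\<close> by (metis diff_self mult_eq_0_iff right_minus_eq)
  show "?R0 = 0"
    using 1 unfolding R1 by simp
qed

text \<open>On the right every term is one factor times a cubic product. In this shape the degree
  rules for sums and products give the bound \<open>4 * (d - 1)\<close> at once.\<close>

lemma remainder_expand0:
  fixes f1 :: "'r::comm_ring_1"
  shows "f1 ^ 3 * f33 - f3 * (f11 * (f2\<^sup>2 - f1 * f3) - 2 * f12 * f1 * f2 + (2 * f13 + f22) * f1\<^sup>2)
    = f33 * (f1 * f1 * f1) - f3 * (f11 * f2 * f2 - f11 * f1 * f3 - 2 * (f12 * f1 * f2)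
      + 2 * (f13 * f1 * f1) + f22 * f1 * f1)"
  by (simp add: algebra_simps power2_eq_square power3_eq_cube)

lemma remainder_expand1:
  fixes f1 :: "'r::comm_ring_1"
  shows "f11 * (2 * f1 * f2 * f3 - f2 ^ 3) + 2 * f12 * f1 * (f2\<^sup>2 - f1 * f3)
      - (2 * f13 + f22) * f1\<^sup>2 * f2 + 2 * f23 * f1 ^ 3
    = f11 * (2 * (f1 * f2 * f3) - f2 * f2 * f2) + f12 * (2 * (f1 * f2 * f2) - 2 * (f1 * f1 * f3))
      - (2 * (f13 * (f1 * f1 * f2)) + f22 * (f1 * f1 * f2)) + f23 * (2 * (f1 * f1 * f1))"
  by (simp add: algebra_simps power2_eq_square power3_eq_cube)

text \<open>Frame adapted to the slope \<beta>: expanding ((\<beta> + t)^2, \<beta> + t, 1) in t,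
  the derivative in the direction of slope \<beta> + t is t^2 \<open>dx\<close> + t
  \<open>d2 \<beta>\<close> + \<open>d3 \<beta>\<close>. In particular \<open>d3 \<beta>\<close>
  differentiates along lines of slope \<beta>.\<close>

definition d2 :: "'k::field \<Rightarrow> 'k poly3 \<Rightarrow> 'k poly3" where
  "d2 \<beta> h = dy h + const3 (2 * \<beta>) * dx h"

definition d3 :: "'k::field \<Rightarrow> 'k poly3 \<Rightarrow> 'k poly3" where
  "d3 \<beta> h = dz h + (const3 \<beta> * dy h + const3 (\<beta>\<^sup>2) * dx h)"

lemma derivation_d2: "derivation (d2 \<beta>)" and derivation_d3: "derivation (d3 \<beta>)"
  unfolding d2_def d3_def
  by (intro derivation_add derivation_scale derivation_dx derivation_dy derivation_dz)+

lemma d_const3_mult: "dx (const3 k * h) = const3 k * dx h" "d2 \<beta> (const3 k * h) = const3 k * d2 \<beta> h"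
  "d3 \<beta> (const3 k * h) = const3 k * d3 \<beta> h"
  by (simp_all add: d2_def d3_def derivationD[OF derivation_dx] derivationD[OF derivation_dy]
      derivationD[OF derivation_dz] algebra_simps)

lemma d_commute: "d2 \<beta> (dx h) = dx (d2 \<beta> h)" "d3 \<beta> (dx h) = dx (d3 \<beta> h)" "d3 \<beta> (d2 \<beta> h) = d2 \<beta> (d3 \<beta> h)"
  by (simp_all add: d2_def d3_def derivationD[OF derivation_dx] derivationD[OF derivation_dy]
      derivationD[OF derivation_dz] dx_dy dx_dz dy_dz algebra_simps)

lemma total_degree_le_const3_mult: "total_degree_le h n \<Longrightarrow> total_degree_le (const3 k * h) n"
  using total_degree_le.mult[OF total_degree_le.const[of k 0], of h n] by simp

lemma total_degree_le_d:
  assumes "total_degree_le g n"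
  shows "total_degree_le (d2 \<beta> g) (n - 1)" "total_degree_le (d3 \<beta> g) (n - 1)"
  unfolding d2_def d3_def using total_degree_le_deriv[OF assms]
  by (auto intro!: total_degree_le.add total_degree_le_const3_mult)

lemma const3_hom: "const3 (a + b) = const3 a + const3 b" "const3 (a * b) = const3 a * const3 b"
  by (simp_all add: const3_def)

lemma pderiv_on_line_shift:
  assumes "slope m = \<beta> + t"
  shows "pderiv (on_line m h) = on_line m (const3 (t\<^sup>2) * dx h + const3 t * d2 \<beta> h + d3 \<beta> h)"
  unfolding pderiv_on_line assms d2_def d3_def
  by (rule arg_cong[of _ _ "on_line m"]) (simp add: power2_eq_square const3_hom mult_2 algebra_simps)

lemma on_line_eq_0_deriv:
  assumes "slope m = \<beta> + t" "on_line m f = 0"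
  shows "[:t\<^sup>2:] * on_line m (dx f) + [:t:] * on_line m (d2 \<beta> f) + on_line m (d3 \<beta> f) = 0"
  using pderiv_on_line_shift[OF assms(1), of f] unfolding assms(2) by (simp add: on_line_hom)

lemma second_derivative_expand:
  fixes T :: "'r::comm_ring_1"
  shows "T\<^sup>2 * (T\<^sup>2 * a + T * b + c) + T * (T\<^sup>2 * b + T * e + h) + (T\<^sup>2 * c + T * h + g)
    = T ^ 4 * a + 2 * T ^ 3 * b + T\<^sup>2 * (2 * c + e) + 2 * T * h + g"
  by (simp add: algebra_simps power2_eq_square power3_eq_cube power4_eq_xxxx)

lemma on_line_eq_0_deriv2:
  assumes "slope m = \<beta> + t" "on_line m f = 0"
  shows "[:t ^ 4:] * on_line m (dx (dx f)) + [:2 * t ^ 3:] * on_line m (dx (d2 \<beta> f))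
     + [:t\<^sup>2:] * (2 * on_line m (dx (d3 \<beta> f)) + on_line m (d2 \<beta> (d2 \<beta> f)))
     + [:2 * t:] * on_line m (d2 \<beta> (d3 \<beta> f)) + on_line m (d3 \<beta> (d3 \<beta> f)) = 0"
proof -
  define g where "g = const3 (t\<^sup>2) * dx f + const3 t * d2 \<beta> f + d3 \<beta> f"
  have "on_line m g = 0"
    using pderiv_on_line_shift[OF assms(1), of f] unfolding assms(2) g_def by simp
  from on_line_eq_0_deriv[OF assms(1) this]
  have "[:t\<^sup>2:] * on_line m (dx g) + [:t:] * on_line m (d2 \<beta> g) + on_line m (d3 \<beta> g) = 0" .
  moreover have "on_line m (dx g) = [:t\<^sup>2:] * on_line m (dx (dx f)) + [:t:] * on_line m (dx (d2 \<beta> f))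
      + on_line m (dx (d3 \<beta> f))"
    by (simp only: g_def on_line_hom(1,2) derivationD(1)[OF derivation_dx] d_const3_mult on_line_const3)
  moreover have "on_line m (d2 \<beta> g) = [:t\<^sup>2:] * on_line m (dx (d2 \<beta> f)) + [:t:] * on_line m (d2 \<beta> (d2 \<beta> f))
      + on_line m (d2 \<beta> (d3 \<beta> f))"
    by (simp only: g_def on_line_hom(1,2) derivationD(1)[OF derivation_d2] d_const3_mult on_line_const3 d_commute)
  moreover have "on_line m (d3 \<beta> g) = [:t\<^sup>2:] * on_line m (dx (d3 \<beta> f)) + [:t:] * on_line m (d2 \<beta> (d3 \<beta> f))
      + on_line m (d3 \<beta> (d3 \<beta> f))"
    by (simp only: g_def on_line_hom(1,2) derivationD(1)[OF derivation_d3] d_const3_mult on_line_const3 d_commute)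
  moreover have "[:t\<^sup>2:] = [:t:]\<^sup>2" "[:t ^ 4:] = [:t:] ^ 4" "[:2 * t ^ 3:] = 2 * [:t:] ^ 3" "[:2 * t:] = 2 * [:t:]"
    by (simp_all add: poly_const_pow numeral_poly)
  ultimately show ?thesis
    by (simp only: second_derivative_expand)
qed

section \<open>The polynomial method for lines with many meetings\<close>

text \<open>\<open>nb l\<close> may be a proper part of the lines that meet \<open>l\<close>. The
  condition \<open>nb_skew\<close> keeps the meeting points on \<open>l\<close> apart, so that they
  can be counted as roots.\<close>

locale line_graph =
  fixes \<Lambda> :: "'k::field line set" and nb :: "'k line \<Rightarrow> 'k line set"
  assumes fin_nb: "l \<in> \<Lambda> \<Longrightarrow> finite (nb l)"
    and nb_sub: "l \<in> \<Lambda> \<Longrightarrow> nb l \<subseteq> \<Lambda>"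
    and nb_symp: "l \<in> \<Lambda> \<Longrightarrow> m \<in> nb l \<Longrightarrow> line_symp l m = 0"
    and nb_slope: "l \<in> \<Lambda> \<Longrightarrow> m \<in> nb l \<Longrightarrow> slope l \<noteq> slope m"
    and nb_skew: "l \<in> \<Lambda> \<Longrightarrow> m \<in> nb l \<Longrightarrow> m' \<in> nb l \<Longrightarrow> m \<noteq> m' \<Longrightarrow> line_symp m m' \<noteq> 0"
begin

lemma inj_on_meet_at: "l \<in> \<Lambda> \<Longrightarrow> inj_on (meet_at l) (nb l)"
  using meet_eq_imp_symp nb_symp nb_slope nb_skew by (meson inj_onI)

lemma on_line_eq_0I:
  assumes l: "l \<in> \<Lambda>" and h: "total_degree_le h n" "n < card (nb l)"
    and z: "\<And>m. m \<in> nb l \<Longrightarrow> poly (on_line l h) (meet_at l m) = 0"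
  shows "on_line l h = 0"
proof (rule ccontr)
  assume ne: "on_line l h \<noteq> 0"
  have "card (nb l) = card (meet_at l ` nb l)"
    using card_image[OF inj_on_meet_at[OF l]] by simp
  also have "\<dots> \<le> card {x. poly (on_line l h) x = 0}"
    using poly_roots_finite[OF ne] z by (intro card_mono) auto
  also have "\<dots> \<le> degree (on_line l h)"
    using ne by (rule card_poly_roots_bound)
  also have "\<dots> \<le> n"
    by (rule degree_on_line_le) fact
  finally show False
    using h by simp
qed

text \<open>The relation is linear in the slope and intercept of \<open>m\<close>. So in projective
  space, up to \<open>D\<close> exceptions, the neighbours lie in a plane besides the polar plane of
  \<open>l\<close>, hence on a line. The factor 5 pays for a tangential derivative of a remainder of
  degree \<open>4 * (d - 1)\<close>, the factor 2 in the condition on the characteristic for the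
  square of \<open>p2\<close>.\<close>

lemma neighbours_on_quadric:
  assumes ne: "\<Lambda> \<noteq> {}"
    and f0: "f0 \<noteq> 0" "total_degree_le f0 D" "\<And>l. l \<in> \<Lambda> \<Longrightarrow> on_line l f0 = 0"
    and deg: "\<And>l. l \<in> \<Lambda> \<Longrightarrow> 5 * D < card (nb l)" and char: "2 * D < CHAR('k)"
  shows "\<exists>l\<in>\<Lambda>. \<exists>\<kappa> \<mu>. card (nb l)
    \<le> card {m \<in> nb l. \<kappa> * (yint l - yint m) + \<mu> * (slope m - slope l) + 1 = 0} + D"
proof -
  define Q where "Q d \<longleftrightarrow> (\<exists>f. f \<noteq> 0 \<and> total_degree_le f d \<and> (\<forall>l\<in>\<Lambda>. on_line l f = 0))" for d
  define d where "d = (LEAST d. Q d)"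
  have "Q D"
    using f0 by (auto simp: Q_def)
  then have dD: "d \<le> D" and "Q d"
    by (auto simp: d_def intro: Least_le LeastI)
  then obtain f where f: "f \<noteq> 0" "total_degree_le f d" "\<And>l. l \<in> \<Lambda> \<Longrightarrow> on_line l f = 0"
    by (auto simp: Q_def)
  have min: "h = 0" if "total_degree_le h (d - 1)" "\<And>l. l \<in> \<Lambda> \<Longrightarrow> on_line l h = 0" "d \<noteq> 0" for h
  proof (rule ccontr)
    assume "h \<noteq> 0"
    then have "Q (d - 1)"
      using that by (auto simp: Q_def)
    then have "d \<le> d - 1"
      by (simp add: d_def Least_le)
    then show False
      using \<open>d \<noteq> 0\<close> by simp
  qed
  have not_const: "f \<noteq> const3 k" for k
    using f ne by (metis all_not_in_conv on_line_const3 pCons_0_0 const3_def pCons_eq_0_iff)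
  have d0: "d \<noteq> 0"
  proof
    assume "d = 0"
    then have g: "degree f = 0" "\<And>i. degree (coeff f i) = 0" "\<And>i j. degree (coeff (coeff f i) j) = 0"
      using total_degree_le_degrees[OF f(2)] by auto
    obtain h1 where h1: "f = [:h1:]"
      using g(1) degree_eq_zeroE by blast
    obtain h2 where h2: "h1 = [:h2:]"
      using g(2)[of 0] h1 degree_eq_zeroE by (metis coeff_pCons_0)
    obtain h3 where h3: "h2 = [:h3:]"
      using g(3)[of 0 0] h1 h2 degree_eq_zeroE by (metis coeff_pCons_0)
    show False
      using not_const[of h3] h1 h2 h3 by (simp add: const3_def)
  qed
  \<comment> \<open>Otherwise the first derivatives, of smaller degree, vanish on all lines, so by
    minimality they vanish identically, and \<open>f\<close> is constant.\<close>
  have "\<exists>l\<in>\<Lambda>. on_line l (dx f) \<noteq> 0 \<or> on_line l (dy f) \<noteq> 0 \<or> on_line l (dz f) \<noteq> 0"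
  proof (rule ccontr)
    assume "\<not> ?thesis"
    then have "dx f = 0" "dy f = 0" "dz f = 0"
      using min total_degree_le_deriv[OF f(2)] d0 by blast+
    then show False
      using all_derivs_0_imp_const3[OF _ _ _ f(2)] not_const dD char by fastforce
  qed
  then obtain l where l: "l \<in> \<Lambda>" "on_line l (dx f) \<noteq> 0 \<or> on_line l (dy f) \<noteq> 0 \<or> on_line l (dz f) \<noteq> 0"
    by blast
  \<comment> \<open>The frame remains that of \<open>l\<close> even where \<open>R0\<close> and
    \<open>R1\<close> are evaluated on other lines; the slope of such a line is written
    \<open>\<beta> + t\<close>.\<close>
  define \<beta> where "\<beta> = slope l"
  define f1 where "f1 = dx f"
  define f2 where "f2 = d2 \<beta> f"
  define f3 where "f3 = d3 \<beta> f"
  define f11 where "f11 = dx (dx f)"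
  define f12 where "f12 = dx (d2 \<beta> f)"
  define f13 where "f13 = dx (d3 \<beta> f)"
  define f22 where "f22 = d2 \<beta> (d2 \<beta> f)"
  define f23 where "f23 = d2 \<beta> (d3 \<beta> f)"
  define f33 where "f33 = d3 \<beta> (d3 \<beta> f)"
  note fs = f1_def f2_def f3_def f11_def f12_def f13_def f22_def f23_def f33_def
  \<comment> \<open>Pseudo-remainder of f11 t^4 + 2 f12 t^3 + (2 f13 + f22) t^2 + 2 f23 t + f33
    modulo f1 t^2 + f2 t + f3; its coefficients are \<open>R0\<close> and \<open>R1\<close>.\<close>
  define R0 where "R0 = f1 ^ 3 * f33 - f3 * (f11 * (f2\<^sup>2 - f1 * f3) - 2 * f12 * f1 * f2 + (2 * f13 + f22) * f1\<^sup>2)"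
  define R1 where "R1 = f11 * (2 * f1 * f2 * f3 - f2 ^ 3) + 2 * f12 * f1 * (f2\<^sup>2 - f1 * f3)
    - (2 * f13 + f22) * f1\<^sup>2 * f2 + 2 * f23 * f1 ^ 3"
  have tf: "total_degree_le f1 (d - 1)" "total_degree_le f2 (d - 1)" "total_degree_le f3 (d - 1)"
    "total_degree_le f11 (d - 1)" "total_degree_le f12 (d - 1)" "total_degree_le f13 (d - 1)"
    "total_degree_le f22 (d - 1)" "total_degree_le f23 (d - 1)" "total_degree_le f33 (d - 1)"
  proof -
    have 1: "total_degree_le (dx f) (d - 1)" "total_degree_le (d2 \<beta> f) (d - 1)" "total_degree_le (d3 \<beta> f) (d - 1)"
      using total_degree_le_deriv[OF f(2)] total_degree_le_d[OF f(2)] by auto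
    have 2: "total_degree_le (dx h) (d - 1)" "total_degree_le (d2 \<beta> h) (d - 1)" "total_degree_le (d3 \<beta> h) (d - 1)"
      if "total_degree_le h (d - 1)" for h
      using total_degree_le_deriv(1)[OF that] total_degree_le_d[OF that, of \<beta>]
      by (meson diff_le_self total_degree_le_mono)+
    show "total_degree_le f1 (d - 1)" "total_degree_le f2 (d - 1)" "total_degree_le f3 (d - 1)"
      "total_degree_le f11 (d - 1)" "total_degree_le f12 (d - 1)" "total_degree_le f13 (d - 1)"
      "total_degree_le f22 (d - 1)" "total_degree_le f23 (d - 1)" "total_degree_le f33 (d - 1)"
      unfolding fs by (intro 1 2)+
  qed
  have t3: "total_degree_le (a * b * c) (3 * (d - 1))"
    if "total_degree_le a (d - 1)" "total_degree_le b (d - 1)" "total_degree_le c (d - 1)" for a b c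
  proof -
    have "3 * (d - 1) = d - 1 + (d - 1) + (d - 1)"
      by simp
    then show ?thesis
      using total_degree_le.mult[OF total_degree_le.mult[OF that(1,2)] that(3)] by (simp only:)
  qed
  have t4: "total_degree_le (a * b) (4 * (d - 1))"
    if "total_degree_le a (d - 1)" "total_degree_le b (3 * (d - 1))" for a b
  proof -
    have "4 * (d - 1) = d - 1 + 3 * (d - 1)"
      by simp
    then show ?thesis
      using total_degree_le.mult[OF that] by (simp only:)
  qed
  have R0_alt: "R0 = f33 * (f1 * f1 * f1) - f3 * (f11 * f2 * f2 - f11 * f1 * f3 - 2 * (f12 * f1 * f2)
      + 2 * (f13 * f1 * f1) + f22 * f1 * f1)"
    unfolding R0_def by (rule remainder_expand0)
  have R1_alt: "R1 = f11 * (2 * (f1 * f2 * f3) - f2 * f2 * f2) + f12 * (2 * (f1 * f2 * f2) - 2 * (f1 * f1 * f3))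
      - (2 * (f13 * (f1 * f1 * f2)) + f22 * (f1 * f1 * f2)) + f23 * (2 * (f1 * f1 * f1))"
    unfolding R1_def by (rule remainder_expand1)
  have R0_deg: "total_degree_le R0 (4 * (d - 1))"
    unfolding R0_alt using tf
    by (intro t4 total_degree_le.add total_degree_le_diff total_degree_le_numeral_mult t3)
  have R1_deg: "total_degree_le R1 (4 * (d - 1))"
    unfolding R1_alt using tf
    by (intro t4 total_degree_le.add total_degree_le_diff total_degree_le_numeral_mult t3)
  have R_point: "poly (on_line m R0) (meet_at m m') = 0 \<and> poly (on_line m R1) (meet_at m m') = 0"
    if m: "m \<in> \<Lambda>" and m': "m' \<in> nb m" for m m'
  proof -
    have m'L: "m' \<in> \<Lambda>"
      using nb_sub[OF m] m' by blast
    define u where "u = meet_at m m'"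
    define v where "v h = poly (on_line m h) u" for h
    have v': "v h = poly (on_line m' h) u" for h
      using poly_on_line_meet_at[OF nb_symp[OF m m'] nb_slope[OF m m']] by (simp add: v_def u_def)
    note vh = on_line_hom(1,2,5,6,7,9)
    define t where "t = slope m - \<beta>"
    define t' where "t' = slope m' - \<beta>"
    have st: "slope m = \<beta> + t" "slope m' = \<beta> + t'"
      by (auto simp: t_def t'_def)
    have "t \<noteq> t'"
      using nb_slope[OF m m'] st by auto
    have q: "v f1 * t\<^sup>2 + v f2 * t + v f3 = 0"
      using arg_cong[OF on_line_eq_0_deriv[OF st(1) f(3)[OF m]], of "\<lambda>p. poly p u"]
      by (simp add: v_def fs mult.commute)
    have q': "v f1 * t'\<^sup>2 + v f2 * t' + v f3 = 0"
      using arg_cong[OF on_line_eq_0_deriv[OF st(2) f(3)[OF m'L]], of "\<lambda>p. poly p u"]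
      by (simp add: v' fs mult.commute)
    have r: "v f11 * t ^ 4 + 2 * v f12 * t ^ 3 + (2 * v f13 + v f22) * t\<^sup>2 + 2 * v f23 * t + v f33 = 0"
      using arg_cong[OF on_line_eq_0_deriv2[OF st(1) f(3)[OF m]], of "\<lambda>p. poly p u"]
      by (simp add: v_def fs algebra_simps)
    have r': "v f11 * t' ^ 4 + 2 * v f12 * t' ^ 3 + (2 * v f13 + v f22) * t'\<^sup>2 + 2 * v f23 * t' + v f33 = 0"
      using arg_cong[OF on_line_eq_0_deriv2[OF st(2) f(3)[OF m'L]], of "\<lambda>p. poly p u"]
      by (simp add: v' fs algebra_simps)
    from remainder_vanishes_at_two_roots[OF \<open>t \<noteq> t'\<close> q q' r r']
    have "v R0 = 0" "v R1 = 0"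
      by (simp_all add: R0_def R1_def v_def vh)
    then show ?thesis
      by (simp add: v_def u_def)
  qed
  have deg': "4 * (d - 1) < card (nb m)" "5 * (d - 1) < card (nb m)" "d - 1 < card (nb m)" if "m \<in> \<Lambda>" for m
    using deg[OF that] dD by auto
  have R0_line: "on_line m R0 = 0" and R1_line: "on_line m R1 = 0" if "m \<in> \<Lambda>" for m
    using on_line_eq_0I[OF that R0_deg deg'(1)[OF that]] on_line_eq_0I[OF that R1_deg deg'(1)[OF that]]
      R_point[OF that] by blast+
  have sl: "slope l = \<beta> + 0"
    by (simp add: \<beta>_def)
  \<comment> \<open>The line \<open>l\<close> itself has t = 0, so of both derivatives only the
    constant terms \<open>f3\<close> and \<open>f33\<close> remain.\<close>
  have p3: "on_line l f3 = 0"
    using on_line_eq_0_deriv[OF sl f(3)[OF l(1)]] by (simp add: fs)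
  have p33: "on_line l f33 = 0"
    using on_line_eq_0_deriv2[OF sl f(3)[OF l(1)]] by (simp add: fs)
  have on_d3: "on_line l (d3 \<beta> h) = pderiv (on_line l h)" for h
    using pderiv_on_line_shift[OF sl, of h] by (simp add: on_line_hom)
  define p1 where "p1 = on_line l f1"
  define p2 where "p2 = on_line l f2"
  have cross: "(slope m - \<beta>) * poly p1 (meet_at l m) + poly p2 (meet_at l m) = 0" if m: "m \<in> nb l" for m
  proof -
    have mL: "m \<in> \<Lambda>"
      using nb_sub[OF l(1)] m by blast
    define t where "t = slope m - \<beta>"
    have st: "slope m = \<beta> + t"
      by (simp add: t_def)
    have "t \<noteq> 0"
      using nb_slope[OF l(1) m] by (simp add: t_def \<beta>_def)
    have "t\<^sup>2 * poly p1 (meet_at l m) + t * poly p2 (meet_at l m) + poly (on_line l f3) (meet_at l m) = 0"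
      using arg_cong[OF on_line_eq_0_deriv[OF st f(3)[OF mL]], of "\<lambda>p. poly p (meet_at l m)"]
      by (simp add: fs p1_def p2_def poly_on_line_meet_at[OF nb_symp[OF l(1) m] nb_slope[OF l(1) m]])
    then have "t * (t * poly p1 (meet_at l m) + poly p2 (meet_at l m)) = 0"
      unfolding p3 by (simp add: algebra_simps power2_eq_square)
    then show ?thesis
      using \<open>t \<noteq> 0\<close> by (simp add: t_def)
  qed
  have p1_0: "p1 \<noteq> 0"
  proof
    assume "p1 = 0"
    then have "poly p2 (meet_at l m) = 0" if "m \<in> nb l" for m
      using cross[OF that] by simp
    then have "p2 = 0"
      unfolding p2_def by (rule on_line_eq_0I[OF l(1) tf(2) deg'(3)[OF l(1)]])
    have x: "on_line l (dx f) = 0"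
      using \<open>p1 = 0\<close> by (simp add: p1_def f1_def)
    then have y: "on_line l (dy f) = 0"
      using \<open>p2 = 0\<close> by (simp add: p2_def f2_def d2_def on_line_hom)
    then have "on_line l (dz f) = 0"
      using p3 x by (simp add: f3_def d3_def on_line_hom)
    then show False
      using x y l by simp
  qed
  have p2_0: "p2 \<noteq> 0"
  proof
    assume "p2 = 0"
    then have "poly p1 (meet_at l m) = 0" if "m \<in> nb l" for m
      using cross[OF that] nb_slope[OF l(1) that] by (simp add: \<beta>_def)
    then have "p1 = 0"
      unfolding p1_def by (rule on_line_eq_0I[OF l(1) tf(1) deg'(3)[OF l(1)]])
    then show False
      using p1_0 by simp
  qed
  \<comment> \<open>The operator \<open>f2 * dx - f1 * d2 \<beta>\<close> is tangent to the surface
    along \<open>l\<close>. At a meeting with a line of slope \<beta> + t,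
    \<open>f2 = - t * f1\<close>; as \<open>R0\<close> vanishes on both lines, also
    \<open>d2 \<beta> R0 = - t * dx R0\<close>.\<close>
  have tan: "on_line l (f2 * dx R0 - f1 * d2 \<beta> R0) = 0"
  proof (rule on_line_eq_0I[OF l(1) _ deg'(2)[OF l(1)]])
    have "total_degree_le (dx R0) (4 * (d - 1))" "total_degree_le (d2 \<beta> R0) (4 * (d - 1))"
      using total_degree_le_deriv(1)[OF R0_deg] total_degree_le_d(1)[OF R0_deg, of \<beta>]
      by (meson diff_le_self total_degree_le_mono)+
    then have "total_degree_le (f2 * dx R0) (d - 1 + 4 * (d - 1))" "total_degree_le (f1 * d2 \<beta> R0) (d - 1 + 4 * (d - 1))"
      using tf(1,2) by (blast intro: total_degree_le.mult)+
    moreover have "d - 1 + 4 * (d - 1) = 5 * (d - 1)"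
      by simp
    ultimately show "total_degree_le (f2 * dx R0 - f1 * d2 \<beta> R0) (5 * (d - 1))"
      by (intro total_degree_le_diff) (simp_all only:)
  next
    fix m
    assume m: "m \<in> nb l"
    have mL: "m \<in> \<Lambda>"
      using nb_sub[OF l(1)] m by blast
    define t where "t = slope m - \<beta>"
    define v where "v h = poly (on_line l h) (meet_at l m)" for h
    have st: "slope m = \<beta> + t"
      by (simp add: t_def)
    have t0: "t \<noteq> 0"
      using nb_slope[OF l(1) m] by (simp add: t_def \<beta>_def)
    have "on_line l (d3 \<beta> R0) = 0"
      by (simp add: on_d3 R0_line[OF l(1)])
    then have "v (d3 \<beta> R0) = 0"
      by (simp add: v_def)
    moreover have "t\<^sup>2 * v (dx R0) + t * v (d2 \<beta> R0) + v (d3 \<beta> R0) = 0"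
      using arg_cong[OF on_line_eq_0_deriv[OF st R0_line[OF mL]], of "\<lambda>p. poly p (meet_at l m)"]
      by (simp add: v_def poly_on_line_meet_at[OF nb_symp[OF l(1) m] nb_slope[OF l(1) m]])
    ultimately have "t * (t * v (dx R0) + v (d2 \<beta> R0)) = 0"
      by (simp add: algebra_simps power2_eq_square)
    then have a: "v (d2 \<beta> R0) = - t * v (dx R0)"
      using t0 by (simp add: add_eq_0_iff)
    have b: "v f2 = - t * v f1"
      using cross[OF m] by (simp add: v_def p1_def p2_def t_def add_eq_0_iff algebra_simps)
    have "v (f2 * dx R0 - f1 * d2 \<beta> R0) = v f2 * v (dx R0) - v f1 * v (d2 \<beta> R0)"
      by (simp add: v_def on_line_hom)
    also have "\<dots> = 0"
      by (simp add: a b)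
    finally show "poly (on_line l (f2 * dx R0 - f1 * d2 \<beta> R0)) (meet_at l m) = 0"
      by (simp add: v_def)
  qed
  \<comment> \<open>\<open>R0 = f1 ^ 3 * f33 - f3 * G\<close>. Since \<open>f3\<close> and
    \<open>f33\<close> vanish on \<open>l\<close>, a derivative of \<open>R0\<close> on
    \<open>l\<close> contains no derivative of \<open>G\<close>.\<close>
  define G where "G = f11 * (f2\<^sup>2 - f1 * f3) - 2 * f12 * f1 * f2 + (2 * f13 + f22) * f1\<^sup>2"
  define g where "g = on_line l G"
  have R0_deriv: "on_line l (D R0) = p1 ^ 3 * on_line l (D f33) - on_line l (D f3) * g"
    if "derivation D" for D
    unfolding R0_def G_def[symmetric]
    by (simp add: derivationD[OF that] on_line_hom p3 p33 flip: g_def p1_def)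
  have f23': "on_line l f23 = pderiv p2" and f13': "on_line l f13 = pderiv p1"
    and f233: "on_line l (d2 \<beta> f33) = pderiv (pderiv p2)" and f133: "on_line l (dx f33) = pderiv (pderiv p1)"
    and f23'': "on_line l (d2 \<beta> f3) = pderiv p2" and f13'': "on_line l (dx f3) = pderiv p1"
    by (simp_all add: fs p1_def p2_def flip: d_commute on_d3)
  have R1_eq: "p2 * g = 2 * pderiv p2 * p1 ^ 3"
  proof -
    have "on_line l R1 = 2 * on_line l f23 * p1 ^ 3 - p2 * g"
      by (simp add: R1_def g_def G_def on_line_hom p3 algebra_simps power2_eq_square power3_eq_cube
          flip: p1_def p2_def)
    then show ?thesis
      using R1_line[OF l(1)] f23' by simp
  qed
  \<comment> \<open>\<open>W\<close> is the numerator of the derivative of p1 / p2. The tangential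
    identity says p1^3 W' = g W, and eliminating g by \<open>R1_eq\<close> gives p2 W' = 2 p2' W. So
    W / p2^2 is a constant \<kappa>, and p1 / p2 = \<kappa> u + \<mu>.\<close>
  define W where "W = p2 * pderiv p1 - p1 * pderiv p2"
  have W': "pderiv W = p2 * pderiv (pderiv p1) - p1 * pderiv (pderiv p2)"
    by (simp add: W_def pderiv_diff pderiv_mult algebra_simps)
  have "p1 ^ 3 * pderiv W = g * W"
  proof -
    have "0 = p2 * on_line l (dx R0) - p1 * on_line l (d2 \<beta> R0)"
      using tan by (simp add: on_line_hom flip: p1_def p2_def)
    then show ?thesis
      unfolding R0_deriv[OF derivation_dx] R0_deriv[OF derivation_d2] f233 f133 f23'' f13'' W'
      by (simp add: W_def algebra_simps)
  qed
  then have "p1 ^ 3 * (p2 * pderiv W) = p1 ^ 3 * (2 * pderiv p2 * W)"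
  proof -
    assume *: "p1 ^ 3 * pderiv W = g * W"
    have "p1 ^ 3 * (p2 * pderiv W) = p2 * (p1 ^ 3 * pderiv W)"
      by (rule mult.left_commute)
    also have "\<dots> = (p2 * g) * W"
      unfolding * by (rule mult.assoc[symmetric])
    also have "\<dots> = p1 ^ 3 * (2 * pderiv p2 * W)"
      unfolding R1_eq by (simp only: ac_simps)
    finally show ?thesis .
  qed
  then have W_eq: "p2 * pderiv W = 2 * pderiv p2 * W"
    using p1_0 by simp
  have dp: "degree p1 \<le> d - 1" "degree p2 \<le> d - 1"
    unfolding p1_def p2_def by (intro degree_on_line_le tf)+
  have dp': "degree (pderiv p1) \<le> d - 1" "degree (pderiv p2) \<le> d - 1"
    unfolding f13'[symmetric] f23'[symmetric] by (intro degree_on_line_le tf)+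
  have mm: "degree (a * b) \<le> 2 * (d - 1)" if "degree a \<le> d - 1" "degree b \<le> d - 1" for a b :: "'k poly"
    using degree_mult_le[of a b] that by linarith
  have "\<exists>\<kappa>. W = smult \<kappa> (p2 * p2)"
  proof (rule wronskian_eq_0_imp_smult)
    show "pderiv W * (p2 * p2) = W * pderiv (p2 * p2)"
      using W_eq by (simp add: pderiv_mult algebra_simps)
    show "p2 * p2 \<noteq> 0"
      using p2_0 by simp
    have "degree W \<le> 2 * (d - 1)"
      unfolding W_def using dp dp' by (intro degree_diff_le mm)
    then show "degree W < CHAR('k)"
      using dD char by linarith
    show "degree (p2 * p2) < CHAR('k)"
      using mm[OF dp(2) dp(2)] dD char by linarith
  qed
  then obtain \<kappa> where \<kappa>: "W = smult \<kappa> (p2 * p2)"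
    by blast
  have "\<exists>\<mu>. p1 - [:0, \<kappa>:] * p2 = smult \<mu> p2"
  proof (rule wronskian_eq_0_imp_smult)
    have "pderiv (p1 - [:0, \<kappa>:] * p2) * p2 - (p1 - [:0, \<kappa>:] * p2) * pderiv p2 = W - smult \<kappa> (p2 * p2)"
      by (simp add: pderiv_diff pderiv_mult pderiv_pCons pderiv_smult W_def algebra_simps)
    then show "pderiv (p1 - [:0, \<kappa>:] * p2) * p2 = (p1 - [:0, \<kappa>:] * p2) * pderiv p2"
      using \<kappa> by simp
    show "p2 \<noteq> 0"
      by (fact p2_0)
    have "degree ([:0, \<kappa>:] * p2) \<le> d"
      using degree_mult_le[of "[:0, \<kappa>:]" p2] dp d0 degree_pCons_le[of 0 "[:\<kappa>:]"] by simp
    then have "degree (p1 - [:0, \<kappa>:] * p2) \<le> d"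
      using dp by (intro degree_diff_le) auto
    then show "degree (p1 - [:0, \<kappa>:] * p2) < CHAR('k)"
      using dD char d0 by linarith
    show "degree p2 < CHAR('k)"
      using dp dD char d0 by linarith
  qed
  then obtain \<mu> where "p1 - [:0, \<kappa>:] * p2 = smult \<mu> p2"
    by blast
  then have p1_eq: "p1 = [:\<mu>, \<kappa>:] * p2"
    by (simp add: algebra_simps)
  \<comment> \<open>Where \<open>p2\<close> does not vanish, dividing \<open>cross\<close> by it
    gives t (\<mu> + \<kappa> u) + 1 = 0, and t u is the difference of the intercepts. The roots of
    \<open>p2\<close> account for the exceptions \<open>?Z\<close>.\<close>
  let ?N = "{m \<in> nb l. \<kappa> * (yint l - yint m) + \<mu> * (slope m - slope l) + 1 = 0}"
  let ?Z = "{m \<in> nb l. poly p2 (meet_at l m) = 0}"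
  have "nb l \<subseteq> ?N \<union> ?Z"
  proof
    fix m
    assume m: "m \<in> nb l"
    show "m \<in> ?N \<union> ?Z"
    proof (cases "poly p2 (meet_at l m) = 0")
      case True
      then show ?thesis
        using m by simp
    next
      case False
      define u where "u = meet_at l m"
      define t where "t = slope m - \<beta>"
      have t0: "t \<noteq> 0"
        using nb_slope[OF l(1) m] by (simp add: t_def \<beta>_def)
      have tu: "t * u = yint l - yint m"
        using t0 by (simp add: u_def meet_at_def t_def \<beta>_def)
      have "(t * (\<mu> + \<kappa> * u) + 1) * poly p2 u = t * poly p1 u + poly p2 u"
        by (simp add: p1_eq algebra_simps)
      also have "\<dots> = 0"
        using cross[OF m] by (simp add: t_def u_def)
      finally have "t * (\<mu> + \<kappa> * u) + 1 = 0"
        using False by (simp add: u_def)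
      then have "\<kappa> * (yint l - yint m) + \<mu> * (slope m - slope l) + 1 = 0"
        unfolding tu[symmetric] by (simp add: t_def \<beta>_def algebra_simps)
      then show ?thesis
        using m by simp
    qed
  qed
  then have "card (nb l) \<le> card (?N \<union> ?Z)"
    using fin_nb[OF l(1)] by (intro card_mono) auto
  also have "\<dots> \<le> card ?N + card ?Z"
    by (rule card_Un_le)
  also have "card ?Z \<le> D"
  proof -
    have "card ?Z = card (meet_at l ` ?Z)"
      by (rule card_image[symmetric]) (rule inj_on_subset[OF inj_on_meet_at[OF l(1)]], auto)
    also have "\<dots> \<le> card {x. poly p2 x = 0}"
      using poly_roots_finite[OF p2_0] by (intro card_mono) auto
    also have "\<dots> \<le> degree p2"
      using p2_0 by (rule card_poly_roots_bound)
    finally show ?thesis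
      using dp dD by simp
  qed
  finally show ?thesis
    using l(1) by auto
qed

end

section \<open>Edge counts in bipartite graphs\<close>

definition edges :: "('a \<Rightarrow> 'b \<Rightarrow> bool) \<Rightarrow> 'a set \<Rightarrow> 'b set \<Rightarrow> nat" where
  "edges E A B = (\<Sum>a\<in>A. card {b \<in> B. E a b})"

lemma edges_swap:
  assumes "finite A" "finite B"
  shows "edges E A B = edges (\<lambda>b a. E a b) B A"
proof -
  have c: "card {b \<in> B. E a b} = (\<Sum>b\<in>B. if E a b then 1 else 0)" for a
    using assms by (simp add: sum.If_cases Int_def)
  have c': "card {a \<in> A. E a b} = (\<Sum>a\<in>A. if E a b then 1 else 0)" for b
    using assms by (simp add: sum.If_cases Int_def)
  show ?thesis
    unfolding edges_def c c' by (rule sum.swap)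
qed

text \<open>Vertices of degree at most \<open>x\<close> are deleted as long as there are any. Each
  deletion destroys at most \<open>x\<close> edges, so the assumed inequality survives, and it fails
  for an empty \<open>A\<close>.\<close>

lemma min_degree_subgraph:
  assumes "finite A" "finite B" "x * (card A + card B) < edges E A B"
  shows "\<exists>A'\<subseteq>A. \<exists>B'\<subseteq>B. A' \<noteq> {} \<and> (\<forall>a\<in>A'. x < card {b \<in> B'. E a b}) \<and> (\<forall>b\<in>B'. x < card {a \<in> A'. E a b})"
  using assms
proof (induction "card A + card B" arbitrary: A B rule: less_induct)
  case less
  consider a where "a \<in> A" "card {b \<in> B. E a b} \<le> x" | b where "b \<in> B" "card {a \<in> A. E a b} \<le> x"
    | "\<forall>a\<in>A. x < card {b \<in> B. E a b}" "\<forall>b\<in>B. x < card {a \<in> A. E a b}"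
    by (meson not_less)
  then show ?case
  proof cases
    case 1
    have "edges E A B = card {b \<in> B. E a b} + edges E (A - {a}) B"
      unfolding edges_def using 1 less.prems by (simp add: sum.remove)
    moreover have "card A = Suc (card (A - {a}))"
      using 1 less.prems by (metis card.remove)
    ultimately have "x * (card (A - {a}) + card B) < edges E (A - {a}) B" "card (A - {a}) + card B < card A + card B"
      using less.prems(3) 1(2) by (simp_all only: add_mult_distrib2 mult_Suc_right)
    then obtain A' B' where "A' \<subseteq> A - {a}" "B' \<subseteq> B" "A' \<noteq> {}" "\<forall>a\<in>A'. x < card {b \<in> B'. E a b}"
        "\<forall>b\<in>B'. x < card {a \<in> A'. E a b}"
      using less.hyps[of "A - {a}" B] less.prems by auto
    moreover from this have "A' \<subseteq> A" "B' \<subseteq> B"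
      by auto
    ultimately show ?thesis
      by blast
  next
    case 2
    have "edges E A B = card {a \<in> A. E a b} + edges E A (B - {b})"
      using less.prems 2 by (subst (1 2) edges_swap) (simp_all add: edges_def sum.remove)
    moreover have "card B = Suc (card (B - {b}))"
      using 2 less.prems by (metis card.remove)
    ultimately have "x * (card A + card (B - {b})) < edges E A (B - {b})" "card A + card (B - {b}) < card A + card B"
      using less.prems(3) 2(2) by (simp_all only: add_mult_distrib2 mult_Suc_right)
    then obtain A' B' where "A' \<subseteq> A" "B' \<subseteq> B - {b}" "A' \<noteq> {}" "\<forall>a\<in>A'. x < card {b \<in> B'. E a b}"
        "\<forall>b\<in>B'. x < card {a \<in> A'. E a b}"
      using less.hyps[of A "B - {b}"] less.prems by auto
    moreover from this have "A' \<subseteq> A" "B' \<subseteq> B"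
      by auto
    ultimately show ?thesis
      by blast
  next
    case 3
    moreover have "A \<noteq> {}"
      using less.prems by (auto simp: edges_def)
    ultimately show ?thesis
      by blast
  qed
qed

section \<open>Generic choices over an infinite field\<close>

text \<open>Polynomials as functions of their parameters. This is enough because they are treated as
  genuine polynomials only after restriction to a line in parameter space.\<close>

inductive polyfun :: "(('i \<Rightarrow> 'k::field) \<Rightarrow> 'k) \<Rightarrow> bool" where
  const: "polyfun (\<lambda>_. c)"
| var: "polyfun (\<lambda>x. x i)"
| add: "polyfun g \<Longrightarrow> polyfun h \<Longrightarrow> polyfun (\<lambda>x. g x + h x)"
| mult: "polyfun g \<Longrightarrow> polyfun h \<Longrightarrow> polyfun (\<lambda>x. g x * h x)"

lemma polyfun_uminus: "polyfun g \<Longrightarrow> polyfun (\<lambda>x. - g x)"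
  using polyfun.mult[OF polyfun.const[of "-1"]] by fastforce

lemma polyfun_diff: "polyfun g \<Longrightarrow> polyfun h \<Longrightarrow> polyfun (\<lambda>x. g x - h x)"
  using polyfun.add[OF _ polyfun_uminus] by fastforce

lemmas polyfun_intros = polyfun.intros polyfun_uminus polyfun_diff

lemma polyfun_on_line: "polyfun g \<Longrightarrow> \<exists>P. \<forall>z. g (\<lambda>i. x i + z * (y i - x i)) = poly P z"
proof (induction rule: polyfun.induct)
  case (const c)
  then show ?case
    by (intro exI[of _ "[:c:]"]) simp
next
  case (var i)
  then show ?case
    by (intro exI[of _ "[:x i, y i - x i:]"]) (simp add: algebra_simps)
next
  case (add g h)
  then obtain P Q where "\<forall>z. g (\<lambda>i. x i + z * (y i - x i)) = poly P z" "\<forall>z. h (\<lambda>i. x i + z * (y i - x i)) = poly Q z"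
    by blast
  then show ?case
    by (intro exI[of _ "P + Q"]) simp
next
  case (mult g h)
  then obtain P Q where "\<forall>z. g (\<lambda>i. x i + z * (y i - x i)) = poly P z" "\<forall>z. h (\<lambda>i. x i + z * (y i - x i)) = poly Q z"
    by blast
  then show ?case
    by (intro exI[of _ "P * Q"]) simp
qed

text \<open>On the line through \<open>x\<close> and \<open>y\<close> both functions become nonzero
  univariate polynomials, whose product has only finitely many roots.\<close>

lemma polyfun_mult_nonzero:
  fixes g h :: "('i \<Rightarrow> 'k::field) \<Rightarrow> 'k"
  assumes "infinite (UNIV :: 'k set)" "polyfun g" "polyfun h" "g x \<noteq> 0" "h y \<noteq> 0"
  shows "\<exists>z. g z * h z \<noteq> 0"
proof -
  obtain P where P: "\<And>z. g (\<lambda>i. x i + z * (y i - x i)) = poly P z"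
    using polyfun_on_line[OF assms(2)] by blast
  obtain Q where Q: "\<And>z. h (\<lambda>i. x i + z * (y i - x i)) = poly Q z"
    using polyfun_on_line[OF assms(3)] by blast
  have "P \<noteq> 0" "Q \<noteq> 0"
    using P[of 0] Q[of 1] assms(4,5) by auto
  then have "finite {z. poly (P * Q) z = 0}"
    by (intro poly_roots_finite) simp
  then obtain z where "poly (P * Q) z \<noteq> 0"
    using assms(1) by (metis (mono_tags, lifting) UNIV_eq_I mem_Collect_eq)
  then show ?thesis
    by (intro exI[of _ "\<lambda>i. x i + z * (y i - x i)"]) (simp add: P Q)
qed

lemma polyfun_common_nonzero:
  fixes C :: "(('i \<Rightarrow> 'k::field) \<Rightarrow> 'k) set"
  assumes "infinite (UNIV :: 'k set)" "finite C" "\<And>g. g \<in> C \<Longrightarrow> polyfun g \<and> (\<exists>x. g x \<noteq> 0)"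
  shows "\<exists>x. \<forall>g\<in>C. g x \<noteq> 0"
proof -
  have "\<exists>h. polyfun h \<and> (\<exists>x. h x \<noteq> 0) \<and> (\<forall>x. h x \<noteq> 0 \<longrightarrow> (\<forall>g\<in>C. g x \<noteq> 0))"
    using assms(2,3)
  proof (induction rule: finite_induct)
    case empty
    show ?case
      by (intro exI[of _ "\<lambda>_. 1"]) (auto intro: polyfun.const)
  next
    case (insert g C)
    obtain h where h: "polyfun h" "\<exists>x. h x \<noteq> 0" "\<forall>x. h x \<noteq> 0 \<longrightarrow> (\<forall>g\<in>C. g x \<noteq> 0)"
      using insert.IH insert.prems by auto
    have g: "polyfun g" "\<exists>x. g x \<noteq> 0"
      using insert.prems by auto
    show ?case
      using h g polyfun_mult_nonzero[OF assms(1) h(1) g(1)]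
      by (intro exI[of _ "\<lambda>x. h x * g x"]) (auto intro: polyfun.mult)
  qed
  then show ?thesis
    by blast
qed

section \<open>Homogeneous coordinates and generic charts\<close>

type_synonym 'k vec4 = "'k \<times> 'k \<times> 'k \<times> 'k"

fun dot4 :: "'k::field vec4 \<Rightarrow> 'k vec4 \<Rightarrow> 'k" where
  "dot4 (a, b, c, d) (a', b', c', d') = a * a' + b * b' + c * c' + d * d'"

fun scale4 :: "'k::field \<Rightarrow> 'k vec4 \<Rightarrow> 'k vec4" where
  "scale4 k (a, b, c, d) = (k * a, k * b, k * c, k * d)"

fun symp4 :: "'k::field vec4 \<Rightarrow> 'k vec4 \<Rightarrow> 'k" where
  "symp4 (a, b, c, d) (a', b', c', d') = d * a' - c * b' + b * c' - a * d'"

fun line_of :: "'k::field vec4 \<Rightarrow> 'k line" where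
  "line_of (a, b, c, d) = (b / a, c / a, d / a)"

text \<open>\<open>chart x\<close> and \<open>cochart x\<close> are linear maps that turn the standard pairing into a multiple of the
  symplectic form. The parameters \<open>x 0, \<dots>, x 4\<close> move the symplectic form, and \<open>x 5, \<dots>, x 8\<close> move
  the Lagrangian plane at infinity, which makes all points and all pairs of points generic.\<close>

fun symp_move :: "(nat \<Rightarrow> 'k::field) \<Rightarrow> 'k vec4 \<Rightarrow> 'k vec4" where
  "symp_move x (a, b, c, d) =
    ((a + x 5 * d - x 6 * c) + x 8 * (b + x 6 * d - x 7 * c), b + x 6 * d - x 7 * c, c + x 8 * d, d)"

fun chart :: "(nat \<Rightarrow> 'k::field) \<Rightarrow> 'k vec4 \<Rightarrow> 'k vec4" where
  "chart x (a, b, c, d) = symp_move x (a + x 0 * c + x 1 * d, c, x 4 * d, b + x 2 * c + x 3 * d)"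

fun cochart :: "(nat \<Rightarrow> 'k::field) \<Rightarrow> 'k vec4 \<Rightarrow> 'k vec4" where
  "cochart x (a, b, c, d) = symp_move x
    (x 4 * b, x 3 * b + x 1 * a - d, x 4 * (c - x 2 * b - x 0 * a), - (x 4 * a))"

lemma symp4_symp_move: "symp4 (symp_move x v) (symp_move x w) = symp4 v w"
  by (cases v; cases w) (simp add: algebra_simps)

lemma symp4_chart_cochart: "symp4 (chart x v) (cochart x w) = x 4 * dot4 v w"
  by (cases v; cases w) (simp only: chart.simps cochart.simps symp4_symp_move,
      simp add: algebra_simps)

lemma symp_move_surj: "\<exists>v. symp_move x v = w"
proof -
  obtain a b c d where w: "w = (a, b, c, d)"
    by (cases w)
  let ?c = "c - x 8 * d"
  let ?b = "b - x 6 * d + x 7 * ?c"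
  show ?thesis
    unfolding w by (intro exI[of _ "(a - x 8 * b - x 5 * d + x 6 * ?c, ?b, ?c, d)"]) simp
qed

lemma chart_surj:
  assumes "x 4 \<noteq> 0"
  shows "\<exists>v. chart x v = w"
proof -
  obtain u where u: "symp_move x u = w"
    using symp_move_surj by blast
  obtain a b c d where u': "u = (a, b, c, d)"
    by (cases u)
  have "chart x (a - x 0 * b - x 1 * (c / x 4), d - x 2 * b - x 3 * (c / x 4), b, c / x 4) = w"
    using assms by (simp add: u[symmetric] u' del: symp_move.simps)
  then show ?thesis
    by blast
qed

lemma cochart_surj:
  assumes "x 4 \<noteq> 0"
  shows "\<exists>v. cochart x v = w"
proof -
  obtain u where u: "symp_move x u = w"
    using symp_move_surj by blast
  obtain a b c d where u': "u = (a, b, c, d)"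
    by (cases u)
  let ?a = "- (d / x 4)" and ?b = "a / x 4"
  have "cochart x (?a, ?b, c / x 4 + x 2 * ?b + x 0 * ?a, x 3 * ?b + x 1 * ?a - b) = w"
    using assms by (simp add: u[symmetric] u' del: symp_move.simps)
  then show ?thesis
    by blast
qed

lemma line_symp_line_of:
  assumes "fst v \<noteq> 0" "fst w \<noteq> 0"
  shows "line_symp (line_of v) (line_of w) = symp4 v w / (fst v * fst w)"
  using assms by (cases v; cases w) (simp add: line_symp_def field_simps)

lemma slope_line_of:
  assumes "fst v \<noteq> 0" "fst w \<noteq> 0" "fst v * fst (snd w) - fst (snd v) * fst w \<noteq> 0"
  shows "slope (line_of v) \<noteq> slope (line_of w)"
  using assms by (cases v; cases w) (auto simp: slope_def field_simps)

text \<open>These are the Pluecker coordinates of the line through the two points. If all vanish,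
  any nonzero coordinate of the second vector exhibits the factor of proportionality.\<close>

lemma plucker_nonzero:
  fixes a b c d :: "'k::field"
  assumes "\<nexists>k. (a, b, c, d) = scale4 k (a', b', c', d')" "(a', b', c', d') \<noteq> (0, 0, 0, 0)"
  shows "a * b' - b * a' \<noteq> 0 \<or> a * c' - c * a' \<noteq> 0 \<or> a * d' - d * a' \<noteq> 0 \<or> b * c' - c * b' \<noteq> 0
    \<or> b * d' - d * b' \<noteq> 0 \<or> c * d' - d * c' \<noteq> 0"
proof (rule ccontr)
  assume *: "\<not> ?thesis"
  have no: "(a, b, c, d) \<noteq> scale4 k (a', b', c', d')" for k
    using assms(1) by blast
  consider "a' \<noteq> 0" | "b' \<noteq> 0" | "c' \<noteq> 0" | "d' \<noteq> 0"
    using assms(2) by auto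
  then show False
  proof cases
    case 1
    then have "(a, b, c, d) = scale4 (a / a') (a', b', c', d')"
      using * by (auto simp: field_simps)
    then show False
      using no by blast
  next
    case 2
    then have "(a, b, c, d) = scale4 (b / b') (a', b', c', d')"
      using * by (auto simp: field_simps)
    then show False
      using no by blast
  next
    case 3
    then have "(a, b, c, d) = scale4 (c / c') (a', b', c', d')"
      using * by (auto simp: field_simps)
    then show False
      using no by blast
  next
    case 4
    then have "(a, b, c, d) = scale4 (d / d') (a', b', c', d')"
      using * by (auto simp: field_simps)
    then show False
      using no by blast
  qed
qed

lemma symp4_chart_nonzero:
  fixes v w :: "'k::field vec4"
  assumes "\<nexists>k. v = scale4 k w" "w \<noteq> (0, 0, 0, 0)"
  shows "\<exists>x. symp4 (chart x v) (chart x w) \<noteq> 0"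
proof -
  obtain a b c d where v: "v = (a, b, c, d)"
    by (cases v)
  obtain a' b' c' d' where w: "w = (a', b', c', d')"
    by (cases w)
  note p = plucker_nonzero[OF assms[unfolded v w]]
  \<comment> \<open>A linear form in the Pluecker coordinates. Setting one of the first five
    parameters, or none, to 1 isolates them one after another; index 5 does not occur in the form
    and stands for "none".\<close>
  have f: "symp4 (chart x v) (chart x w) = - (a * b' - b * a') - x 2 * (a * c' - c * a') - x 3 * (a * d' - d * a')
    + x 0 * (b * c' - c * b') + x 1 * (b * d' - d * b') + (x 2 * x 1 - x 0 * x 3 + x 4) * (c * d' - d * c')" for x
    by (simp only: v w chart.simps symp4_symp_move) (simp add: algebra_simps)
  have "\<exists>i. symp4 (chart ((\<lambda>_. 0)(i := 1)) v) (chart ((\<lambda>_. 0)(i := 1)) w) \<noteq> 0"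
  proof (rule ccontr)
    assume *: "\<not> ?thesis"
    have z: "symp4 (chart ((\<lambda>_. 0)(i := 1)) v) (chart ((\<lambda>_. 0)(i := 1)) w) = 0" for i
      using * by blast
    show False
      using z[of 0] z[of 1] z[of 2] z[of 3] z[of 4] z[of 5] p unfolding f by auto
  qed
  then show ?thesis
    by blast
qed

lemma symp4_cochart_nonzero:
  fixes v w :: "'k::field vec4"
  assumes inf: "infinite (UNIV :: 'k set)" and indep: "\<nexists>k. v = scale4 k w" "w \<noteq> (0, 0, 0, 0)"
  shows "\<exists>x. symp4 (cochart x v) (cochart x w) \<noteq> 0"
proof -
  obtain a b c d where v: "v = (a, b, c, d)"
    by (cases v)
  obtain a' b' c' d' where w: "w = (a', b', c', d')"
    by (cases w)
  note p = plucker_nonzero[OF indep[unfolded v w]]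
  \<comment> \<open>The form is \<open>x 4 * ?g x\<close>. Parameter vectors with a single 1 suffice
    for \<open>?g\<close> but usually make \<open>x 4\<close> zero, so the two factors are made
    nonzero separately and then combined.\<close>
  let ?g = "\<lambda>x :: nat \<Rightarrow> 'k. (x 3 * x 0 - x 1 * x 2 - x 4) * (a * b' - b * a')
      + x 1 * (a * c' - c * a') - x 0 * (a * d' - d * a')
      + x 3 * (b * c' - c * b') - x 2 * (b * d' - d * b') + (c * d' - d * c')"
  have "\<exists>i. ?g ((\<lambda>_. 0)(i := 1)) \<noteq> 0"
  proof (rule ccontr)
    assume *: "\<not> ?thesis"
    have z: "?g ((\<lambda>_. 0)(i := 1)) = 0" for i
      using * by blast
    show False
      using z[of 0] z[of 1] z[of 2] z[of 3] z[of 4] z[of 5] p by auto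
  qed
  then obtain y where "?g y \<noteq> 0"
    by blast
  moreover have "polyfun ?g"
    by (intro polyfun_intros)
  moreover have "polyfun (\<lambda>x. x (4::nat))" "(\<lambda>x. x 4) (\<lambda>_::nat. 1::'k) \<noteq> 0"
    by (auto intro: polyfun_intros)
  ultimately obtain z where z: "z 4 * ?g z \<noteq> 0"
    using polyfun_mult_nonzero[OF inf, of "\<lambda>x. x (4::nat)" ?g "\<lambda>_. 1" y] by blast
  have eq: "symp4 (cochart z v) (cochart z w) = z 4 * ?g z"
    by (simp only: v w cochart.simps symp4_symp_move) (simp add: algebra_simps)
  show ?thesis
  proof
    show "symp4 (cochart z v) (cochart z w) \<noteq> 0"
      unfolding eq by (fact z)
  qed
qed

lemma fst_chart_nonzero:
  fixes v :: "'k::field vec4"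
  assumes "v \<noteq> (0, 0, 0, 0)"
  shows "\<exists>x. fst (chart x v) \<noteq> 0"
proof -
  obtain a b c d where v: "v = (a, b, c, d)"
    by (cases v)
  have "\<exists>x\<in>{\<lambda>_. 0, (\<lambda>_. 0)(8 := 1), (\<lambda>_. 0)(5 := 1), (\<lambda>_. 0)(1 := 1)}. fst (chart x v) \<noteq> 0"
    using assms v by auto
  then show ?thesis
    by blast
qed

lemma fst_cochart_nonzero:
  fixes v :: "'k::field vec4"
  assumes "v \<noteq> (0, 0, 0, 0)"
  shows "\<exists>x. fst (cochart x v) \<noteq> 0"
proof -
  obtain a b c d where v: "v = (a, b, c, d)"
    by (cases v)
  have "\<exists>x\<in>{(\<lambda>_. 0)(4 := 1), (\<lambda>_. 0)(8 := 1), (\<lambda>_. 0)(8 := 1, 1 := 1), (\<lambda>_. 0)(4 := 1, 6 := 1)}. fst (cochart x v) \<noteq> 0"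
    using assms v by auto
  then show ?thesis
    by blast
qed

lemma polyfun_charts:
  "polyfun (\<lambda>x. fst (chart x v))" "polyfun (\<lambda>x. fst (snd (chart x v)))"
  "polyfun (\<lambda>x. fst (cochart x v))" "polyfun (\<lambda>x. fst (snd (cochart x v)))"
  "polyfun (\<lambda>x. symp4 (chart x v) (chart x w))" "polyfun (\<lambda>x. symp4 (cochart x v) (cochart x w))"
  by (cases v; cases w; simp only: chart.simps cochart.simps symp4_symp_move symp4.simps symp_move.simps fst_conv snd_conv;
      intro polyfun_intros)+

lemma slopes_differ:
  fixes v w :: "'k::field vec4"
  assumes inf: "infinite (UNIV :: 'k set)" and "v \<noteq> (0, 0, 0, 0)" "w \<noteq> (0, 0, 0, 0)"
  shows "\<exists>x. fst (chart x v) * fst (snd (cochart x w)) - fst (snd (chart x v)) * fst (cochart x w) \<noteq> 0"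
proof -
  obtain a b c d where v: "v = (a, b, c, d)"
    by (cases v)
  obtain a' b' c' d' where w: "w = (a', b', c', d')"
    by (cases w)
  let ?h = "\<lambda>x :: nat \<Rightarrow> 'k. a + x 0 * c + x 1 * d + x 5 * (b + x 2 * c + x 3 * d)"
  have h: "\<exists>x\<in>{\<lambda>_. 0, (\<lambda>_. 0)(0 := 1), (\<lambda>_. 0)(5 := 1), (\<lambda>_. 0)(1 := 1)}. ?h x \<noteq> 0"
    using assms(2) v by auto
  have hp: "polyfun ?h"
    by (intro polyfun_intros)
  show ?thesis
  \<comment> \<open>For \<open>x 4 = x 8 = 0\<close> the second point becomes (0, g, 0, 0), and the
    determinant is a product of two independent polynomial functions. This fails only if g is
    identically zero; then w = (0, 0, c', 0), and the parameter \<open>x 7\<close> separates the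
    slopes.\<close>
  proof (cases "a' = 0 \<and> b' = 0 \<and> d' = 0")
    case True
    then have "c' \<noteq> 0"
      using assms(3) w by auto
    obtain x where x: "?h x \<noteq> 0"
      using h by (rule bexE)
    define z where "z = x(4 := 1, 6 := 0, 7 := 1, 8 := 0)"
    have eq: "fst (chart z v) * fst (snd (cochart z w)) - fst (snd (chart z v)) * fst (cochart z w) = - c' * ?h x"
      using True by (simp add: v w z_def algebra_simps)
    show ?thesis
    proof
      show "fst (chart z v) * fst (snd (cochart z w)) - fst (snd (chart z v)) * fst (cochart z w) \<noteq> 0"
        unfolding eq using x \<open>c' \<noteq> 0\<close> by (simp only: mult_eq_0_iff neg_equal_0_iff_equal) simp
    qed
  next
    case False
    let ?g = "\<lambda>x :: nat \<Rightarrow> 'k. x 3 * b' + x 1 * a' - d'"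
    have g: "\<exists>x\<in>{\<lambda>_. 0, (\<lambda>_. 0)(3 := 1), (\<lambda>_. 0)(1 := 1)}. ?g x \<noteq> 0"
      using False by auto
    have gp: "polyfun ?g"
      by (intro polyfun_intros)
    define h' where "h' = ?h"
    define g' where "g' = ?g"
    obtain x1 where x1: "h' x1 \<noteq> 0"
      using h unfolding h'_def by (rule bexE)
    obtain x2 where x2: "g' x2 \<noteq> 0"
      using g unfolding g'_def by (rule bexE)
    obtain x where x: "h' x * g' x \<noteq> 0"
      using polyfun_mult_nonzero[of h' g' x1 x2] inf hp gp x1 x2 unfolding h'_def g'_def by blast
    define z where "z = x(4 := 0, 8 := 0)"
    have h1: "fst (chart z v) = h' x"
      unfolding v z_def h'_def chart.simps symp_move.simps fst_conv by simp
    have g1: "fst (snd (cochart z w)) = g' x"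
      unfolding w z_def g'_def cochart.simps symp_move.simps fst_conv snd_conv by simp
    have g0: "fst (cochart z w) = 0"
      unfolding w z_def cochart.simps symp_move.simps fst_conv by simp
    have eq: "fst (chart z v) * fst (snd (cochart z w)) - fst (snd (chart z v)) * fst (cochart z w) = h' x * g' x"
      unfolding h1 g1 g0 by (simp only: mult_zero_right diff_zero)
    show ?thesis
    proof
      show "fst (chart z v) * fst (snd (cochart z w)) - fst (snd (chart z v)) * fst (cochart z w) \<noteq> 0"
        unfolding eq by (fact x)
    qed
  qed
qed

text \<open>The transpose of \<open>cochart x\<close>: it brings a plane found in chart coordinates
  back to the original ones.\<close>

lemma dot4_cochart: "\<exists>c. \<forall>w. dot4 c w = dot4 a (cochart x w)"
proof -
  let ?f = "\<lambda>w. dot4 a (cochart x w)"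
  have "dot4 (?f (1, 0, 0, 0), ?f (0, 1, 0, 0), ?f (0, 0, 1, 0), ?f (0, 0, 0, 1)) w = ?f w" for w
    by (cases a; cases w) (simp add: algebra_simps)
  then show ?thesis
    by blast
qed

lemma dot4_chart: "\<exists>c. \<forall>w. dot4 c w = dot4 a (chart x w)"
proof -
  let ?f = "\<lambda>w. dot4 a (chart x w)"
  have "dot4 (?f (1, 0, 0, 0), ?f (0, 1, 0, 0), ?f (0, 0, 1, 0), ?f (0, 0, 0, 1)) w = ?f w" for w
    by (cases a; cases w) (simp add: algebra_simps)
  then show ?thesis
    by blast
qed

lemma dot4_scale4: "dot4 (scale4 k v) w = k * dot4 v w"
  by (cases v; cases w) (simp add: algebra_simps)

text \<open>The plane found by \<open>neighbours_on_quadric\<close> is not the polar plane of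
  \<open>V\<close>: its functional has the value \<open>fst V\<close> at \<open>V\<close>, where
  \<open>symp4 V\<close> vanishes. So the two planes intersect in a line.\<close>

lemma functional_not_symp4_multiple:
  fixes V :: "'k::field vec4"
  assumes "fst V \<noteq> 0"
  shows "\<exists>W. dot4 (\<kappa> * yint (line_of V) - \<mu> * slope (line_of V) + 1, \<mu>, - \<kappa>, 0) W \<noteq> k * symp4 V W"
proof (rule ccontr)
  assume *: "\<not> ?thesis"
  obtain a b c d where V: "V = (a, b, c, d)"
    by (cases V)
  have eq: "dot4 (\<kappa> * yint (line_of V) - \<mu> * slope (line_of V) + 1, \<mu>, - \<kappa>, 0) W = k * symp4 V W" for W
    using * by blast
  have "k = 0"
    using eq[of "(0, 0, 0, 1)"] assms by (simp add: V)
  then show False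
    using eq[of "(0, 1, 0, 0)"] eq[of "(0, 0, 1, 0)"] eq[of "(1, 0, 0, 0)"] by simp
qed

lemma functional_on_lines:
  assumes "fst W \<noteq> 0" "\<kappa> * (yint l - yint (line_of W)) + \<mu> * (slope (line_of W) - slope l) + 1 = 0"
  shows "dot4 (\<kappa> * yint l - \<mu> * slope l + 1, \<mu>, - \<kappa>, 0) W = 0"
proof -
  obtain a b c d where W: "W = (a, b, c, d)"
    by (cases W)
  have "dot4 (\<kappa> * yint l - \<mu> * slope l + 1, \<mu>, - \<kappa>, 0) W
      = a * (\<kappa> * (yint l - yint (line_of W)) + \<mu> * (slope (line_of W) - slope l) + 1)"
    using assms(1) by (simp add: W yint_def slope_def algebra_simps)
  then show ?thesis
    using assms(2) by simp
qed

lemma symp4_commute: "symp4 w v = - symp4 v w"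
  by (cases v; cases w) (simp add: algebra_simps)

declare chart.simps [simp del] cochart.simps [simp del] symp4.simps [simp del] dot4.simps [simp del]

text \<open>Every requirement is the nonvanishing of a polynomial function of \<open>x\<close> that
  is not identically zero, and there are finitely many of them.\<close>

lemma generic_charts:
  fixes P P' :: "'k::field vec4 set"
  assumes inf: "infinite (UNIV :: 'k set)" and fin: "finite P" "finite P'"
    and nz: "(0, 0, 0, 0) \<notin> P" "(0, 0, 0, 0) \<notin> P'"
    and indep: "\<And>v w k. v \<in> P \<Longrightarrow> w \<in> P \<Longrightarrow> v = scale4 k w \<Longrightarrow> v = w"
      "\<And>v w k. v \<in> P' \<Longrightarrow> w \<in> P' \<Longrightarrow> v = scale4 k w \<Longrightarrow> v = w"
  shows "\<exists>x. x 4 \<noteq> 0 \<and> (\<forall>v\<in>P. fst (chart x v) \<noteq> 0) \<and> (\<forall>w\<in>P'. fst (cochart x w) \<noteq> 0) \<and>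
    (\<forall>v\<in>P. \<forall>w\<in>P - {v}. symp4 (chart x v) (chart x w) \<noteq> 0) \<and>
    (\<forall>v\<in>P'. \<forall>w\<in>P' - {v}. symp4 (cochart x v) (cochart x w) \<noteq> 0) \<and>
    (\<forall>v\<in>P. \<forall>w\<in>P'. fst (chart x v) * fst (snd (cochart x w)) - fst (snd (chart x v)) * fst (cochart x w) \<noteq> 0)"
proof -
  define C1 where "C1 = (\<Union>v\<in>P. {\<lambda>x. fst (chart x v)})"
  define C2 where "C2 = (\<Union>w\<in>P'. {\<lambda>x. fst (cochart x w)})"
  define C3 where "C3 = (\<Union>v\<in>P. \<Union>w\<in>P - {v}. {\<lambda>x. symp4 (chart x v) (chart x w)})"
  define C4 where "C4 = (\<Union>v\<in>P'. \<Union>w\<in>P' - {v}. {\<lambda>x. symp4 (cochart x v) (cochart x w)})"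
  define C5 where "C5 = (\<Union>v\<in>P. \<Union>w\<in>P'.
    {\<lambda>x. fst (chart x v) * fst (snd (cochart x w)) - fst (snd (chart x v)) * fst (cochart x w)})"
  define C where "C = insert (\<lambda>x. x 4) (C1 \<union> C2 \<union> C3 \<union> C4 \<union> C5)"
  have "finite C"
    using fin by (simp add: C_def C1_def C2_def C3_def C4_def C5_def)
  moreover have "polyfun g \<and> (\<exists>x. g x \<noteq> 0)" if gC: "g \<in> C" for g
  proof -
    consider "g = (\<lambda>x. x 4)" | "g \<in> C1" | "g \<in> C2" | "g \<in> C3" | "g \<in> C4" | "g \<in> C5"
      using gC unfolding C_def insert_iff Un_iff by blast
    then show ?thesis
    proof cases
      case 1
      then show ?thesis
        by (auto intro!: polyfun.var exI[of _ "\<lambda>_. 1"])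
    next
      case 2
      then obtain v where "v \<in> P" "g = (\<lambda>x. fst (chart x v))"
        unfolding C1_def by blast
      then show ?thesis
        using polyfun_charts(1)[of v] fst_chart_nonzero[of v] nz by blast
    next
      case 3
      then obtain v where "v \<in> P'" "g = (\<lambda>x. fst (cochart x v))"
        unfolding C2_def by blast
      then show ?thesis
        using polyfun_charts(3)[of v] fst_cochart_nonzero[of v] nz by blast
    next
      case 4
      then obtain v w where vw: "v \<in> P" "w \<in> P" "v \<noteq> w" and g: "g = (\<lambda>x. symp4 (chart x v) (chart x w))"
        unfolding C3_def by blast
      have "\<nexists>k. v = scale4 k w" "w \<noteq> (0, 0, 0, 0)"
        using indep(1) vw nz by blast+
      then show ?thesis
        unfolding g using polyfun_charts(5)[of v w] symp4_chart_nonzero[of v w] by blast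
    next
      case 5
      then obtain v w where vw: "v \<in> P'" "w \<in> P'" "v \<noteq> w" and g: "g = (\<lambda>x. symp4 (cochart x v) (cochart x w))"
        unfolding C4_def by blast
      have "\<nexists>k. v = scale4 k w" "w \<noteq> (0, 0, 0, 0)"
        using indep(2) vw nz by blast+
      then show ?thesis
        unfolding g using polyfun_charts(6)[of v w] symp4_cochart_nonzero[OF inf, of v w] by blast
    next
      case 6
      then obtain v w where vw: "v \<in> P" "w \<in> P'" and g: "g = (\<lambda>x. fst (chart x v) * fst (snd (cochart x w))
          - fst (snd (chart x v)) * fst (cochart x w))"
        unfolding C5_def by blast
      have "v \<noteq> (0, 0, 0, 0)" "w \<noteq> (0, 0, 0, 0)"
        using vw nz by blast+
      moreover have "polyfun (\<lambda>x. fst (chart x v) * fst (snd (cochart x w)) - fst (snd (chart x v)) * fst (cochart x w))"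
        by (rule polyfun_diff[OF polyfun.mult polyfun.mult]) (rule polyfun_charts)+
      ultimately show ?thesis
        unfolding g using slopes_differ[OF inf, of v w] by blast
    qed
  qed
  ultimately have "\<exists>x. \<forall>g\<in>C. g x \<noteq> 0"
    by (rule polyfun_common_nonzero[OF inf])
  then obtain x where x: "\<And>g. g \<in> C \<Longrightarrow> g x \<noteq> 0"
    by blast
  have "fst (chart x v) \<noteq> 0" if "v \<in> P" for v
    by (rule x) (use that in \<open>unfold C_def C1_def, blast\<close>)
  moreover have "fst (cochart x v) \<noteq> 0" if "v \<in> P'" for v
    by (rule x) (use that in \<open>unfold C_def C2_def, blast\<close>)
  moreover have "symp4 (chart x v) (chart x w) \<noteq> 0" if "v \<in> P" "w \<in> P - {v}" for v w
    by (rule x[where g = "\<lambda>x. symp4 (chart x v) (chart x w)"]) (use that in \<open>unfold C_def C3_def, blast\<close>)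
  moreover have "symp4 (cochart x v) (cochart x w) \<noteq> 0" if "v \<in> P'" "w \<in> P' - {v}" for v w
    by (rule x[where g = "\<lambda>x. symp4 (cochart x v) (cochart x w)"]) (use that in \<open>unfold C_def C4_def, blast\<close>)
  moreover have "fst (chart x v) * fst (snd (cochart x w)) - fst (snd (chart x v)) * fst (cochart x w) \<noteq> 0"
    if "v \<in> P" "w \<in> P'" for v w
    by (rule x[where g = "\<lambda>x. fst (chart x v) * fst (snd (cochart x w)) - fst (snd (chart x v)) * fst (cochart x w)"])
      (use that in \<open>unfold C_def C5_def, blast\<close>)
  moreover have "x 4 \<noteq> 0"
    by (rule x) (simp add: C_def)
  ultimately show ?thesis
    by (intro exI[of _ x] conjI ballI)
qed

section \<open>Incidences of points and planes\<close>

text \<open>Rudnev's point-plane incidence bound, with the planes given by their normal vectors.\<close>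

lemma incidence_bound:
  fixes A B :: "'k::field vec4 set"
  assumes inf: "infinite (UNIV :: 'k set)" and fin: "finite A" "finite B"
    and nz: "(0, 0, 0, 0) \<notin> A" "(0, 0, 0, 0) \<notin> B"
    and indep: "\<And>v w k. v \<in> A \<Longrightarrow> w \<in> A \<Longrightarrow> v = scale4 k w \<Longrightarrow> v = w"
      "\<And>v w k. v \<in> B \<Longrightarrow> w \<in> B \<Longrightarrow> v = scale4 k w \<Longrightarrow> v = w"
    and E: "\<And>v w. v \<in> A \<Longrightarrow> w \<in> B \<Longrightarrow> E v w \<Longrightarrow> dot4 v w = 0"
    and collinear: "\<And>v c. v \<in> A \<Longrightarrow> \<nexists>k. c = scale4 k v \<Longrightarrow> card {w \<in> B. E v w \<and> dot4 c w = 0} \<le> D"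
      "\<And>w c. w \<in> B \<Longrightarrow> \<nexists>k. c = scale4 k w \<Longrightarrow> card {v \<in> A. E v w \<and> dot4 c v = 0} \<le> D"
    and m: "3 * card A \<le> (m + 1)\<^sup>2" "6 * m < CHAR('k)"
  shows "edges E A B \<le> (15 * m + D) * (card A + card B)"
proof (rule ccontr)
  assume "\<not> ?thesis"
  then have "(15 * m + D) * (card A + card B) < edges E A B"
    by simp
  from min_degree_subgraph[OF fin this] obtain A' B' where A': "A' \<subseteq> A" and B': "B' \<subseteq> B" and ne: "A' \<noteq> {}"
    and degA: "\<And>a. a \<in> A' \<Longrightarrow> 15 * m + D < card {b \<in> B'. E a b}"
    and degB: "\<And>b. b \<in> B' \<Longrightarrow> 15 * m + D < card {a \<in> A'. E a b}"
    by blast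
  have fin': "finite A'" "finite B'"
    using A' B' fin finite_subset by blast+
  obtain x where x: "x 4 \<noteq> 0 \<and> (\<forall>v\<in>A. fst (chart x v) \<noteq> 0) \<and> (\<forall>w\<in>B. fst (cochart x w) \<noteq> 0) \<and>
    (\<forall>v\<in>A. \<forall>w\<in>A - {v}. symp4 (chart x v) (chart x w) \<noteq> 0) \<and>
    (\<forall>v\<in>B. \<forall>w\<in>B - {v}. symp4 (cochart x v) (cochart x w) \<noteq> 0) \<and>
    (\<forall>v\<in>A. \<forall>w\<in>B. fst (chart x v) * fst (snd (cochart x w)) - fst (snd (chart x v)) * fst (cochart x w) \<noteq> 0)"
    using generic_charts[OF inf fin nz indep] by (rule exE)
  have x4: "x 4 \<noteq> 0" and x1: "\<And>v. v \<in> A \<Longrightarrow> fst (chart x v) \<noteq> 0"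
    and x2: "\<And>w. w \<in> B \<Longrightarrow> fst (cochart x w) \<noteq> 0"
    and x3: "\<And>v w. v \<in> A \<Longrightarrow> w \<in> A \<Longrightarrow> v \<noteq> w \<Longrightarrow> symp4 (chart x v) (chart x w) \<noteq> 0"
    and x3': "\<And>v w. v \<in> B \<Longrightarrow> w \<in> B \<Longrightarrow> v \<noteq> w \<Longrightarrow> symp4 (cochart x v) (cochart x w) \<noteq> 0"
    and x5: "\<And>v w. v \<in> A \<Longrightarrow> w \<in> B \<Longrightarrow>
      fst (chart x v) * fst (snd (cochart x w)) - fst (snd (chart x v)) * fst (cochart x w) \<noteq> 0"
    using x by blast+
  define L where "L v = line_of (chart x v)" for v
  define M where "M w = line_of (cochart x w)" for w
  have symp_0: "line_symp l l = 0" for l :: "'k line"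
    by (cases l) (simp add: line_symp_def algebra_simps)
  have symp_sym: "line_symp l l' = - line_symp l' l" for l l' :: "'k line"
    by (cases l; cases l') (simp add: line_symp_def algebra_simps)
  have LL: "line_symp (L v) (L w) \<noteq> 0" if "v \<in> A" "w \<in> A" "v \<noteq> w" for v w
    using x3[OF that] x1 that by (simp add: L_def line_symp_line_of)
  have MM: "line_symp (M v) (M w) \<noteq> 0" if "v \<in> B" "w \<in> B" "v \<noteq> w" for v w
    using x3'[OF that] x2 that by (simp add: M_def line_symp_line_of)
  have injL: "inj_on L A" and injM: "inj_on M B"
    using LL MM symp_0 by (metis inj_onI)+
  have LM: "line_symp (L v) (M w) = 0" "slope (L v) \<noteq> slope (M w)" if "v \<in> A" "w \<in> B" "E v w" for v w
  proof -
    show "line_symp (L v) (M w) = 0"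
      using E[OF that] x1 x2 that by (simp add: L_def M_def line_symp_line_of symp4_chart_cochart)
    show "slope (L v) \<noteq> slope (M w)"
      unfolding L_def M_def using x1 x2 x5 that by (intro slope_line_of) auto
  qed
  \<comment> \<open>A line is assigned to a family by its value alone, with precedence for the image
    of \<open>L\<close>; this makes the neighbourhoods of both families one function.\<close>
  define nb where "nb l = (if l \<in> L ` A' then M ` {w \<in> B'. \<exists>v\<in>A'. l = L v \<and> E v w}
    else L ` {v \<in> A'. \<exists>w\<in>B'. l = M w \<and> E v w})" for l
  have nbL: "nb (L v) = M ` {w \<in> B'. E v w}" if "v \<in> A'" for v
  proof -
    have "{w \<in> B'. \<exists>v'\<in>A'. L v = L v' \<and> E v' w} = {w \<in> B'. E v w}"
      using that A' injL by (auto dest!: inj_onD)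
    then show ?thesis
      using that by (simp add: nb_def)
  qed
  have nbM: "nb (M w) = L ` {v \<in> A'. E v w}" if "w \<in> B'" "M w \<notin> L ` A'" for w
  proof -
    have "{v \<in> A'. \<exists>w'\<in>B'. M w = M w' \<and> E v w'} = {v \<in> A'. E v w}"
      using that B' injM by (auto dest!: inj_onD)
    then show ?thesis
      using that by (simp add: nb_def)
  qed
  define \<Lambda> where "\<Lambda> = L ` A' \<union> M ` B'"
  have \<Lambda>_cases: "(\<exists>v\<in>A'. l = L v) \<or> (\<exists>w\<in>B'. l = M w \<and> M w \<notin> L ` A')" if "l \<in> \<Lambda>" for l
    using that unfolding \<Lambda>_def by blast
  have inA: "line_symp (L v) m = 0 \<and> slope (L v) \<noteq> slope m" if v: "v \<in> A'" and m: "m \<in> nb (L v)" for v m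
  proof -
    obtain w where "w \<in> B'" "E v w" "m = M w"
      using m unfolding nbL[OF v] by blast
    then show ?thesis
      using LM v A' B' by blast
  qed
  have inB: "line_symp (M w) m = 0 \<and> slope (M w) \<noteq> slope m" if w: "w \<in> B'" "M w \<notin> L ` A'" and m: "m \<in> nb (M w)" for w m
  proof -
    obtain v where v: "v \<in> A'" "E v w" "m = L v"
      using m unfolding nbM[OF w] by blast
    have "line_symp (L v) (M w) = 0" "slope (L v) \<noteq> slope (M w)"
      using LM v w A' B' by blast+
    then show ?thesis
      using symp_sym[of "M w" "L v"] v by auto
  qed
  interpret line_graph \<Lambda> nb
  proof
    fix l
    assume l: "l \<in> \<Lambda>"
    show "finite (nb l)"
      using fin' by (simp add: nb_def)
    show "nb l \<subseteq> \<Lambda>"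
      by (auto simp: nb_def \<Lambda>_def)
    fix m
    assume m: "m \<in> nb l"
    show "line_symp l m = 0" "slope l \<noteq> slope m"
      using \<Lambda>_cases[OF l] m inA inB by blast+
    fix m'
    assume m': "m' \<in> nb l" "m \<noteq> m'"
    show "line_symp m m' \<noteq> 0"
      using \<Lambda>_cases[OF l]
    proof (elim disjE bexE conjE)
      fix v
      assume v: "v \<in> A'" "l = L v"
      obtain w w' where "w \<in> B'" "m = M w" "w' \<in> B'" "m' = M w'"
        using m m' unfolding v(2) nbL[OF v(1)] by blast
      then show ?thesis
        using MM[of w w'] m'(2) B' by blast
    next
      fix w
      assume w: "w \<in> B'" "l = M w" "M w \<notin> L ` A'"
      obtain v v' where "v \<in> A'" "m = L v" "v' \<in> A'" "m' = L v'"
        using m m' unfolding w(2) nbM[OF w(1,3)] by blast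
      then show ?thesis
        using LL[of v v'] m'(2) A' by blast
    qed
  qed
  have card_nbL: "card (nb (L v)) = card {w \<in> B'. E v w}" if "v \<in> A'" for v
    unfolding nbL[OF that] using B' by (intro card_image inj_on_subset[OF injM]) auto
  have card_nbM: "card (nb (M w)) = card {v \<in> A'. E v w}" if "w \<in> B'" "M w \<notin> L ` A'" for w
    unfolding nbM[OF that] using A' by (intro card_image inj_on_subset[OF injL]) auto
  have deg: "15 * m + D < card (nb l)" if "l \<in> \<Lambda>" for l
    using \<Lambda>_cases[OF that]
  proof (elim disjE bexE conjE)
    fix v
    assume v: "v \<in> A'" "l = L v"
    show ?thesis
      unfolding v(2) card_nbL[OF v(1)] by (rule degA[OF v(1)])
  next
    fix w
    assume w: "w \<in> B'" "l = M w" "M w \<notin> L ` A'"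
    show ?thesis
      unfolding w(2) card_nbM[OF w(1,3)] by (rule degB[OF w(1)])
  qed
  have "card (L ` A') \<le> card A"
    using card_image_le[OF fin'(1), of L] card_mono[OF fin(1) A'] by linarith
  then have "3 * card (L ` A') \<le> (m + 1)\<^sup>2"
    using m(1) by linarith
  then obtain f where f: "f \<noteq> 0" "total_degree_le f (3 * m)" "\<forall>l\<in>L ` A'. on_line l f = 0"
    using exists_poly3_vanishing_on_lines[of "L ` A'" m] fin' by auto
  \<comment> \<open>\<open>f\<close> was chosen for the first family only. A line of the second
    family meets more than \<open>15 * m + D\<close> lines of the first, more than the degree
    \<open>3 * m\<close> allows, so \<open>f\<close> vanishes on it as well. Hence only
    \<open>card A\<close> governs \<open>m\<close>.\<close>
  have f_\<Lambda>: "on_line l f = 0" if l: "l \<in> \<Lambda>" for l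
    using \<Lambda>_cases[OF l]
  proof
    assume "\<exists>v\<in>A'. l = L v"
    then show ?thesis
      using f by blast
  next
    assume "\<exists>w\<in>B'. l = M w \<and> M w \<notin> L ` A'"
    then have "nb l \<subseteq> L ` A'"
      using nbM by auto
    moreover have "poly (on_line l f) (meet_at l l') = poly (on_line l' f) (meet_at l l')" if "l' \<in> nb l" for l'
      using poly_on_line_meet_at nb_symp nb_slope l that by blast
    ultimately show ?thesis
      using f(3) deg[OF l] by (intro on_line_eq_0I[OF l f(2)]) auto
  qed
  \<comment> \<open>The degree bound is now \<open>3 * m\<close>: this is the origin of
    \<open>15 * m = 5 * (3 * m)\<close> and of \<open>6 * m < CHAR('k)\<close>.\<close>
  have "\<exists>l\<in>\<Lambda>. \<exists>\<kappa> \<mu>. card (nb l) \<le> card {l' \<in> nb l. \<kappa> * (yint l - yint l') + \<mu> * (slope l' - slope l) + 1 = 0} + 3 * m"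
  proof (rule neighbours_on_quadric[OF _ f(1,2)])
    show "\<Lambda> \<noteq> {}"
      using ne by (simp add: \<Lambda>_def)
    show "5 * (3 * m) < card (nb l)" if "l \<in> \<Lambda>" for l
      using deg[OF that] by simp
    show "2 * (3 * m) < CHAR('k)"
      using m by simp
  qed (rule f_\<Lambda>)
  then obtain l \<kappa> \<mu> where l: "l \<in> \<Lambda>"
    and quad: "card (nb l) \<le> card {l' \<in> nb l. \<kappa> * (yint l - yint l') + \<mu> * (slope l' - slope l) + 1 = 0} + 3 * m"
    by blast
  let ?N = "{l' \<in> nb l. \<kappa> * (yint l - yint l') + \<mu> * (slope l' - slope l) + 1 = 0}"
  let ?a = "(\<kappa> * yint l - \<mu> * slope l + 1, \<mu>, - \<kappa>, 0)"
  \<comment> \<open>Pulled back through the charts, the second plane is given by a vector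
    \<open>c\<close> that is no multiple of the one belonging to \<open>l\<close>. So
    \<open>collinear\<close> applies, and with the \<open>3 * m\<close> exceptions the degree of
    \<open>l\<close> is too small.\<close>
  have "card ?N \<le> D"
    using \<Lambda>_cases[OF l]
  proof
    assume "\<exists>v\<in>A'. l = L v"
    then obtain v where v: "v \<in> A'" "l = L v"
      by blast
    obtain c where c: "\<And>w. dot4 c w = dot4 ?a (cochart x w)"
      using dot4_cochart[of ?a x] by blast
    have "c \<noteq> scale4 k v" for k
    proof
      assume ck: "c = scale4 k v"
      obtain W where W: "dot4 ?a W \<noteq> k / x 4 * symp4 (chart x v) W"
        using functional_not_symp4_multiple[of "chart x v"] x1 v A' unfolding v(2) L_def by blast
      obtain w where w: "cochart x w = W"
        using cochart_surj[of x W] x4 by blast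
      have "dot4 c w = k * dot4 v w"
        by (simp add: ck dot4_scale4)
      also have "\<dots> = k / x 4 * symp4 (chart x v) W"
        using x4 by (simp add: w[symmetric] symp4_chart_cochart)
      finally show False
        using W c w by simp
    qed
    then have D: "card {w \<in> B. E v w \<and> dot4 c w = 0} \<le> D"
      using collinear(1) v A' by blast
    have "?N \<subseteq> M ` {w \<in> B. E v w \<and> dot4 c w = 0}"
    proof
      fix l'
      assume l': "l' \<in> ?N"
      then obtain w where w: "w \<in> B'" "E v w" "l' = M w"
        using nbL[OF v(1)] v(2) by auto
      have "dot4 ?a (cochart x w) = 0"
      proof (rule functional_on_lines)
        show "fst (cochart x w) \<noteq> 0"
          using x2 w B' by blast
        show "\<kappa> * (yint l - yint (line_of (cochart x w))) + \<mu> * (slope (line_of (cochart x w)) - slope l) + 1 = 0"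
          using l' unfolding w(3) M_def by blast
      qed
      then show "l' \<in> M ` {w \<in> B. E v w \<and> dot4 c w = 0}"
        using w c B' by auto
    qed
    then have "card ?N \<le> card {w \<in> B. E v w \<and> dot4 c w = 0}"
      by (rule surj_card_le[rotated]) (simp add: fin)
    then show ?thesis
      using D by (rule order_trans)
  next
    assume "\<exists>w\<in>B'. l = M w \<and> M w \<notin> L ` A'"
    then obtain w where w: "w \<in> B'" "l = M w" "M w \<notin> L ` A'"
      by blast
    obtain c where c: "\<And>v. dot4 c v = dot4 ?a (chart x v)"
      using dot4_chart[of ?a x] by blast
    have "c \<noteq> scale4 k w" for k
    proof
      assume ck: "c = scale4 k w"
      obtain V where V: "dot4 ?a V \<noteq> - k / x 4 * symp4 (cochart x w) V"
        using functional_not_symp4_multiple[of "cochart x w"] x2 w B' unfolding w(2) M_def by blast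
      obtain v where v: "chart x v = V"
        using chart_surj[of x V] x4 by blast
      have "dot4 c v = k * dot4 v w"
        unfolding ck dot4_scale4 by (cases v; cases w) (simp add: dot4.simps algebra_simps)
      also have "\<dots> = k / x 4 * symp4 (chart x v) (cochart x w)"
        using x4 by (simp add: symp4_chart_cochart)
      also have "\<dots> = - k / x 4 * symp4 (cochart x w) V"
        unfolding v symp4_commute[of V] by simp
      finally show False
        using V c v by simp
    qed
    then have D: "card {v \<in> A. E v w \<and> dot4 c v = 0} \<le> D"
      using collinear(2) w B' by blast
    have "?N \<subseteq> L ` {v \<in> A. E v w \<and> dot4 c v = 0}"
    proof
      fix l'
      assume l': "l' \<in> ?N"
      then obtain v where v: "v \<in> A'" "E v w" "l' = L v"
        using nbM[OF w(1,3)] w(2) by auto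
      have "dot4 ?a (chart x v) = 0"
      proof (rule functional_on_lines)
        show "fst (chart x v) \<noteq> 0"
          using x1 v A' by blast
        show "\<kappa> * (yint l - yint (line_of (chart x v))) + \<mu> * (slope (line_of (chart x v)) - slope l) + 1 = 0"
          using l' unfolding v(3) L_def by blast
      qed
      then show "l' \<in> L ` {v \<in> A. E v w \<and> dot4 c v = 0}"
        using v c A' by auto
    qed
    then have "card ?N \<le> card {v \<in> A. E v w \<and> dot4 c v = 0}"
      by (rule surj_card_le[rotated]) (simp add: fin)
    then show ?thesis
      using D by (rule order_trans)
  qed
  then show False
    using quad deg[OF l] by simp
qed

text \<open>Otherwise 1 plus the product of all X - a would be a nonconstant polynomial without
  roots.\<close>

lemma infinite_UNIV_alg_closed: "infinite (UNIV :: 'k::alg_closed_field set)"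
proof
  assume fin: "finite (UNIV :: 'k set)"
  define q where "q = (\<Prod>a\<in>(UNIV :: 'k set). [:- a, 1:])"
  have "degree q = card (UNIV :: 'k set)"
    by (simp add: q_def degree_prod_eq_sum_degree)
  then have "degree (q + 1) > 0"
    using fin by (subst degree_add_eq_left) (auto simp: card_gt_0_iff)
  then obtain z where "poly (q + 1) z = 0"
    using alg_closed_imp_poly_has_root by blast
  moreover have "poly q z = 0"
    unfolding q_def poly_prod using fin by (intro prod_zero) auto
  ultimately show False
    by simp
qed

section \<open>Collisions, and bilinear forms on the plane\<close>

text \<open>Cauchy-Schwarz for the fibre sizes, in the form that the sum of all (n v - n w)^2 is
  nonnegative.\<close>

lemma card_square_le_collisions:
  assumes "finite A" "finite W" "g ` A \<subseteq> W"
  shows "(card A)\<^sup>2 \<le> card W * card {(x, y). x \<in> A \<and> y \<in> A \<and> g x = g y}"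
proof -
  define n where "n w = int (card {x \<in> A. g x = w})" for w
  have A: "int (card A) = (\<Sum>w\<in>W. n w)"
  proof -
    have "A = (\<Union>w\<in>W. {x \<in> A. g x = w})"
      using assms by auto
    then have "card A = card (\<Union>w\<in>W. {x \<in> A. g x = w})"
      by simp
    also have "\<dots> = (\<Sum>w\<in>W. card {x \<in> A. g x = w})"
      using assms by (intro card_UN_disjoint) auto
    finally show ?thesis
      by (simp add: n_def)
  qed
  have pairs: "int (card {(x, y). x \<in> A \<and> y \<in> A \<and> g x = g y}) = (\<Sum>w\<in>W. (n w)\<^sup>2)"
  proof -
    have "{(x, y). x \<in> A \<and> y \<in> A \<and> g x = g y} = (\<Union>w\<in>W. {x \<in> A. g x = w} \<times> {x \<in> A. g x = w})"
      using assms by auto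
    then have "card {(x, y). x \<in> A \<and> y \<in> A \<and> g x = g y} = card (\<Union>w\<in>W. {x \<in> A. g x = w} \<times> {x \<in> A. g x = w})"
      by simp
    also have "\<dots> = (\<Sum>w\<in>W. card ({x \<in> A. g x = w} \<times> {x \<in> A. g x = w}))"
      using assms by (intro card_UN_disjoint) auto
    finally show ?thesis
      by (simp add: n_def card_cartesian_product power2_eq_square)
  qed
  have "0 \<le> (\<Sum>v\<in>W. \<Sum>w\<in>W. (n v - n w)\<^sup>2)"
    by (intro sum_nonneg) auto
  also have "\<dots> = (\<Sum>v\<in>W. \<Sum>w\<in>W. (n v)\<^sup>2 + (n w)\<^sup>2 - 2 * (n v * n w))"
    by (simp add: power2_diff mult.assoc)
  also have "\<dots> = 2 * (int (card W) * (\<Sum>w\<in>W. (n w)\<^sup>2)) - 2 * (\<Sum>w\<in>W. n w)\<^sup>2"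
  proof -
    have "(\<Sum>v\<in>W. \<Sum>w\<in>W. (n v)\<^sup>2) = int (card W) * (\<Sum>w\<in>W. (n w)\<^sup>2)"
      by (simp add: sum_distrib_left)
    moreover have "(\<Sum>v\<in>W. \<Sum>w\<in>W. (n w)\<^sup>2) = int (card W) * (\<Sum>w\<in>W. (n w)\<^sup>2)"
      by simp
    moreover have "(\<Sum>v\<in>W. \<Sum>w\<in>W. 2 * (n v * n w)) = 2 * (\<Sum>w\<in>W. n w)\<^sup>2"
    proof -
      have "(\<Sum>w\<in>W. n w)\<^sup>2 = (\<Sum>v\<in>W. \<Sum>w\<in>W. n v * n w)"
        unfolding power2_eq_square by (rule sum_product)
      then show ?thesis
        by (simp only: sum_distrib_left)
    qed
    ultimately show ?thesis
      by (simp only: sum.distrib sum_subtractf)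
  qed
  finally have "(\<Sum>w\<in>W. n w)\<^sup>2 \<le> int (card W) * (\<Sum>w\<in>W. (n w)\<^sup>2)"
    by simp
  then have "int ((card A)\<^sup>2) \<le> int (card W * card {(x, y). x \<in> A \<and> y \<in> A \<and> g x = g y})"
    by (simp add: A pairs)
  then show ?thesis
    by linarith
qed

type_synonym 'k vec2 = "'k \<times> 'k"

definition scale2 :: "'k::field \<Rightarrow> 'k vec2 \<Rightarrow> 'k vec2" where
  "scale2 k v = (k * fst v, k * snd v)"

text \<open>A homogeneous coordinate of degree one that is nonzero off the origin. Dividing by it,
  \<open>dir2\<close> selects one vector on each line through the origin, the one whose first
  nonzero coordinate is 1.\<close>

definition size2 :: "'k::field vec2 \<Rightarrow> 'k" where
  "size2 v = (if fst v \<noteq> 0 then fst v else snd v)"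

definition dir2 :: "'k::field vec2 \<Rightarrow> 'k vec2" where
  "dir2 v = scale2 (inverse (size2 v)) v"

lemma size2_nonzero: "v \<noteq> (0, 0) \<Longrightarrow> size2 v \<noteq> 0"
  by (cases v) (auto simp: size2_def)

lemma scale2_scale2: "scale2 k (scale2 l v) = scale2 (k * l) v"
  by (simp add: scale2_def mult.assoc)

lemma scale2_1 [simp]: "scale2 1 v = v"
  by (simp add: scale2_def)

lemma scale2_eq_0_iff: "scale2 k v = (0, 0) \<longleftrightarrow> k = 0 \<or> v = (0, 0)"
  by (cases v) (auto simp: scale2_def)

lemma size2_scale2: "size2 (scale2 k v) = k * size2 v"
  by (auto simp: size2_def scale2_def)

lemma scale2_size2_dir2: "v \<noteq> (0, 0) \<Longrightarrow> scale2 (size2 v) (dir2 v) = v"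
  by (simp add: dir2_def scale2_scale2 size2_nonzero)

lemma dir2_scale2:
  assumes "k \<noteq> 0"
  shows "dir2 (scale2 k v) = dir2 v"
proof -
  have "inverse (k * size2 v) * k = inverse (size2 v)"
    using assms by (cases "size2 v = 0") (auto simp: field_simps)
  then show ?thesis
    unfolding dir2_def size2_scale2 scale2_scale2 by (rule arg_cong[where f = "\<lambda>k. scale2 k v"])
qed

lemma dir2_nonzero: "v \<noteq> (0, 0) \<Longrightarrow> dir2 v \<noteq> (0, 0)"
  by (simp add: dir2_def scale2_eq_0_iff size2_nonzero)

lemma size2_dir2: "v \<noteq> (0, 0) \<Longrightarrow> size2 (dir2 v) = 1"
  by (simp add: dir2_def size2_scale2 size2_nonzero)

text \<open>\<epsilon> is 1 for symmetric and -1 for skew-symmetric forms, so that both symmetries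
  share one argument.\<close>

locale bilin =
  fixes w11 w12 w21 w22 \<epsilon> :: "'f::field"
  assumes det: "w11 * w22 - w12 * w21 \<noteq> 0"
    and eps: "w11 = \<epsilon> * w11" "w22 = \<epsilon> * w22" "w12 = \<epsilon> * w21" "w21 = \<epsilon> * w12"
begin

definition om :: "'f vec2 \<Rightarrow> 'f vec2 \<Rightarrow> 'f" where
  "om u v = w11 * fst u * fst v + w12 * fst u * snd v + w21 * snd u * fst v + w22 * snd u * snd v"

lemma eps_nonzero: "\<epsilon> \<noteq> 0"
proof
  assume "\<epsilon> = 0"
  then have "w11 = 0" "w22 = 0" "w12 = 0"
    using eps(1-3) by simp_all
  then show False
    using det by simp
qed

lemma om_commute: "om u v = \<epsilon> * om v u"
proof -
  have "\<epsilon> * om v u = (\<epsilon> * w11) * fst u * fst v + (\<epsilon> * w21) * fst u * snd v + (\<epsilon> * w12) * snd u * fst v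
      + (\<epsilon> * w22) * snd u * snd v"
    by (simp add: om_def algebra_simps)
  then show ?thesis
    unfolding eps[symmetric] by (simp add: om_def)
qed

lemma om_scale [simp]: "om (scale2 k u) v = k * om u v" "om u (scale2 k v) = k * om u v"
  by (simp_all add: om_def scale2_def algebra_simps)

lemma om_diff: "om (fst u - fst v, snd u - snd v) w = om u w - om v w"
  "om w (fst u - fst v, snd u - snd v) = om w u - om w v"
  by (simp_all add: om_def algebra_simps)

lemma om_zero [simp]: "om (0, 0) v = 0" "om v (0, 0) = 0"
  by (simp_all add: om_def)

text \<open>By nondegeneracy a nonzero \<open>x\<close> defines a nonzero functional, whose kernel
  is one-dimensional.\<close>

lemma om_zero_parallel:
  assumes "om u x = 0" "om v x = 0" "x \<noteq> (0, 0)"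
  shows "fst u * snd v = snd u * fst v"
proof -
  obtain a b where x: "x = (a, b)"
    by (cases x)
  define \<alpha> where "\<alpha> = w11 * a + w12 * b"
  define \<beta> where "\<beta> = w21 * a + w22 * b"
  have "\<alpha> \<noteq> 0 \<or> \<beta> \<noteq> 0"
  proof (rule ccontr)
    assume "\<not> ?thesis"
    then have "\<alpha> = 0" "\<beta> = 0"
      by auto
    moreover have "w22 * \<alpha> - w12 * \<beta> = (w11 * w22 - w12 * w21) * a" "w11 * \<beta> - w21 * \<alpha> = (w11 * w22 - w12 * w21) * b"
      by (simp_all add: \<alpha>_def \<beta>_def algebra_simps)
    ultimately show False
      using det assms(3) x by auto
  qed
  have u: "fst u * \<alpha> + snd u * \<beta> = 0" and v: "fst v * \<alpha> + snd v * \<beta> = 0"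
    using assms(1,2) by (simp_all add: om_def x \<alpha>_def \<beta>_def algebra_simps)
  have "\<alpha> * (fst u * snd v - snd u * fst v) = snd v * (fst u * \<alpha> + snd u * \<beta>) - snd u * (fst v * \<alpha> + snd v * \<beta>)"
    "\<beta> * (fst u * snd v - snd u * fst v) = fst u * (fst v * \<alpha> + snd v * \<beta>) - fst v * (fst u * \<alpha> + snd u * \<beta>)"
    by (simp_all add: algebra_simps)
  then have "\<alpha> * (fst u * snd v - snd u * fst v) = 0" "\<beta> * (fst u * snd v - snd u * fst v) = 0"
    by (simp_all add: u v)
  then show ?thesis
    using \<open>\<alpha> \<noteq> 0 \<or> \<beta> \<noteq> 0\<close> by auto
qed

lemma om_zero_parallel':
  assumes "om x u = 0" "om x v = 0" "x \<noteq> (0, 0)"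
  shows "fst u * snd v = snd u * fst v"
  using om_zero_parallel[of u x v] assms om_commute[of u x] om_commute[of v x] by simp

end

lemma parallel_imp_scale2:
  fixes u v :: "'k::field vec2"
  assumes "fst u * snd v = snd u * fst v" "v \<noteq> (0, 0)"
  shows "\<exists>k. u = scale2 k v"
proof (cases "fst v = 0")
  case True
  then show ?thesis
    using assms by (intro exI[of _ "snd u / snd v"]) (cases u; cases v; auto simp: scale2_def)
next
  case False
  then show ?thesis
    using assms by (intro exI[of _ "fst u / fst v"]) (cases u; cases v; auto simp: scale2_def field_simps)
qed

lemma parallel_imp_dir2_eq:
  fixes u v :: "'k::field vec2"
  assumes "fst u * snd v = snd u * fst v" "u \<noteq> (0, 0)" "v \<noteq> (0, 0)"
  shows "dir2 u = dir2 v"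
proof -
  obtain k where k: "u = scale2 k v"
    using parallel_imp_scale2[OF assms(1,3)] by blast
  then have "k \<noteq> 0"
    using assms(2) by (auto simp: scale2_def)
  then show ?thesis
    by (simp add: k dir2_scale2)
qed

context bilin
begin

definition vals :: "'f vec2 set \<Rightarrow> 'f set" where
  "vals S = (\<lambda>(s, t). om s t) ` (S \<times> S)"

lemma finite_vals: "finite S \<Longrightarrow> finite (vals S)"
  by (simp add: vals_def)

lemma om_in_vals: "s \<in> S \<Longrightarrow> t \<in> S \<Longrightarrow> om s t \<in> vals S"
  by (force simp: vals_def)

lemma vals_mono: "S \<subseteq> T \<Longrightarrow> vals S \<subseteq> vals T"
  by (auto simp: vals_def)

text \<open>The fibres of \<open>om s\<close> are parallel lines whose direction determines the direction of \<open>s\<close>. So a pair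
  of distinct points lies in a common fibre for at most one \<open>s\<close>, while few values force many such pairs.\<close>

lemma card_le_twice_vals:
  assumes fin: "finite T" and nz: "(0, 0) \<notin> T" and inj: "inj_on dir2 T"
  shows "card T \<le> 2 * card (vals T)"
proof (cases "T = {}")
  case True
  then show ?thesis
    by simp
next
  case False
  define n where "n = card T"
  have n: "n > 0"
    using False fin by (simp add: n_def card_gt_0_iff)
  have 1: "n\<^sup>2 \<le> card (vals T) * card {(x, y). x \<in> T \<and> y \<in> T \<and> om s x = om s y}" if "s \<in> T" for s
    unfolding n_def using fin that
    by (intro card_square_le_collisions finite_vals) (auto intro: om_in_vals)
  define E where "E s z \<longleftrightarrow> om s (fst z) = om s (snd z)" for s z
  have "n * n\<^sup>2 \<le> (\<Sum>s\<in>T. card (vals T) * card {(x, y). x \<in> T \<and> y \<in> T \<and> om s x = om s y})"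
    using sum_mono[of T "\<lambda>_. n\<^sup>2", OF 1] by (simp add: n_def)
  also have "\<dots> = card (vals T) * edges E T (T \<times> T)"
  proof -
    have "{(x, y). x \<in> T \<and> y \<in> T \<and> om s x = om s y} = {z \<in> T \<times> T. E s z}" for s
      by (auto simp: E_def)
    then show ?thesis
      by (simp add: edges_def sum_distrib_left)
  qed
  also have "edges E T (T \<times> T) = (\<Sum>z\<in>T \<times> T. card {s \<in> T. E s z})"
    using edges_swap[of T "T \<times> T" E] fin by (simp add: edges_def)
  also have "\<dots> \<le> (\<Sum>z\<in>T \<times> T. 1 + (if fst z = snd z then n else 0))"
  proof (rule sum_mono)
    fix z
    assume z: "z \<in> T \<times> T"
    show "card {s \<in> T. E s z} \<le> 1 + (if fst z = snd z then n else 0)"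
    proof (cases "fst z = snd z")
      case True
      have "card {s \<in> T. E s z} \<le> n"
        unfolding n_def using fin by (intro card_mono) auto
      then show ?thesis
        using True by simp
    next
      case False
      define x where "x = (fst (fst z) - fst (snd z), snd (fst z) - snd (snd z))"
      have x: "x \<noteq> (0, 0)"
        using False by (auto simp: x_def prod_eq_iff)
      have E0: "om s x = 0" if "E s z" for s
        using that by (simp add: x_def E_def om_diff)
      have "s = s'" if "s \<in> {s \<in> T. E s z}" "s' \<in> {s \<in> T. E s z}" for s s'
      proof -
        have ss: "s \<in> T" "s' \<in> T" "om s x = 0" "om s' x = 0"
          using that E0 by auto
        then have "s \<noteq> (0, 0)" "s' \<noteq> (0, 0)"
          using nz by auto
        then have "dir2 s = dir2 s'"
          using om_zero_parallel[OF ss(3,4) x] by (intro parallel_imp_dir2_eq) auto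
        then show ?thesis
          using ss inj by (auto dest: inj_onD)
      qed
      then have "card {s \<in> T. E s z} \<le> 1"
        using fin card_le_Suc0_iff_eq[of "{s \<in> T. E s z}"] by auto
      then show ?thesis
        by simp
    qed
  qed
  \<comment> \<open>The diagonal contributes n^2 and so does everything else, whence the factor 2
    after cancelling n^2.\<close>
  also have "\<dots> = n * n + (\<Sum>z\<in>T \<times> T. if fst z = snd z then n else 0)"
    by (simp only: sum.distrib) (simp add: card_cartesian_product n_def)
  also have "(\<Sum>z\<in>T \<times> T. if fst z = snd z then n else 0) = (\<Sum>x\<in>T. \<Sum>y\<in>T. if x = y then n else 0)"
    by (simp add: sum.cartesian_product case_prod_beta)
  also have "\<dots> = n * n"
    using fin by (simp add: n_def)
  finally have "n * n\<^sup>2 \<le> card (vals T) * (n * n + n * n)"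
    by simp
  moreover have "n * n\<^sup>2 = (n * n) * n" "card (vals T) * (n * n + n * n) = (n * n) * (2 * card (vals T))"
    by (simp_all add: power2_eq_square algebra_simps)
  ultimately have "(n * n) * n \<le> (n * n) * (2 * card (vals T))"
    by (simp only:)
  then have "n \<le> 2 * card (vals T)"
    using n by (metis mult_le_cancel1 nat_0_less_mult_iff)
  then show ?thesis
    by (simp add: n_def)
qed

end

section \<open>Equal form values as incidences in projective space over the algebraic
  closure\<close>

abbreviation to_ac2 :: "'f::field vec2 \<Rightarrow> 'f alg_closure vec2" where
  "to_ac2 v \<equiv> (to_ac (fst v), to_ac (snd v))"

lemma size2_to_ac2: "size2 (to_ac2 v) = to_ac (size2 v)"
  by (simp add: size2_def)

context bilin
begin

abbreviation om_ac :: "'f alg_closure vec2 \<Rightarrow> 'f alg_closure vec2 \<Rightarrow> 'f alg_closure" where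
  "om_ac \<equiv> bilin.om (to_ac w11) (to_ac w12) (to_ac w21) (to_ac w22)"

lemma bilin_to_ac: "bilin (to_ac w11) (to_ac w12) (to_ac w21) (to_ac w22) (to_ac \<epsilon>)"
proof
  show "to_ac w11 * to_ac w22 - to_ac w12 * to_ac w21 \<noteq> 0"
    using det by (simp flip: to_ac_mult to_ac_diff)
qed (use eps in \<open>metis to_ac_mult\<close>)+

lemma om_ac_to_ac2: "om_ac (to_ac2 u) (to_ac2 v) = to_ac (om u v)"
  by (simp add: om_def bilin.om_def[OF bilin_to_ac])

text \<open>Representatives of the points (s : t) of projective space. Normalising \<open>s\<close>
  uses up the common factor; the length of \<open>t\<close> remains free and only its direction is
  restricted.\<close>

definition normed_pairs :: "'f vec2 set \<Rightarrow> ('f vec2 \<times> 'f vec2) set" where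
  "normed_pairs \<Delta> = {(s, t). s \<in> \<Delta> \<and> size2 s = 1 \<and> t \<noteq> (0, 0) \<and> dir2 t \<in> \<Delta>}"

text \<open>Incidence of the point \<open>q\<close> with the plane dual to \<open>q'\<close>.
  Excluding the value 0 is what makes a neighbour recoverable from directions.\<close>

definition rel :: "'f vec2 \<times> 'f vec2 \<Rightarrow> 'f vec2 \<times> 'f vec2 \<Rightarrow> bool" where
  "rel q q' \<longleftrightarrow> om (fst q) (fst q') = om (snd q) (snd q') \<and> om (fst q) (fst q') \<noteq> 0"

lemma rel_commute: "rel q q' \<longleftrightarrow> rel q' q"
  unfolding rel_def om_commute[of "fst q"] om_commute[of "snd q"] using eps_nonzero by auto

lemma size2_1_parallel:
  fixes u v :: "'f vec2"
  assumes "fst u * snd v = snd u * fst v" "size2 u = 1" "size2 v = 1"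
  shows "u = v"
proof -
  have "u \<noteq> (0, 0)" "v \<noteq> (0, 0)"
    using assms(2,3) by (auto simp: size2_def)
  then have "dir2 u = dir2 v"
    using assms(1) by (intro parallel_imp_dir2_eq)
  then show ?thesis
    using assms(2,3) by (simp add: dir2_def)
qed

text \<open>Either the first components are distinct, and they lie in \<Delta>; or two neighbours
  share one, and the difference of their second components forces \<delta> = k t. Then \<gamma> - k
  s is nonzero and orthogonal to all first components, which therefore coincide. Now the direction
  of a second component determines its length, as its product with t has a fixed nonzero
  value.\<close>

lemma few_neighbours:
  fixes \<gamma> \<delta> :: "'f alg_closure vec2"
  assumes fin: "finite \<Delta>" and t: "t \<noteq> (0, 0)"
    and indep: "\<And>k. \<not> (\<gamma> = scale2 k (to_ac2 s) \<and> \<delta> = scale2 k (to_ac2 t))"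
    and N: "N \<subseteq> normed_pairs \<Delta>" "\<And>q. q \<in> N \<Longrightarrow> rel (s, t) q"
      "\<And>q. q \<in> N \<Longrightarrow> om_ac \<gamma> (to_ac2 (fst q)) = om_ac \<delta> (to_ac2 (snd q))"
  shows "card N \<le> card \<Delta>"
proof -
  interpret K: bilin "to_ac w11" "to_ac w12" "to_ac w21" "to_ac w22" "to_ac \<epsilon>"
    by (rule bilin_to_ac)
  show ?thesis
  proof (cases "inj_on fst N")
    case True
    have "fst ` N \<subseteq> \<Delta>"
      using N(1) by (auto simp: normed_pairs_def)
    then show ?thesis
      using True fin card_inj_on_le by blast
  next
    case False
    then obtain q q' where q: "q \<in> N" "q' \<in> N" "fst q = fst q'" "q \<noteq> q'"
      unfolding inj_on_def by blast
    define x where "x = (fst (snd q) - fst (snd q'), snd (snd q) - snd (snd q'))"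
    have x0: "x \<noteq> (0, 0)"
      using q(3,4) by (auto simp: x_def prod_eq_iff)
    have "om t x = 0"
      using N(2)[OF q(1)] N(2)[OF q(2)] q(3) by (simp add: x_def om_diff rel_def)
    then have tx: "om_ac (to_ac2 t) (to_ac2 x) = 0"
      by (simp only: om_ac_to_ac2) simp
    have dx: "om_ac \<delta> (to_ac2 x) = 0"
      using N(3)[OF q(1)] N(3)[OF q(2)] q(3)
        K.om_diff(2)[of \<delta> "to_ac2 (snd q)" "to_ac2 (snd q')"] by (simp add: x_def)
    have "to_ac2 x \<noteq> (0, 0)" "to_ac2 t \<noteq> (0, 0)"
      using x0 t by (auto simp: prod_eq_iff)
    then obtain k where k: "\<delta> = scale2 k (to_ac2 t)"
      using K.om_zero_parallel[OF dx tx] parallel_imp_scale2 by blast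
    define \<gamma>' where "\<gamma>' = (fst \<gamma> - fst (scale2 k (to_ac2 s)), snd \<gamma> - snd (scale2 k (to_ac2 s)))"
    have g0: "\<gamma>' \<noteq> (0, 0)"
      using indep[of k] k by (auto simp: \<gamma>'_def prod_eq_iff)
    have g: "om_ac \<gamma>' (to_ac2 (fst r)) = 0" if "r \<in> N" for r
    proof -
      have "om_ac \<gamma>' (to_ac2 (fst r)) = om_ac \<gamma> (to_ac2 (fst r)) - k * om_ac (to_ac2 s) (to_ac2 (fst r))"
        unfolding \<gamma>'_def K.om_diff(1) K.om_scale ..
      also have "om_ac \<gamma> (to_ac2 (fst r)) = k * om_ac (to_ac2 t) (to_ac2 (snd r))"
        unfolding N(3)[OF that] k K.om_scale ..
      also have "om_ac (to_ac2 t) (to_ac2 (snd r)) = om_ac (to_ac2 s) (to_ac2 (fst r))"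
        unfolding om_ac_to_ac2 using N(2)[OF that] by (simp add: rel_def)
      finally show ?thesis
        by simp
    qed
    have same: "fst r = fst r'" if "r \<in> N" "r' \<in> N" for r r'
    proof -
      have "to_ac (fst (fst r) * snd (fst r')) = to_ac (snd (fst r) * fst (fst r'))"
        using K.om_zero_parallel'[OF g[OF that(1)] g[OF that(2)] g0] by simp
      then have "fst (fst r) * snd (fst r') = snd (fst r) * fst (fst r')"
        by (simp only: to_ac_eq_iff)
      moreover have "size2 (fst r) = 1" "size2 (fst r') = 1"
        using N(1) that by (auto simp: normed_pairs_def)
      ultimately show ?thesis
        by (rule size2_1_parallel)
    qed
    have "inj_on (\<lambda>q. dir2 (snd q)) N"
    proof (rule inj_onI)
      fix r r'
      assume r: "r \<in> N" "r' \<in> N" "dir2 (snd r) = dir2 (snd r')"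
      define d where "d = dir2 (snd r)"
      have nz: "snd r \<noteq> (0, 0)" "snd r' \<noteq> (0, 0)"
        using N(1) r by (auto simp: normed_pairs_def)
      have e: "snd r = scale2 (size2 (snd r)) d" "snd r' = scale2 (size2 (snd r')) d"
        using scale2_size2_dir2[OF nz(1)] scale2_size2_dir2[OF nz(2)] r(3) by (simp_all add: d_def)
      have "om t (snd r) = om t (snd r')" "om t (snd r) \<noteq> 0"
        using N(2)[OF r(1)] N(2)[OF r(2)] same[OF r(1,2)] by (auto simp: rel_def)
      moreover have "om t (snd r) = size2 (snd r) * om t d"
        by (subst e(1)) simp
      moreover have "om t (snd r') = size2 (snd r') * om t d"
        by (subst e(2)) simp
      ultimately have "size2 (snd r) = size2 (snd r')"
        by auto
      then have "snd r = snd r'"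
        using e by simp
      then show "r = r'"
        using same[OF r(1,2)] by (simp add: prod_eq_iff)
    qed
    moreover have "(\<lambda>q. dir2 (snd q)) ` N \<subseteq> \<Delta>"
      using N(1) by (auto simp: normed_pairs_def)
    ultimately show ?thesis
      using fin card_inj_on_le by blast
  qed
qed

definition emb :: "'f vec2 \<times> 'f vec2 \<Rightarrow> 'f alg_closure vec4" where
  "emb q = (to_ac (fst (fst q)), to_ac (snd (fst q)), to_ac (fst (snd q)), to_ac (snd (snd q)))"

text \<open>Normal vector of the plane of all (a, b) with om a (fst q) = om b (snd q).\<close>

definition dual :: "'f vec2 \<times> 'f vec2 \<Rightarrow> 'f alg_closure vec4" where
  "dual q = (to_ac (w11 * fst (fst q) + w12 * snd (fst q)), to_ac (w21 * fst (fst q) + w22 * snd (fst q)),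
    - to_ac (w11 * fst (snd q) + w12 * snd (snd q)), - to_ac (w21 * fst (snd q) + w22 * snd (snd q)))"

lemma dot4_dual: "dot4 (c1, c2, c3, c4) (dual q) = om_ac (c1, c2) (to_ac2 (fst q)) - om_ac (c3, c4) (to_ac2 (snd q))"
  by (simp add: dual_def dot4.simps bilin.om_def[OF bilin_to_ac] algebra_simps)

lemma dot4_emb_dual: "dot4 (emb q) (dual q') = to_ac (om (fst q) (fst q') - om (snd q) (snd q'))"
  by (simp add: emb_def dot4_dual om_ac_to_ac2)

lemma linear_system_ac:
  assumes "to_ac w11 * x + to_ac w12 * y = 0" "to_ac w21 * x + to_ac w22 * y = 0"
  shows "x = 0 \<and> y = 0"
proof -
  let ?d = "to_ac w11 * to_ac w22 - to_ac w12 * to_ac w21"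
  have "?d * x = to_ac w22 * (to_ac w11 * x + to_ac w12 * y) - to_ac w12 * (to_ac w21 * x + to_ac w22 * y)"
    "?d * y = to_ac w11 * (to_ac w21 * x + to_ac w22 * y) - to_ac w21 * (to_ac w11 * x + to_ac w12 * y)"
    by (simp_all add: algebra_simps)
  then have "?d * x = 0" "?d * y = 0"
    by (simp_all add: assms)
  then show ?thesis
    using bilin.det[OF bilin_to_ac] by simp
qed

lemma dual_scale4:
  assumes "dual q = scale4 k (dual q')"
  shows "emb q = scale4 k (emb q')"
proof -
  have *: "to_ac w11 * (to_ac (fst (fst q)) - k * to_ac (fst (fst q'))) + to_ac w12 * (to_ac (snd (fst q)) - k * to_ac (snd (fst q'))) = 0"
    "to_ac w21 * (to_ac (fst (fst q)) - k * to_ac (fst (fst q'))) + to_ac w22 * (to_ac (snd (fst q)) - k * to_ac (snd (fst q'))) = 0"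
    "to_ac w11 * (to_ac (fst (snd q)) - k * to_ac (fst (snd q'))) + to_ac w12 * (to_ac (snd (snd q)) - k * to_ac (snd (snd q'))) = 0"
    "to_ac w21 * (to_ac (fst (snd q)) - k * to_ac (fst (snd q'))) + to_ac w22 * (to_ac (snd (snd q)) - k * to_ac (snd (snd q'))) = 0"
    using assms by (simp_all add: dual_def algebra_simps)
  show ?thesis
    using linear_system_ac[OF *(1,2)] linear_system_ac[OF *(3,4)] by (simp add: emb_def)
qed

lemma emb_scale4:
  assumes "emb q = scale4 k (emb q')" "size2 (fst q) = 1" "size2 (fst q') = 1"
  shows "q = q'"
proof -
  have "to_ac2 (fst q) = scale2 k (to_ac2 (fst q'))"
    using assms(1) by (simp add: emb_def scale2_def)
  then have "size2 (to_ac2 (fst q)) = k * size2 (to_ac2 (fst q'))"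
    by (simp only: size2_scale2)
  then have "k = 1"
    unfolding size2_to_ac2 assms(2,3) by simp
  then show ?thesis
    using assms(1) by (simp add: emb_def prod_eq_iff)
qed

lemma edges_image:
  assumes "inj_on g A" "inj_on h B"
  shows "edges (\<lambda>v w. \<exists>a\<in>A. \<exists>b\<in>B. v = g a \<and> w = h b \<and> R a b) (g ` A) (h ` B) = edges R A B"
proof -
  have "{w \<in> h ` B. \<exists>a'\<in>A. \<exists>b\<in>B. g a = g a' \<and> w = h b \<and> R a' b} = h ` {b \<in> B. R a b}" if "a \<in> A" for a
    using that assms(1) by (auto dest: inj_onD)
  moreover have "card (h ` {b \<in> B. R a b}) = card {b \<in> B. R a b}" for a
    by (intro card_image inj_on_subset[OF assms(2)]) auto
  ultimately show ?thesis
    unfolding edges_def by (simp add: sum.reindex[OF assms(1)])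
qed

text \<open>Passing to the algebraic closure makes the field infinite and keeps the characteristic.
  The collinearity bound \<open>card \<Delta>\<close> comes from \<open>few_neighbours\<close>, for
  points and planes alike.\<close>

lemma normed_incidence_bound:
  assumes fin: "finite \<Delta>" "finite A" "finite B" and sub: "A \<subseteq> normed_pairs \<Delta>" "B \<subseteq> normed_pairs \<Delta>"
    and m: "3 * card A \<le> (m + 1)\<^sup>2" "6 * m < CHAR('f)"
  shows "edges rel A B \<le> (15 * m + card \<Delta>) * (card A + card B)"
proof -
  interpret K: bilin "to_ac w11" "to_ac w12" "to_ac w21" "to_ac w22" "to_ac \<epsilon>"
    by (rule bilin_to_ac)
  have sizeA: "size2 (fst q) = 1" "snd q \<noteq> (0, 0)" if "q \<in> A" for q
    using that sub by (auto simp: normed_pairs_def)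
  have sizeB: "size2 (fst q) = 1" "snd q \<noteq> (0, 0)" if "q \<in> B" for q
    using that sub by (auto simp: normed_pairs_def)
  have scale4_1: "scale4 1 v = v" for v :: "'f alg_closure vec4"
    by (cases v) simp
  have injA: "inj_on emb A"
    using emb_scale4[where k = 1] sizeA by (auto simp: inj_on_def scale4_1)
  have dualB: "q = q'" if "q \<in> B" "q' \<in> B" "dual q = scale4 k (dual q')" for q q' k
    using emb_scale4[OF dual_scale4[OF that(3)]] sizeB that by blast
  have injB: "inj_on dual B"
    using dualB[where k = 1] by (auto simp: inj_on_def scale4_1)
  define E where "E = (\<lambda>v w. \<exists>a\<in>A. \<exists>b\<in>B. v = emb a \<and> w = dual b \<and> rel a b)"
  have "edges E (emb ` A) (dual ` B) \<le> (15 * m + card \<Delta>) * (card (emb ` A) + card (dual ` B))"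
  proof (rule incidence_bound[OF infinite_UNIV_alg_closed])
    show "finite (emb ` A)" "finite (dual ` B)"
      using fin by auto
    show "(0, 0, 0, 0) \<notin> emb ` A"
      using sizeA by (auto simp: emb_def prod_eq_iff)
    have e0: "emb q \<noteq> (0, 0, 0, 0)" if "q \<in> B" for q
      using sizeB[OF that] by (auto simp: emb_def prod_eq_iff)
    have "dual q \<noteq> (0, 0, 0, 0)" if "q \<in> B" for q
    proof
      assume "dual q = (0, 0, 0, 0)"
      then have "dual q = scale4 0 (dual q)"
        by simp
      then have "emb q = scale4 0 (emb q)"
        by (rule dual_scale4)
      then show False
        using e0[OF that] by (cases "emb q") simp
    qed
    then show "(0, 0, 0, 0) \<notin> dual ` B"
      by (metis imageE)
    show "v = w" if "v \<in> emb ` A" "w \<in> emb ` A" "v = scale4 k w" for v w k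
      using that emb_scale4 sizeA by blast
    show "v = w" if "v \<in> dual ` B" "w \<in> dual ` B" "v = scale4 k w" for v w k
      using that dualB by blast
    show "dot4 v w = 0" if "E v w" for v w
      using that by (auto simp: E_def dot4_emb_dual rel_def)
    show "3 * card (emb ` A) \<le> (m + 1)\<^sup>2"
      using m(1) by (simp add: card_image[OF injA])
    show "6 * m < CHAR('f alg_closure)"
      using m(2) by simp
  next
    fix v c
    assume v: "v \<in> emb ` A" and c: "\<nexists>k. c = scale4 k v"
    obtain q where q: "q \<in> A" "v = emb q"
      using v by blast
    obtain c1 c2 c3 c4 where c': "c = (c1, c2, c3, c4)"
      by (cases c)
    define N where "N = {q' \<in> B. rel q q' \<and> dot4 c (dual q') = 0}"
    have "{w \<in> dual ` B. E v w \<and> dot4 c w = 0} \<subseteq> dual ` N"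
    proof
      fix w
      assume w: "w \<in> {w \<in> dual ` B. E v w \<and> dot4 c w = 0}"
      then obtain a b where ab: "a \<in> A" "b \<in> B" "v = emb a" "w = dual b" "rel a b"
        by (auto simp: E_def)
      then have "a = q"
        using q injA by (auto dest: inj_onD)
      then show "w \<in> dual ` N"
        using ab w by (auto simp: N_def)
    qed
    then have "card {w \<in> dual ` B. E v w \<and> dot4 c w = 0} \<le> card N"
      by (rule surj_card_le[rotated]) (simp add: N_def fin)
    also have "card N \<le> card \<Delta>"
    proof (rule few_neighbours[OF fin(1)])
      show "snd q \<noteq> (0, 0)"
        using sizeA q by blast
      show "N \<subseteq> normed_pairs \<Delta>"
        using sub by (auto simp: N_def)
      show "rel (fst q, snd q) r" if "r \<in> N" for r
        using that by (simp add: N_def)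
      show "om_ac (c1, c2) (to_ac2 (fst r)) = om_ac (c3, c4) (to_ac2 (snd r))" if "r \<in> N" for r
        using that by (simp add: N_def c' dot4_dual)
      show "\<not> ((c1, c2) = scale2 k (to_ac2 (fst q)) \<and> (c3, c4) = scale2 k (to_ac2 (snd q)))" for k
        using c by (auto simp: c' q(2) emb_def scale2_def)
    qed
    finally show "card {w \<in> dual ` B. E v w \<and> dot4 c w = 0} \<le> card \<Delta>" .
  next
    fix w c
    assume w: "w \<in> dual ` B" and c: "\<nexists>k. c = scale4 k w"
    obtain q where q: "q \<in> B" "w = dual q"
      using w by blast
    obtain c1 c2 c3 c4 where c': "c = (c1, c2, c3, c4)"
      by (cases c)
    let ?d = "to_ac w11 * to_ac w22 - to_ac w12 * to_ac w21"
    \<comment> \<open>Cramer's rule writes the functional \<open>c\<close> on points as pairing with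
      (\<gamma>, \<delta>) on the right; \<open>om_commute\<close> moves it to the left at the cost
      of \<epsilon>, so that \<open>few_neighbours\<close> applies with points and planes
      exchanged.\<close>
    define \<gamma> where "\<gamma> = ((to_ac w22 * c1 - to_ac w12 * c2) / ?d, (to_ac w11 * c2 - to_ac w21 * c1) / ?d)"
    define \<delta> where "\<delta> = (- (to_ac w22 * c3 - to_ac w12 * c4) / ?d, - (to_ac w11 * c4 - to_ac w21 * c3) / ?d)"
    have solve: "to_ac w11 * fst \<gamma> + to_ac w12 * snd \<gamma> = c1" "to_ac w21 * fst \<gamma> + to_ac w22 * snd \<gamma> = c2"
      "to_ac w11 * fst \<delta> + to_ac w12 * snd \<delta> = - c3" "to_ac w21 * fst \<delta> + to_ac w22 * snd \<delta> = - c4"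
    proof -
      define d where "d = ?d"
      have d0: "d \<noteq> 0"
        using K.det by (simp add: d_def)
      have "d * (to_ac w11 * fst \<gamma> + to_ac w12 * snd \<gamma>) = d * c1" "d * (to_ac w21 * fst \<gamma> + to_ac w22 * snd \<gamma>) = d * c2"
        "d * (to_ac w11 * fst \<delta> + to_ac w12 * snd \<delta>) = d * (- c3)" "d * (to_ac w21 * fst \<delta> + to_ac w22 * snd \<delta>) = d * (- c4)"
        unfolding \<gamma>_def \<delta>_def d_def[symmetric] using d0
        by (simp_all add: distrib_left, simp_all add: d_def algebra_simps)
      then show "to_ac w11 * fst \<gamma> + to_ac w12 * snd \<gamma> = c1" "to_ac w21 * fst \<gamma> + to_ac w22 * snd \<gamma> = c2"
        "to_ac w11 * fst \<delta> + to_ac w12 * snd \<delta> = - c3" "to_ac w21 * fst \<delta> + to_ac w22 * snd \<delta> = - c4"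
        using d0 by (simp_all only: mult_cancel_left) simp_all
    qed
    have dot_c: "dot4 c (emb r) = to_ac \<epsilon> * (om_ac \<gamma> (to_ac2 (fst r)) - om_ac \<delta> (to_ac2 (snd r)))" for r
    proof -
      have "om_ac (to_ac2 (fst r)) \<gamma> - om_ac (to_ac2 (snd r)) \<delta>
        = (to_ac w11 * fst \<gamma> + to_ac w12 * snd \<gamma>) * to_ac (fst (fst r))
          + (to_ac w21 * fst \<gamma> + to_ac w22 * snd \<gamma>) * to_ac (snd (fst r))
          - (to_ac w11 * fst \<delta> + to_ac w12 * snd \<delta>) * to_ac (fst (snd r))
          - (to_ac w21 * fst \<delta> + to_ac w22 * snd \<delta>) * to_ac (snd (snd r))"
        unfolding K.om_def by (simp add: algebra_simps)
      also have "\<dots> = dot4 c (emb r)"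
        unfolding solve by (simp add: c' emb_def dot4.simps)
      finally have "dot4 c (emb r) = om_ac (to_ac2 (fst r)) \<gamma> - om_ac (to_ac2 (snd r)) \<delta>"
        by (rule sym)
      then show ?thesis
        by (simp add: K.om_commute[of "to_ac2 (fst r)"] K.om_commute[of "to_ac2 (snd r)"] right_diff_distrib)
    qed
    define N where "N = {q' \<in> A. rel q' q \<and> dot4 c (emb q') = 0}"
    have "{v \<in> emb ` A. E v w \<and> dot4 c v = 0} \<subseteq> emb ` N"
    proof
      fix v
      assume v: "v \<in> {v \<in> emb ` A. E v w \<and> dot4 c v = 0}"
      then obtain a b where ab: "a \<in> A" "b \<in> B" "v = emb a" "w = dual b" "rel a b"
        by (auto simp: E_def)
      then have "b = q"
        using q injB by (auto dest: inj_onD)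
      then show "v \<in> emb ` N"
        using ab v by (auto simp: N_def)
    qed
    then have "card {v \<in> emb ` A. E v w \<and> dot4 c v = 0} \<le> card N"
      by (rule surj_card_le[rotated]) (simp add: N_def fin)
    also have "card N \<le> card \<Delta>"
    proof (rule few_neighbours[OF fin(1)])
      show "snd q \<noteq> (0, 0)"
        using sizeB q by blast
      show "N \<subseteq> normed_pairs \<Delta>"
        using sub by (auto simp: N_def)
      show "rel (fst q, snd q) r" if "r \<in> N" for r
        using that by (simp add: N_def rel_commute[of q])
      show "om_ac \<gamma> (to_ac2 (fst r)) = om_ac \<delta> (to_ac2 (snd r))" if "r \<in> N" for r
        using that K.eps_nonzero by (simp add: N_def dot_c)
      show "\<not> (\<gamma> = scale2 k (to_ac2 (fst q)) \<and> \<delta> = scale2 k (to_ac2 (snd q)))" for k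
      proof
        assume "\<gamma> = scale2 k (to_ac2 (fst q)) \<and> \<delta> = scale2 k (to_ac2 (snd q))"
        then have gd: "\<gamma> = scale2 k (to_ac2 (fst q))" "\<delta> = scale2 k (to_ac2 (snd q))"
          by auto
        have "c = scale4 k (dual q)"
        proof -
          have "c3 = - (to_ac w11 * fst \<delta> + to_ac w12 * snd \<delta>)" "c4 = - (to_ac w21 * fst \<delta> + to_ac w22 * snd \<delta>)"
            "c1 = to_ac w11 * fst \<gamma> + to_ac w12 * snd \<gamma>" "c2 = to_ac w21 * fst \<gamma> + to_ac w22 * snd \<gamma>"
            using solve by simp_all
          then have "c = (to_ac w11 * fst \<gamma> + to_ac w12 * snd \<gamma>, to_ac w21 * fst \<gamma> + to_ac w22 * snd \<gamma>,
              - (to_ac w11 * fst \<delta> + to_ac w12 * snd \<delta>), - (to_ac w21 * fst \<delta> + to_ac w22 * snd \<delta>))"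
            using c' by (simp only:)
          then show ?thesis
            unfolding gd scale2_def dual_def fst_conv snd_conv by (simp add: algebra_simps)
        qed
        then show False
          using c q by blast
      qed
    qed
    finally show "card {v \<in> emb ` A. E v w \<and> dot4 c v = 0} \<le> card \<Delta>" .
  qed
  then show ?thesis
    unfolding E_def edges_image[OF injA injB] card_image[OF injA] card_image[OF injB] .
qed

end

section \<open>Averaging and layers of multiplicity\<close>

text \<open>Telescoping: 1 / b \<le> 2 (b - a) for the square roots a, b of consecutive
  numbers.\<close>

lemma sum_inverse_sqrt_le: "(\<Sum>i=1..k. 1 / sqrt (real i)) \<le> 2 * sqrt (real k)"
proof (induction k)
  case 0
  then show ?case
    by simp
next
  case (Suc k)
  define a where "a = sqrt (real k)"
  define b where "b = sqrt (real (Suc k))"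
  have b: "b > 0" "a \<ge> 0"
    by (auto simp: a_def b_def)
  have "b * b = a * a + 1"
    by (simp add: a_def b_def)
  then have "2 * (a * b) + 1 \<le> 2 * (b * b)"
    using zero_le_square[of "a - b"] by (simp add: algebra_simps)
  then have "1 / b \<le> 2 * b - 2 * a"
    using b by (simp add: field_simps)
  then show ?case
    using Suc.IH by (simp add: a_def b_def)
qed

text \<open>Dropping an element with the least value of \<open>g\<close> never lowers the
  average.\<close>

lemma subset_with_large_sum:
  fixes g :: "'a \<Rightarrow> nat"
  assumes "finite A" "m \<le> card A"
  shows "\<exists>A0\<subseteq>A. card A0 = m \<and> m * sum g A \<le> card A * sum g A0"
  using assms
proof (induction "card A" arbitrary: A)
  case 0
  then show ?case
    by auto
next
  case (Suc c)
  show ?case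
  proof (cases "m = card A")
    case True
    then show ?thesis
      by (intro exI[of _ A]) auto
  next
    case False
    then have mc: "m \<le> c"
      using Suc.hyps Suc.prems by simp
    have "A \<noteq> {}"
      using Suc.hyps by auto
    define a where "a = arg_min_on g A"
    have a: "a \<in> A" "\<And>x. x \<in> A \<Longrightarrow> g a \<le> g x"
      using arg_min_if_finite(1)[OF Suc.prems(1) \<open>A \<noteq> {}\<close>] arg_min_least[OF Suc.prems(1) \<open>A \<noteq> {}\<close>]
      by (auto simp: a_def)
    have cA: "card (A - {a}) = c"
      using Suc.hyps Suc.prems a by simp
    then obtain A0 where A0: "A0 \<subseteq> A - {a}" "card A0 = m" "m * sum g (A - {a}) \<le> c * sum g A0"
      using Suc.hyps(1)[of "A - {a}"] Suc.prems mc by auto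
    have sA: "sum g A = g a + sum g (A - {a})"
      using a Suc.prems by (simp add: sum.remove)
    have "c * g a \<le> sum g (A - {a})"
      using sum_mono[of "A - {a}" "\<lambda>_. g a" g] a cA by simp
    then have "c * sum g A \<le> Suc c * sum g (A - {a})"
      by (simp add: sA algebra_simps)
    then have "m * (c * sum g A) \<le> m * (Suc c * sum g (A - {a}))"
      by (rule mult_le_mono2)
    also have "\<dots> \<le> Suc c * (c * sum g A0)"
      using mult_le_mono2[OF A0(3), of "Suc c"] by (simp only: ac_simps)
    finally have "c * (m * sum g A) \<le> c * (Suc c * sum g A0)"
      by (simp only: ac_simps)
    then have "m * sum g A \<le> Suc c * sum g A0"
      using mc by (cases "c = 0") (simp_all only: mult_le_cancel1, auto)
    then show ?thesis
      using A0 Suc.hyps by (intro exI[of _ A0]) auto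
  qed
qed

lemma sum_over_fibres:
  fixes g :: "'b \<Rightarrow> nat"
  assumes "finite A"
  shows "(\<Sum>x\<in>A. g (f x)) = (\<Sum>y\<in>f ` A. card {x \<in> A. f x = y} * g y)"
proof -
  have "(\<Sum>x\<in>A. g (f x)) = (\<Sum>y\<in>f ` A. \<Sum>x\<in>{x \<in> A. f x = y}. g (f x))"
    by (rule sum.image_gen[OF assms])
  also have "\<dots> = (\<Sum>y\<in>f ` A. card {x \<in> A. f x = y} * g y)"
    by (intro sum.cong refl) simp
  finally show ?thesis .
qed

lemma edges_of_bool:
  assumes "finite B"
  shows "edges R A B = (\<Sum>a\<in>A. \<Sum>b\<in>B. of_bool (R a b))"
  unfolding edges_def using assms by (simp add: of_bool_def sum.If_cases Int_def)

text \<open>Layer-cake decomposition: a multiplicity is the number of positive i not exceeding it,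
  so a count weighted by multiplicities is a sum of unweighted counts between layers. The last claim
  is Markov's inequality.\<close>

lemma edges_layers:
  fixes f :: "'a \<Rightarrow> 'b"
  assumes fin: "finite A" and R: "\<And>x y. x \<in> A \<Longrightarrow> y \<in> A \<Longrightarrow> R' (f x) (f y) = R x y"
    and k: "\<And>q. card {x \<in> A. f x = q} \<le> k"
  defines "L \<equiv> \<lambda>i. {q \<in> f ` A. i \<le> card {x \<in> A. f x = q}}"
  shows "edges R A A = (\<Sum>i=1..k. \<Sum>j=1..k. edges R' (L i) (L j))"
    and "(\<Sum>i=1..k. card (L i)) = card A" and "i * card (L i) \<le> card A"
proof -
  define w where "w q = card {x \<in> A. f x = q}" for q
  have w: "w q = (\<Sum>i=1..k. of_bool (i \<le> w q))" for q
  proof -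
    have "{i \<in> {1..k}. i \<le> w q} = {1..w q}"
      using k[of q] by (auto simp: w_def)
    then have "card {i \<in> {1..k}. i \<le> w q} = w q"
      by simp
    then show ?thesis
      by (simp add: of_bool_def sum.If_cases Int_def)
  qed
  have finP: "finite (f ` A)"
    using fin by simp
  have L_eq: "L i = {q \<in> f ` A. i \<le> w q}" for i
    by (simp add: L_def w_def)
  have finL: "finite (L i)" for i
    using finP by (simp add: L_eq)
  have sumL: "(\<Sum>q\<in>L i. h q) = (\<Sum>q\<in>f ` A. of_bool (i \<le> w q) * h q)" for i and h :: "'b \<Rightarrow> nat"
    unfolding L_eq using finP by (simp add: of_bool_def sum.If_cases Int_def if_distrib[of "\<lambda>t. t * _"] cong: if_cong)
  have "edges R A A = (\<Sum>x\<in>A. \<Sum>y\<in>A. of_bool (R' (f x) (f y)))"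
    using fin by (simp add: edges_of_bool R)
  also have "\<dots> = (\<Sum>x\<in>A. \<Sum>q'\<in>f ` A. w q' * of_bool (R' (f x) q'))"
    unfolding w_def using sum_over_fibres[OF fin, of "\<lambda>q'. of_bool (R' _ q')" f] by simp
  also have "\<dots> = (\<Sum>q\<in>f ` A. w q * (\<Sum>q'\<in>f ` A. w q' * of_bool (R' q q')))"
    using sum_over_fibres[OF fin, of "\<lambda>q. (\<Sum>q'\<in>f ` A. w q' * of_bool (R' q q'))" f] by (simp add: w_def)
  also have "\<dots> = (\<Sum>q\<in>f ` A. (\<Sum>i=1..k. of_bool (i \<le> w q)) * (\<Sum>q'\<in>f ` A. (\<Sum>j=1..k. of_bool (j \<le> w q')) * of_bool (R' q q')))"
    by (simp only: w[symmetric])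
  also have "\<dots> = (\<Sum>q\<in>f ` A. \<Sum>i=1..k. of_bool (i \<le> w q) * (\<Sum>j=1..k. \<Sum>q'\<in>f ` A. of_bool (j \<le> w q') * of_bool (R' q q')))"
    by (simp only: sum_distrib_right sum.swap[of _ "{1..k}" "f ` A"])
  also have "\<dots> = (\<Sum>i=1..k. \<Sum>q\<in>f ` A. of_bool (i \<le> w q) * (\<Sum>j=1..k. \<Sum>q'\<in>L j. of_bool (R' q q')))"
    unfolding sumL by (rule sum.swap)
  also have "\<dots> = (\<Sum>i=1..k. \<Sum>q\<in>L i. \<Sum>j=1..k. \<Sum>q'\<in>L j. of_bool (R' q q'))"
    by (simp only: sumL)
  also have "\<dots> = (\<Sum>i=1..k. \<Sum>j=1..k. \<Sum>q\<in>L i. \<Sum>q'\<in>L j. of_bool (R' q q'))"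
    by (intro sum.cong refl sum.swap)
  also have "\<dots> = (\<Sum>i=1..k. \<Sum>j=1..k. edges R' (L i) (L j))"
    by (simp add: edges_of_bool[OF finL])
  finally show "edges R A A = (\<Sum>i=1..k. \<Sum>j=1..k. edges R' (L i) (L j))" .
  have cardA: "card A = (\<Sum>q\<in>f ` A. w q)"
    using sum_over_fibres[OF fin, of "\<lambda>_. 1" f] by (simp add: w_def)
  also have "\<dots> = (\<Sum>q\<in>f ` A. \<Sum>i=1..k. of_bool (i \<le> w q))"
    by (simp only: w[symmetric])
  also have "\<dots> = (\<Sum>i=1..k. \<Sum>q\<in>f ` A. of_bool (i \<le> w q) * 1)"
    by (subst sum.swap) simp
  also have "\<dots> = (\<Sum>i=1..k. card (L i))"
    by (intro sum.cong refl) (subst sumL[symmetric], simp)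
  finally show "(\<Sum>i=1..k. card (L i)) = card A"
    by simp
  have "i * card (L i) = (\<Sum>q\<in>L i. i)"
    by simp
  also have "\<dots> \<le> (\<Sum>q\<in>L i. w q)"
    by (rule sum_mono) (simp add: L_eq)
  also have "\<dots> \<le> (\<Sum>q\<in>f ` A. w q)"
    using finP by (intro sum_mono2) (auto simp: L_eq)
  finally show "i * card (L i) \<le> card A"
    by (simp add: cardA)
qed

section \<open>Incidence bounds for families of any size\<close>

context bilin
begin

text \<open>With \<open>m\<close> the integer part of sqrt (3 * card A) the parameter count works,
  and (6 m)^2 \<le> 108 * card A keeps the degree admissible for the characteristic.\<close>

lemma edges_rel_small:
  assumes fin: "finite \<Delta>" "finite A" "finite B" and sub: "A \<subseteq> normed_pairs \<Delta>" "B \<subseteq> normed_pairs \<Delta>"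
    and AB: "card A \<le> card B" and p: "108 * card A < CHAR('f)\<^sup>2"
  shows "real (edges rel A B) \<le> 2 * real (card B) * (30 * sqrt (real (card A)) + real (card \<Delta>))"
proof -
  define m where "m = nat \<lfloor>sqrt (3 * real (card A))\<rfloor>"
  have m_le: "real m \<le> sqrt (3 * real (card A))" and m_ge: "sqrt (3 * real (card A)) < real m + 1"
    by (simp_all add: m_def)
  have "3 * real (card A) = (sqrt (3 * real (card A)))\<^sup>2"
    by simp
  also have "\<dots> \<le> (real m + 1)\<^sup>2"
    using m_ge by (intro power_mono) auto
  finally have "real (3 * card A) \<le> real ((m + 1)\<^sup>2)"
    by (simp add: add.commute)
  then have m1: "3 * card A \<le> (m + 1)\<^sup>2"
    by (simp only: of_nat_le_iff)
  have "(real m)\<^sup>2 \<le> (sqrt (3 * real (card A)))\<^sup>2"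
    using m_le by (intro power_mono) auto
  then have "real (m\<^sup>2) \<le> real (3 * card A)"
    by simp
  then have "m\<^sup>2 \<le> 3 * card A"
    by (simp only: of_nat_le_iff)
  then have "(6 * m)\<^sup>2 < CHAR('f)\<^sup>2"
    using p by (simp add: power_mult_distrib)
  then have m2: "6 * m < CHAR('f)"
    by (rule power_less_imp_less_base) simp
  have "sqrt (3 * real (card A)) \<le> sqrt (2\<^sup>2 * real (card A))"
    by (simp add: real_sqrt_le_mono)
  also have "\<dots> = 2 * sqrt (real (card A))"
    by (simp add: real_sqrt_mult)
  finally have m3: "real m \<le> 2 * sqrt (real (card A))"
    using m_le by linarith
  have "edges rel A B \<le> (15 * m + card \<Delta>) * (card A + card B)"
    by (rule normed_incidence_bound[OF fin sub m1 m2])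
  then have "real (edges rel A B) \<le> real ((15 * m + card \<Delta>) * (card A + card B))"
    by (simp only: of_nat_le_iff)
  also have "\<dots> = (15 * real m + real (card \<Delta>)) * (real (card A) + real (card B))"
    by simp
  also have "\<dots> \<le> (30 * sqrt (real (card A)) + real (card \<Delta>)) * (2 * real (card B))"
    using m3 AB by (intro mult_mono) auto
  finally show ?thesis
    by (simp add: mult.commute)
qed

text \<open>If \<open>A\<close> is too large for the previous bound, n points with at least their
  share of the edges are kept, n being the largest admissible size. Scaling the bound back by card A
  / n yields the term with the characteristic in the denominator.\<close>

lemma edges_rel_ordered:
  assumes fin: "finite \<Delta>" "finite A" "finite B" and sub: "A \<subseteq> normed_pairs \<Delta>" "B \<subseteq> normed_pairs \<Delta>"
    and AB: "card A \<le> card B" and D: "card \<Delta> \<le> CHAR('f)" and p: "15 \<le> CHAR('f)"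
  shows "real (edges rel A B) \<le> 2 * real (card B) * (30 * sqrt (real (card A)) + real (card \<Delta>))
    + 1400 * real (card A) * real (card B) / real (CHAR('f))"
proof (cases "108 * card A < CHAR('f)\<^sup>2")
  case True
  have "0 \<le> 1400 * real (card A) * real (card B) / real (CHAR('f))"
    by simp
  then show ?thesis
    using edges_rel_small[OF fin sub AB True] by linarith
next
  case False
  define P where "P = real CHAR('f)"
  have P: "P \<ge> 15"
    using p by (simp add: P_def)
  define n where "n = (CHAR('f)\<^sup>2 - 1) div 108"
  have n108: "108 * n \<le> CHAR('f)\<^sup>2 - 1"
    by (simp add: n_def)
  have p225: "225 \<le> CHAR('f)\<^sup>2"
    using power_mono[OF p, of 2] by simp
  have n1: "108 * n < CHAR('f)\<^sup>2"
    using n108 p225 by linarith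
  have "CHAR('f)\<^sup>2 - 1 < 108 * (n + 1)"
    unfolding n_def using div_less_iff_less_mult[of 108 "CHAR('f)\<^sup>2 - 1" "(CHAR('f)\<^sup>2 - 1) div 108 + 1"]
    by (simp add: mult.commute)
  moreover from this have "n \<ge> 1"
    using p225 by (cases n) auto
  ultimately have "CHAR('f)\<^sup>2 \<le> 216 * n"
    by simp
  then have "real (CHAR('f)\<^sup>2) \<le> real (216 * n)"
    by (simp only: of_nat_le_iff)
  then have nP: "P\<^sup>2 \<le> 216 * real n"
    by (simp add: P_def)
  have n0: "real n > 0"
    using nP P by (metis linorder_not_less mult_zero_right of_nat_0_le_iff order_antisym_conv
        not_numeral_le_zero order_trans power2_less_eq_zero_iff)
  have "n \<le> card A"
    using False n1 by linarith
  then obtain A0 where A0: "A0 \<subseteq> A" "card A0 = n"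
      "n * (\<Sum>a\<in>A. card {b \<in> B. rel a b}) \<le> card A * (\<Sum>a\<in>A0. card {b \<in> B. rel a b})"
    using subset_with_large_sum[OF fin(2), of n "\<lambda>a. card {b \<in> B. rel a b}"] by auto
  have fin0: "finite A0"
    using A0 fin finite_subset by blast
  have small: "real (edges rel A0 B) \<le> 2 * real (card B) * (30 * sqrt (real n) + real (card \<Delta>))"
    using edges_rel_small[OF fin(1) fin0 fin(3) _ sub(2)] A0 sub AB n1 \<open>n \<le> card A\<close> by auto
  have "real (n * edges rel A B) \<le> real (card A * edges rel A0 B)"
    unfolding of_nat_le_iff using A0(3) by (simp only: edges_def)
  then have "real n * real (edges rel A B) \<le> real (card A) * real (edges rel A0 B)"
    by simp
  also have "\<dots> \<le> real (card A) * (2 * real (card B) * (30 * sqrt (real n) + real (card \<Delta>)))"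
    by (rule mult_left_mono[OF small]) simp
  \<comment> \<open>P^2 \<le> 216 n and 216 \<le> 15^2 give sqrt n \<le> 15 n / P, and card \<Delta>
    \<le> P \<le> 216 n / P; then 30 * 15 + 216 = 666.\<close>
  also have "\<dots> \<le> real (card A) * (2 * real (card B) * (real n * (666 / P)))"
  proof -
    have "(P / 15)\<^sup>2 \<le> real n"
      using nP by (simp add: power_divide)
    then have "P / 15 \<le> sqrt (real n)"
      by (rule real_le_rsqrt)
    then have "sqrt (real n) * (P / 15) \<le> sqrt (real n) * sqrt (real n)"
      by (rule mult_left_mono) simp
    then have "sqrt (real n) * P \<le> 15 * real n"
      by simp
    then have 1: "30 * sqrt (real n) \<le> real n * (450 / P)"
      using P by (simp add: field_simps)
    have "real (card \<Delta>) * P \<le> P * P"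
      using D P by (intro mult_right_mono) (auto simp: P_def)
    also have "\<dots> \<le> 216 * real n"
      using nP by (simp add: power2_eq_square)
    finally have 2: "real (card \<Delta>) \<le> real n * (216 / P)"
      using P by (simp add: field_simps)
    have "30 * sqrt (real n) + real (card \<Delta>) \<le> real n * (666 / P)"
      using add_mono[OF 1 2] by (simp add: field_simps)
    then show ?thesis
      by (intro mult_left_mono) auto
  qed
  also have "\<dots> = real n * (1332 * real (card A) * real (card B) / P)"
    by simp
  finally have "real (edges rel A B) \<le> 1332 * real (card A) * real (card B) / P"
    using n0 by (simp only: mult_le_cancel_left_pos)
  also have "\<dots> \<le> 1400 * real (card A) * real (card B) / P"
    using P by (intro divide_right_mono mult_right_mono) auto
  also have "\<dots> \<le> 2 * real (card B) * (30 * sqrt (real (card A)) + real (card \<Delta>)) + \<dots>"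
    by simp
  finally show ?thesis
    by (simp add: P_def)
qed

lemma edges_rel_bound:
  assumes fin: "finite \<Delta>" "finite A" "finite B" and sub: "A \<subseteq> normed_pairs \<Delta>" "B \<subseteq> normed_pairs \<Delta>"
    and D: "card \<Delta> \<le> CHAR('f)" and p: "15 \<le> CHAR('f)"
  shows "real (edges rel A B) \<le> 60 * (real (card B) * sqrt (real (card A)) + real (card A) * sqrt (real (card B)))
    + 2 * real (card \<Delta>) * (real (card A) + real (card B)) + 1400 * (real (card A) * real (card B)) / real (CHAR('f))"
proof -
  define a where "a = real (card A)"
  define b where "b = real (card B)"
  define d where "d = real (card \<Delta>)"
  define c where "c = real CHAR('f)"
  have nn: "0 \<le> d * a" "0 \<le> d * b" "0 \<le> b * sqrt a" "0 \<le> a * sqrt b"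
    by (simp_all add: a_def b_def d_def)
  have goal: "e \<le> 60 * (b * sqrt a + a * sqrt b) + 2 * d * (a + b) + 1400 * (a * b) / c"
    if "e \<le> 2 * b * (30 * sqrt a + d) + 1400 * a * b / c \<or> e \<le> 2 * a * (30 * sqrt b + d) + 1400 * b * a / c" for e
  proof -
    define r where "r = 1400 * (a * b) / c"
    have r: "1400 * a * b / c = r" "1400 * b * a / c = r"
      by (simp_all add: r_def mult.assoc mult.commute)
    show ?thesis
      using that nn unfolding r r_def[symmetric] by (auto simp: algebra_simps)
  qed
  show ?thesis
  proof (cases "card A \<le> card B")
    case True
    show ?thesis
      using goal edges_rel_ordered[OF fin sub True D p] by (simp add: a_def b_def c_def d_def)
  next
    case False
    then have BA: "card B \<le> card A"
      by simp
    have "(\<lambda>b a. rel a b) = rel"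
      by (intro ext) (rule rel_commute)
    then have "edges rel A B = edges rel B A"
      using edges_swap[OF fin(2,3), of rel] by simp
    then show ?thesis
      using goal edges_rel_ordered[OF fin(1,3,2) sub(2,1) BA D p] by (simp add: a_def b_def c_def d_def)
  qed
qed

end

lemma double_sum_expand:
  fixes a r :: "nat \<Rightarrow> real"
  shows "(\<Sum>i\<in>I. \<Sum>j\<in>I. 60 * (a j * r i + a i * r j) + 2 * D * (a i + a j) + 1400 * (a i * a j) / p)
    = 120 * (sum a I * sum r I) + 4 * D * real (card I) * sum a I + 1400 * (sum a I)\<^sup>2 / p"
proof -
  have 1: "(\<Sum>i\<in>I. \<Sum>j\<in>I. a j * r i) = sum a I * sum r I"
    by (subst sum.swap) (simp only: sum_product)
  have 2: "(\<Sum>i\<in>I. \<Sum>j\<in>I. a i * r j) = sum a I * sum r I"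
    by (simp only: sum_product)
  have 3: "(\<Sum>i\<in>I. \<Sum>j\<in>I. a i * a j) = (sum a I)\<^sup>2"
    by (simp only: sum_product power2_eq_square)
  have 4: "(\<Sum>i\<in>I. \<Sum>j\<in>I. a i) = real (card I) * sum a I"
    by (simp add: sum_distrib_left)
  have 5: "(\<Sum>i\<in>I. \<Sum>j\<in>I. a j) = real (card I) * sum a I"
    by simp
  have "(\<Sum>i\<in>I. \<Sum>j\<in>I. 60 * (a j * r i + a i * r j) + 2 * D * (a i + a j) + 1400 * (a i * a j) / p)
    = 60 * ((\<Sum>i\<in>I. \<Sum>j\<in>I. a j * r i) + (\<Sum>i\<in>I. \<Sum>j\<in>I. a i * r j))
      + 2 * D * ((\<Sum>i\<in>I. \<Sum>j\<in>I. a i) + (\<Sum>i\<in>I. \<Sum>j\<in>I. a j)) + 1400 / p * (\<Sum>i\<in>I. \<Sum>j\<in>I. a i * a j)"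
    unfolding sum_distrib_left sum.distrib[symmetric] by (intro sum.cong refl) simp
  then show ?thesis
    unfolding 1 2 3 4 5 by (simp add: algebra_simps)
qed

section \<open>Lower bounds for the number of values\<close>

context bilin
begin

text \<open>With N points, V values and E equalities between nonzero values, Cauchy-Schwarz gives
  N^4 \<le> 4 V E, while the layers give E of order N^3 sqrt k + N^4 / p. As N = (D sqrt k) sqrt k,
  the first term equals N^4 / (D sqrt k).\<close>

lemma vals_uniform_bound:
  assumes fin: "finite U" and nz: "(0, 0) \<notin> U"
    and fib: "\<And>d. d \<in> dir2 ` U \<Longrightarrow> card {s \<in> U. dir2 s = d} = k"
    and D2: "2 \<le> card (dir2 ` U)" and Dp: "card (dir2 ` U) \<le> CHAR('f)" and p: "15 \<le> CHAR('f)"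
  shows "min (real (card (dir2 ` U)) * sqrt (real k)) (real CHAR('f)) \<le> 6576 * real (card (vals U))"
proof -
  define \<Delta> where "\<Delta> = dir2 ` U"
  define D where "D = card \<Delta>"
  define N where "N = card U"
  have N_eq: "N = D * k"
    using sum_over_fibres[OF fin, of "\<lambda>_. 1" dir2] fib by (simp add: N_def D_def \<Delta>_def)
  have "U \<noteq> {}"
    using D2 by auto
  then have N0: "N > 0"
    using fin by (simp add: N_def card_gt_0_iff)
  then have k0: "k > 0"
    by (simp add: N_eq)
  have unz: "s \<noteq> (0, 0)" if "s \<in> U" for s
    using that nz by auto
  \<comment> \<open>Division by the length of the first entry normalises a pair. It preserves
    \<open>rel\<close>, because both form values are divided by the same nonzero factor.\<close>
  define rep where "rep x = (dir2 (fst x), scale2 (inverse (size2 (fst x))) (snd x))" for x :: "'f vec2 \<times> 'f vec2"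
  define Q where "Q = U \<times> U"
  have finQ: "finite Q"
    using fin by (simp add: Q_def)
  have cardQ: "card Q = N\<^sup>2"
    by (simp add: Q_def card_cartesian_product N_def power2_eq_square)
  have rel_rep: "rel (rep x) (rep y) = rel x y" if "x \<in> Q" "y \<in> Q" for x y
  proof -
    have "size2 (fst x) \<noteq> 0" "size2 (fst y) \<noteq> 0"
      using that nz by (auto simp: Q_def intro!: size2_nonzero)
    then show ?thesis
      by (auto simp: rel_def rep_def dir2_def)
  qed
  \<comment> \<open>Given its representative, a pair is determined by its first entry, one of the
    \<open>k\<close> points in a fixed direction.\<close>
  have fibre: "card {x \<in> Q. rep x = q} \<le> k" for q
  proof (cases "{x \<in> Q. rep x = q} = {}")
    case True
    then show ?thesis
      by (simp only: card.empty)
  next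
    case False
    then obtain x0 where "x0 \<in> Q" "rep x0 = q"
      by blast
    then have "fst q \<in> dir2 ` U"
      by (auto simp: rep_def Q_def)
    then have "card {s \<in> U. dir2 s = fst q} = k"
      by (rule fib)
    moreover have "inj_on fst {x \<in> Q. rep x = q}"
    proof (rule inj_onI)
      fix x y
      assume x: "x \<in> {x \<in> Q. rep x = q}" and y: "y \<in> {x \<in> Q. rep x = q}" and xy: "fst x = fst y"
      define c where "c = inverse (size2 (fst x))"
      have "fst x \<noteq> (0, 0)"
        using x nz by (auto simp: Q_def)
      then have c: "c \<noteq> 0"
        by (simp add: c_def size2_nonzero)
      have "rep x = rep y"
        using x y by simp
      then have "scale2 c (snd x) = scale2 c (snd y)"
        by (simp add: rep_def c_def xy)
      then have "snd x = snd y"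
        using c by (simp add: scale2_def prod_eq_iff)
      then show "x = y"
        using xy by (simp add: prod_eq_iff)
    qed
    moreover have "fst ` {x \<in> Q. rep x = q} \<subseteq> {s \<in> U. dir2 s = fst q}"
      by (auto simp: rep_def Q_def)
    ultimately show ?thesis
      using fin card_inj_on_le[of fst "{x \<in> Q. rep x = q}" "{s \<in> U. dir2 s = fst q}"] by auto
  qed
  define L where "L i = {q \<in> rep ` Q. i \<le> card {x \<in> Q. rep x = q}}" for i
  have layers: "edges rel Q Q = (\<Sum>i=1..k. \<Sum>j=1..k. edges rel (L i) (L j))"
    and layers_sum: "(\<Sum>i=1..k. card (L i)) = N\<^sup>2" and layers_le: "\<And>i. i * card (L i) \<le> N\<^sup>2"
    using edges_layers[OF finQ, where f = rep and R = rel and R' = rel and k = k, OF rel_rep fibre]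
    unfolding L_def[symmetric] cardQ by auto
  have L_sub: "L i \<subseteq> normed_pairs \<Delta>" for i
  proof
    fix q
    assume "q \<in> L i"
    then obtain s t where st: "s \<in> U" "t \<in> U" "q = rep (s, t)"
      by (auto simp: L_def Q_def)
    have s: "s \<noteq> (0, 0)" and t: "t \<noteq> (0, 0)"
      using st nz by auto
    have c: "inverse (size2 s) \<noteq> 0"
      using s by (simp add: size2_nonzero)
    show "q \<in> normed_pairs \<Delta>"
      unfolding st(3) rep_def normed_pairs_def \<Delta>_def
      using st s t c by (auto simp: size2_dir2 scale2_eq_0_iff dir2_scale2)
  qed
  have L_fin: "finite (L i)" for i
    using finQ by (simp add: L_def)
  define a where "a i = real (card (L i))" for i
  define P where "P = real CHAR('f)"
  have P: "P \<ge> 15"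
    using p by (simp add: P_def)
  have sum_a: "sum a {1..k} = (real N)\<^sup>2"
    using arg_cong[OF layers_sum, of real] by (simp add: a_def)
  \<comment> \<open>Markov's bound on the size of a layer. Summed over i it contributes only sqrt k,
    where the trivial bound by N would contribute k.\<close>
  have sqrt_a: "sqrt (a i) \<le> real N * (1 / sqrt (real i))" if "i \<in> {1..k}" for i
  proof -
    have "real (i * card (L i)) \<le> real (N\<^sup>2)"
      using layers_le[of i] by (simp only: of_nat_le_iff)
    then have "real i * a i \<le> (real N)\<^sup>2"
      by (simp add: a_def)
    then have "sqrt (real i * a i) \<le> sqrt ((real N)\<^sup>2)"
      by (rule real_sqrt_le_mono)
    then have "sqrt (real i) * sqrt (a i) \<le> real N"
      by (simp add: real_sqrt_mult)
    then show ?thesis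
      using that by (simp add: field_simps)
  qed
  have sum_r: "(\<Sum>i=1..k. sqrt (a i)) \<le> real N * (2 * sqrt (real k))"
  proof -
    have "(\<Sum>i=1..k. sqrt (a i)) \<le> (\<Sum>i=1..k. real N * (1 / sqrt (real i)))"
      by (rule sum_mono) (rule sqrt_a)
    also have "\<dots> = real N * (\<Sum>i=1..k. 1 / sqrt (real i))"
      by (simp only: sum_distrib_left)
    also have "\<dots> \<le> real N * (2 * sqrt (real k))"
      by (rule mult_left_mono[OF sum_inverse_sqrt_le]) simp
    finally show ?thesis .
  qed
  have "real (edges rel Q Q) = (\<Sum>i=1..k. \<Sum>j=1..k. real (edges rel (L i) (L j)))"
    by (simp add: layers)
  also have "\<dots> \<le> (\<Sum>i=1..k. \<Sum>j=1..k. 60 * (a j * sqrt (a i) + a i * sqrt (a j)) + 2 * real D * (a i + a j)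
      + 1400 * (a i * a j) / P)"
    unfolding a_def P_def D_def
    using edges_rel_bound[of \<Delta>, OF _ L_fin L_fin L_sub L_sub] Dp p fin
    by (intro sum_mono) (simp add: \<Delta>_def)
  also have "\<dots> = 120 * (sum a {1..k} * (\<Sum>i=1..k. sqrt (a i))) + 4 * real D * real (card {1..k}) * sum a {1..k}
      + 1400 * (sum a {1..k})\<^sup>2 / P"
    by (rule double_sum_expand)
  also have "\<dots> \<le> 120 * ((real N)\<^sup>2 * (real N * (2 * sqrt (real k)))) + 4 * real D * real k * (real N)\<^sup>2
      + 1400 * ((real N)\<^sup>2)\<^sup>2 / P"
    unfolding sum_a using sum_r by (intro add_mono mult_left_mono) auto
  \<comment> \<open>D k = N turns the middle term into 4 N^3, which is absorbed because k is at
    least 1: 240 + 4 = 244.\<close>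
  also have "\<dots> \<le> 244 * (real N ^ 3 * sqrt (real k)) + 1400 * real N ^ 4 / P"
  proof -
    have "4 * real D * real k * (real N)\<^sup>2 = 4 * real N ^ 3"
      by (simp add: N_eq power2_eq_square power3_eq_cube)
    also have "\<dots> \<le> 4 * (real N ^ 3 * sqrt (real k))"
      using k0 mult_left_mono[of 1 "sqrt (real k)" "real N ^ 3"] by simp
    finally show ?thesis
      by (simp add: power2_eq_square power3_eq_cube power4_eq_xxxx algebra_simps)
  qed
  finally have upper: "real (edges rel Q Q) \<le> 244 * (real N ^ 3 * sqrt (real k)) + 1400 * real N ^ 4 / P" .
  define V where "V = card (vals U)"
  define Z where "Z = {z \<in> U \<times> U. om (fst z) (snd z) \<noteq> 0}"
  have finZ: "finite Z"
    using fin by (simp add: Z_def)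
  have "card (\<Union>s\<in>U. {s} \<times> {t \<in> U. om s t \<noteq> 0}) = (\<Sum>s\<in>U. card ({s} \<times> {t \<in> U. om s t \<noteq> 0}))"
    using fin by (intro card_UN_disjoint) auto
  also have "(\<Union>s\<in>U. {s} \<times> {t \<in> U. om s t \<noteq> 0}) = Z"
    by (auto simp: Z_def)
  finally have "card Z = (\<Sum>s\<in>U. card {t \<in> U. om s t \<noteq> 0})"
    by (simp add: card_cartesian_product)
  \<comment> \<open>The points orthogonal to \<open>s\<close> share one direction, so they are at
    most \<open>k\<close>; with at least two directions this is at most half of U. Hence discarding
    the value 0 costs only a constant factor.\<close>
  moreover have "N \<le> 2 * card {t \<in> U. om s t \<noteq> 0}" if s: "s \<in> U" for s
  proof -
    have "card {t \<in> U. om s t = 0} \<le> k"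
    proof (cases "{t \<in> U. om s t = 0} = {}")
      case True
      then show ?thesis
        by (simp only: card.empty)
    next
      case False
      then obtain t0 where t0: "t0 \<in> U" "om s t0 = 0"
        by blast
      have "{t \<in> U. om s t = 0} \<subseteq> {t \<in> U. dir2 t = dir2 t0}"
      proof
        fix t
        assume "t \<in> {t \<in> U. om s t = 0}"
        then have t: "t \<in> U" "om s t = 0"
          by auto
        have "dir2 t = dir2 t0"
          by (rule parallel_imp_dir2_eq[OF om_zero_parallel'[OF t(2) t0(2) unz[OF s]] unz[OF t(1)] unz[OF t0(1)]])
        then show "t \<in> {t \<in> U. dir2 t = dir2 t0}"
          using t by simp
      qed
      then have "card {t \<in> U. om s t = 0} \<le> card {t \<in> U. dir2 t = dir2 t0}"
        using fin by (intro card_mono) auto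
      also have "\<dots> = k"
        using t0 by (intro fib) auto
      finally show ?thesis .
    qed
    moreover have "2 * k \<le> N"
      unfolding N_eq using D2 by (intro mult_le_mono1) (simp add: D_def \<Delta>_def)
    moreover have "N = card {t \<in> U. om s t = 0} + card {t \<in> U. om s t \<noteq> 0}"
    proof -
      have "U = {t \<in> U. om s t = 0} \<union> {t \<in> U. om s t \<noteq> 0}"
        by auto
      then show ?thesis
        unfolding N_def using fin by (subst card_Un_disjoint[symmetric]) auto
    qed
    ultimately show ?thesis
      by linarith
  qed
  ultimately have "(\<Sum>s\<in>U. N) \<le> 2 * card Z"
    by (simp only: sum_distrib_left) (intro sum_mono, blast)
  then have Z2: "N\<^sup>2 \<le> 2 * card Z"
    by (simp add: N_def power2_eq_square)
  have "(card Z)\<^sup>2 \<le> V * card {(x, y). x \<in> Z \<and> y \<in> Z \<and> om (fst x) (snd x) = om (fst y) (snd y)}"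
    unfolding V_def using finZ fin
    by (intro card_square_le_collisions finite_vals) (auto simp: Z_def intro: om_in_vals)
  also have "card {(x, y). x \<in> Z \<and> y \<in> Z \<and> om (fst x) (snd x) = om (fst y) (snd y)} \<le> edges rel Q Q"
  proof -
    \<comment> \<open>Regrouping: an equality om s s' = om t t' is a collision of (s, s') with (t,
      t') and also an incidence of (s, t) with (s', t').\<close>
    let ?f = "\<lambda>(x, y). ((fst x, fst y), (snd x, snd y)) :: ('f vec2 \<times> 'f vec2) \<times> ('f vec2 \<times> 'f vec2)"
    let ?S = "{(x, y). x \<in> Z \<and> y \<in> Z \<and> om (fst x) (snd x) = om (fst y) (snd y)}"
    have "card ?S = card (?f ` ?S)"
      by (rule card_image[symmetric]) (simp add: inj_on_def prod_eq_iff split: prod.splits)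
    also have "\<dots> \<le> card (\<Union>x\<in>Q. {x} \<times> {y \<in> Q. rel x y})"
    proof (rule card_mono)
      show "finite (\<Union>x\<in>Q. {x} \<times> {y \<in> Q. rel x y})"
        using finQ by auto
      show "?f ` ?S \<subseteq> (\<Union>x\<in>Q. {x} \<times> {y \<in> Q. rel x y})"
      proof
        fix w
        assume "w \<in> ?f ` ?S"
        then obtain v where v: "v \<in> ?S" "w = ?f v"
          by blast
        obtain x y where xy: "v = (x, y)"
          by (cases v)
        have "x \<in> Z" "y \<in> Z" "om (fst x) (snd x) = om (fst y) (snd y)"
          using v(1) unfolding xy mem_Collect_eq prod.case by blast+
        then have "(fst x, fst y) \<in> Q" "(snd x, snd y) \<in> Q" "rel (fst x, fst y) (snd x, snd y)"
          unfolding Z_def Q_def rel_def mem_Collect_eq mem_Times_iff fst_conv snd_conv by blast+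
        then show "w \<in> (\<Union>x\<in>Q. {x} \<times> {y \<in> Q. rel x y})"
          unfolding v(2) xy prod.case by blast
      qed
    qed
    also have "\<dots> = (\<Sum>x\<in>Q. card ({x} \<times> {y \<in> Q. rel x y}))"
      using finQ by (intro card_UN_disjoint) auto
    finally show ?thesis
      by (simp add: edges_def card_cartesian_product)
  qed
  finally have "(card Z)\<^sup>2 \<le> V * edges rel Q Q"
    by simp
  moreover have "(N\<^sup>2)\<^sup>2 \<le> (2 * card Z)\<^sup>2"
    using Z2 by (intro power_mono) auto
  ultimately have "N ^ 4 \<le> 4 * (V * edges rel Q Q)"
    by (simp add: power_mult_distrib flip: power_mult)
  then have "real (N ^ 4) \<le> real (4 * (V * edges rel Q Q))"
    by (simp only: of_nat_le_iff)
  then have "real N ^ 4 \<le> 4 * real V * real (edges rel Q Q)"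
    by simp
  also have "\<dots> \<le> 4 * real V * (244 * (real N ^ 3 * sqrt (real k)) + 1400 * real N ^ 4 / P)"
    by (rule mult_left_mono[OF upper]) simp
  finally have main: "real N ^ 4 \<le> 4 * real V * (244 * (real N ^ 3 * sqrt (real k)) + 1400 * real N ^ 4 / P)" .
  define Y where "Y = real D * sqrt (real k)"
  have sk: "sqrt (real k) > 0" "sqrt (real k) * sqrt (real k) = real k"
    using k0 by auto
  have D0: "real D > 0"
    using D2 by (simp add: D_def \<Delta>_def)
  then have Y0: "Y > 0"
    using sk by (simp add: Y_def)
  define M where "M = min Y P"
  have M0: "M > 0"
    using Y0 P by (simp add: M_def)
  have NY: "real N = Y * sqrt (real k)"
    by (simp add: Y_def N_eq sk(2) mult.assoc)
  have "real N ^ 3 * sqrt (real k) * M \<le> real N ^ 3 * sqrt (real k) * Y"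
    using sk by (intro mult_left_mono) (auto simp: M_def)
  also have "\<dots> = real N ^ 4"
    using NY by (simp add: power4_eq_xxxx power3_eq_cube)
  finally have t1: "real N ^ 3 * sqrt (real k) \<le> real N ^ 4 / M"
    using M0 by (simp add: field_simps)
  have "1 / P \<le> 1 / M"
    using M0 P by (intro divide_left_mono) (auto simp: M_def)
  then have "real N ^ 4 * (1 / P) \<le> real N ^ 4 * (1 / M)"
    by (rule mult_left_mono) simp
  then have t2: "real N ^ 4 / P \<le> real N ^ 4 / M"
    by simp
  \<comment> \<open>Both terms are at most multiples of N^4 / M; 244 + 1400 = 1644, and 4 * 1644 is
    the constant 6576.\<close>
  have "244 * (real N ^ 3 * sqrt (real k)) + 1400 * real N ^ 4 / P \<le> 1644 * (real N ^ 4 / M)"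
    using t1 t2 by simp
  then have "4 * real V * (244 * (real N ^ 3 * sqrt (real k)) + 1400 * real N ^ 4 / P)
      \<le> 4 * real V * (1644 * (real N ^ 4 / M))"
    by (rule mult_left_mono) simp
  moreover have "4 * real V * (1644 * (real N ^ 4 / M)) = real N ^ 4 * (6576 * real V / M)"
    by simp
  ultimately have "real N ^ 4 * 1 \<le> real N ^ 4 * (6576 * real V / M)"
    using main by linarith
  then have "1 \<le> 6576 * real V / M"
    using N0 by (subst (asm) mult_le_cancel_left_pos) auto
  then have "M \<le> 6576 * real V"
    using M0 by (simp add: field_simps)
  then show ?thesis
    by (simp add: M_def Y_def P_def V_def D_def \<Delta>_def)
qed

text \<open>A pigeonhole over the number j of points per direction reduces to a uniform subset. More
  than p directions are settled by one point in each, 2 to p directions by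
  \<open>vals_uniform_bound\<close>, and a single direction by its having at most V points.\<close>

lemma vals_lower_bound:
  assumes fin: "finite S"
    and noline: "\<And>a d. d \<noteq> (0, 0) \<Longrightarrow> \<not> S \<subseteq> range (\<lambda>t. (fst a + t * fst d, snd a + t * snd d))"
    and char: "CHAR('f) > 0"
  shows "min (real (card S) powr (2/3)) (real CHAR('f)) \<le> 30000 * real (card (vals S))"
proof (rule ccontr)
  assume neg: "\<not> ?thesis"
  define V where "V = card (vals S)"
  define N where "N = card S"
  define T where "T = real N powr (2/3)"
  have V_less: "30000 * real V < T" "30000 * real V < real CHAR('f)"
    using neg by (auto simp: V_def N_def T_def)
  have noline0: "\<exists>s\<in>S. om s d \<noteq> 0" if d: "d \<noteq> (0, 0)" for d
  proof (rule ccontr)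
    assume "\<not> ?thesis"
    then have z: "om s d = 0" if "s \<in> S" for s
      using that by blast
    have "\<not> S \<subseteq> {(0, 0)}"
      using noline[of "(1, 0)" "(0, 0)"] by auto
    then obtain s0 where s0: "s0 \<in> S" "s0 \<noteq> (0, 0)"
      by blast
    have "S \<subseteq> range (\<lambda>t. (fst (0, 0) + t * fst s0, snd (0, 0) + t * snd s0))"
    proof
      fix s
      assume "s \<in> S"
      then obtain k where "s = scale2 k s0"
        using om_zero_parallel[OF z[of s] z[OF s0(1)] d] parallel_imp_scale2[OF _ s0(2)] by blast
      then show "s \<in> range (\<lambda>t. (fst (0, 0) + t * fst s0, snd (0, 0) + t * snd s0))"
        by (auto simp: scale2_def)
    qed
    then show False
      using noline[OF s0(2)] by blast
  qed
  define S0 where "S0 = S - {(0, 0)}"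
  have fin0: "finite S0"
    using fin by (simp add: S0_def)
  have nz: "(0, 0) \<notin> S0"
    by (simp add: S0_def)
  have "S \<noteq> {}"
    using noline[of "(1, 0)"] by auto
  then have "vals S \<noteq> {}"
    by (auto simp: vals_def)
  then have V1: "V \<ge> 1"
    using finite_vals[OF fin] by (simp add: V_def Suc_le_eq card_gt_0_iff)
  have p15: "15 \<le> CHAR('f)"
    using V_less(2) V1 by linarith
  have N2: "N \<ge> 2"
  proof (rule ccontr)
    assume "\<not> ?thesis"
    then have "\<forall>x\<in>S. \<forall>y\<in>S. x = y"
      using card_le_Suc0_iff_eq[OF fin] by (simp add: N_def)
    moreover obtain s0 where "s0 \<in> S"
      using \<open>S \<noteq> {}\<close> by blast
    ultimately have "S \<subseteq> {s0}"
      by blast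
    moreover have "s0 \<in> range (\<lambda>t. (fst s0 + t * fst (1, 0), snd s0 + t * snd (1, 0)))"
      by (rule range_eqI[of _ _ 0]) simp
    ultimately have "S \<subseteq> range (\<lambda>t. (fst s0 + t * fst (1, 0), snd s0 + t * snd (1, 0)))"
      by blast
    then show False
      using noline[of "(1, 0)" s0] by simp
  qed
  have "N \<le> card S0 + 1"
    unfolding N_def S0_def by (metis add.commute card_Diff1_le card_Diff_singleton_if diff_le_self le_diff_conv order_refl plus_1_eq_Suc)
  then have NS0: "real N \<le> 2 * real (card S0)"
    using N2 by linarith
  define c where "c d = card {s \<in> S0. dir2 s = d}" for d
  \<comment> \<open>As S is in no line, some \<open>om s\<close> is nonzero on the direction
    \<open>d\<close>; it is then injective there, so each point of this direction produces its own
    value.\<close>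
  have c_le: "c d \<le> V" for d
  proof (cases "{s \<in> S0. dir2 s = d} = {}")
    case True
    then show ?thesis
      unfolding c_def by (simp only: card.empty)
  next
    case False
    then obtain s1 where s1: "s1 \<in> S0" "dir2 s1 = d"
      by blast
    have d0: "d \<noteq> (0, 0)"
      using dir2_nonzero[of s1] s1 nz by blast
    then obtain s where s: "s \<in> S" "om s d \<noteq> 0"
      using noline0 by blast
    have sc: "t = scale2 (size2 t) d" if "t \<in> {s \<in> S0. dir2 s = d}" for t
    proof -
      have t: "t \<in> S0" "dir2 t = d"
        using that by auto
      then have "t \<noteq> (0, 0)"
        using nz by blast
      then show ?thesis
        using scale2_size2_dir2[of t] t(2) by simp
    qed
    have "inj_on (om s) {s \<in> S0. dir2 s = d}"
    proof (rule inj_onI)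
      fix t t'
      assume t: "t \<in> {s \<in> S0. dir2 s = d}" "t' \<in> {s \<in> S0. dir2 s = d}" "om s t = om s t'"
      have "om s t = size2 t * om s d"
        by (subst sc[OF t(1)]) simp
      moreover have "om s t' = size2 t' * om s d"
        by (subst sc[OF t(2)]) simp
      ultimately have "size2 t = size2 t'"
        using t(3) s(2) by auto
      then show "t = t'"
        using sc[OF t(1)] sc[OF t(2)] by (simp only:)
    qed
    moreover have "om s ` {s \<in> S0. dir2 s = d} \<subseteq> vals S"
      using s(1) om_in_vals unfolding S0_def by blast
    ultimately show ?thesis
      unfolding c_def V_def using finite_vals[OF fin] card_inj_on_le by blast
  qed
  define \<Delta> where "\<Delta> j = {d \<in> dir2 ` S0. j \<le> c d}" for j
  have fin\<Delta>: "finite (\<Delta> j)" for j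
    using fin0 by (simp add: \<Delta>_def)
  have sum\<Delta>: "(\<Sum>j=1..V. card (\<Delta> j)) = card S0"
    using edges_layers(2)[OF fin0, where f = dir2 and R = "\<lambda>x y. True" and R' = "\<lambda>x y. True" and k = V] c_le
    unfolding c_def \<Delta>_def by blast
  have T0: "T \<ge> 0"
    by (simp add: T_def)
  \<comment> \<open>Otherwise summing the layers over j gives N \<le> T sqrt V, while V < T and T
    sqrt T = N. This balance is where the exponent 2/3 comes from; the 4 combines the loss of the
    origin with the factor of \<open>sum_inverse_sqrt_le\<close>.\<close>
  have "\<exists>j\<in>{1..V}. T / 4 \<le> real (card (\<Delta> j)) * sqrt (real j)"
  proof (rule ccontr)
    assume "\<not> ?thesis"
    then have less: "real (card (\<Delta> j)) \<le> T / 4 * (1 / sqrt (real j))" if "j \<in> {1..V}" for j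
    proof -
      assume *: "\<not> (\<exists>j\<in>{1..V}. T / 4 \<le> real (card (\<Delta> j)) * sqrt (real j))"
      then have "real (card (\<Delta> j)) * sqrt (real j) \<le> T / 4"
        using that by (meson linorder_linear)
      then show ?thesis
        using that by (simp add: pos_le_divide_eq)
    qed
    have "real (card S0) = (\<Sum>j=1..V. real (card (\<Delta> j)))"
      using sum\<Delta> by (metis of_nat_sum)
    also have "\<dots> \<le> (\<Sum>j=1..V. T / 4 * (1 / sqrt (real j)))"
      by (rule sum_mono) (rule less)
    also have "\<dots> = T / 4 * (\<Sum>j=1..V. 1 / sqrt (real j))"
      by (simp only: sum_distrib_left)
    also have "\<dots> \<le> T / 4 * (2 * sqrt (real V))"
      using T0 by (intro mult_left_mono sum_inverse_sqrt_le) auto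
    finally have 1: "real N \<le> T * sqrt (real V)"
      using NS0 by linarith
    have "sqrt (real V) < sqrt T"
      using V_less(1) by (intro real_sqrt_less_mono) linarith
    moreover have Tpos: "T > 0"
      using N2 by (simp add: T_def)
    ultimately have "T * sqrt (real V) < T * sqrt T"
      by simp
    also have "T * sqrt T = real N"
    proof -
      have "T * sqrt T = T powr 1 * T powr (1/2)"
        using Tpos by (simp add: powr_half_sqrt)
      also have "\<dots> = T powr (3/2)"
        unfolding powr_add[symmetric] by simp
      also have "\<dots> = real N"
        using N2 by (simp add: T_def powr_powr)
      finally show ?thesis .
    qed
    finally show False
      using 1 by simp
  qed
  then obtain j where j: "1 \<le> j" "j \<le> V" "T / 4 \<le> real (card (\<Delta> j)) * sqrt (real j)"
    by auto
  define D where "D = card (\<Delta> j)"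
  \<comment> \<open>Applied with i = 1 when there are more than p directions, and with i = j when
    there are between 2 and p.\<close>
  have pick: "\<exists>U. U \<subseteq> S0 \<and> dir2 ` U = \<Delta> j \<and> (\<forall>d\<in>\<Delta> j. card {s \<in> U. dir2 s = d} = i)" if i: "1 \<le> i" "i \<le> j" for i
  proof -
    have "\<exists>W. W \<subseteq> {s \<in> S0. dir2 s = d} \<and> card W = i" if "d \<in> \<Delta> j" for d
    proof -
      have "i \<le> card {s \<in> S0. dir2 s = d}"
        using that i by (auto simp: \<Delta>_def c_def)
      then show ?thesis
        by (meson obtain_subset_with_card_n)
    qed
    then obtain W where W: "\<And>d. d \<in> \<Delta> j \<Longrightarrow> W d \<subseteq> {s \<in> S0. dir2 s = d} \<and> card (W d) = i"
      by metis
    have fibre: "{s \<in> (\<Union>d\<in>\<Delta> j. W d). dir2 s = d} = W d" if d: "d \<in> \<Delta> j" for d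
    proof (intro equalityI subsetI)
      fix s
      assume "s \<in> {s \<in> (\<Union>d\<in>\<Delta> j. W d). dir2 s = d}"
      then obtain d' where d': "d' \<in> \<Delta> j" "s \<in> W d'" "dir2 s = d"
        by blast
      then have "d' = d"
        using W[OF d'(1)] by blast
      then show "s \<in> W d"
        using d' by simp
    next
      fix s
      assume "s \<in> W d"
      then show "s \<in> {s \<in> (\<Union>d\<in>\<Delta> j. W d). dir2 s = d}"
        using W[OF d] d by blast
    qed
    have "W d \<noteq> {}" if "d \<in> \<Delta> j" for d
      using W[OF that] i by auto
    define U where "U = (\<Union>d\<in>\<Delta> j. W d)"
    have dirW: "dir2 s = d" "s \<in> S0" if "d \<in> \<Delta> j" "s \<in> W d" for d s
      using W[OF that(1)] that(2) by blast+
    have "dir2 ` U = \<Delta> j"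
    proof (intro equalityI subsetI)
      fix d
      assume "d \<in> dir2 ` U"
      then show "d \<in> \<Delta> j"
        using dirW(1) unfolding U_def by blast
    next
      fix d
      assume d: "d \<in> \<Delta> j"
      then obtain s where "s \<in> W d"
        using \<open>\<And>d. d \<in> \<Delta> j \<Longrightarrow> W d \<noteq> {}\<close> by blast
      then show "d \<in> dir2 ` U"
        using d dirW(1)[OF d] unfolding U_def by blast
    qed
    moreover have "U \<subseteq> S0"
      using dirW(2) unfolding U_def by blast
    moreover have "card {s \<in> U. dir2 s = d} = i" if "d \<in> \<Delta> j" for d
      using fibre[OF that] W[OF that] by (simp add: U_def)
    ultimately show ?thesis
      by blast
  qed
  have vals_le: "card (vals U) \<le> V" if "U \<subseteq> S0" for U
    unfolding V_def using finite_vals[OF fin] that by (intro card_mono vals_mono) (auto simp: S0_def)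
  show False
  proof (cases "D > CHAR('f)")
    case True
    obtain U where U: "U \<subseteq> S0" "dir2 ` U = \<Delta> j" "\<forall>d\<in>\<Delta> j. card {s \<in> U. dir2 s = d} = 1"
      using pick[of 1] j by auto
    have finU: "finite U"
      using U(1) fin0 finite_subset by blast
    have "inj_on dir2 U"
    proof (rule inj_onI)
      fix s t
      assume st: "s \<in> U" "t \<in> U" "dir2 s = dir2 t"
      have "card {u \<in> U. dir2 u = dir2 t} = 1"
        using U st by blast
      then obtain u where u: "{u \<in> U. dir2 u = dir2 t} = {u}"
        by (rule card_1_singletonE)
      have "s \<in> {u \<in> U. dir2 u = dir2 t}" "t \<in> {u \<in> U. dir2 u = dir2 t}"
        using st by simp_all
      then show "s = t"
        unfolding u by simp
    qed
    then have "card U = D" "card U \<le> 2 * card (vals U)"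
      using card_le_twice_vals[OF finU] U nz card_image[of dir2 U] by (auto simp: D_def)
    then have "CHAR('f) < 2 * V"
      using True vals_le[OF U(1)] by linarith
    then show False
      using V_less(2) by linarith
  next
    case False
    show False
    proof (cases "D \<ge> 2")
      case True
      obtain U where U: "U \<subseteq> S0" "dir2 ` U = \<Delta> j" "\<forall>d\<in>\<Delta> j. card {s \<in> U. dir2 s = d} = j"
        using pick[of j] j by auto
      have "min (real (card (dir2 ` U)) * sqrt (real j)) (real CHAR('f)) \<le> 6576 * real (card (vals U))"
      proof (rule vals_uniform_bound)
        show "finite U"
          using U(1) fin0 finite_subset by blast
        show "(0, 0) \<notin> U"
          using U nz by blast
        show "card {s \<in> U. dir2 s = d} = j" if "d \<in> dir2 ` U" for d
          using U that by blast
        show "2 \<le> card (dir2 ` U)" "card (dir2 ` U) \<le> CHAR('f)"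
          using True False U(2) by (auto simp: D_def)
      qed (rule p15)
      \<comment> \<open>With \<open>T / 4\<close> at most the first entry of the minimum, a
        contradiction follows since 4 * 6576 = 26304 is below 30000.\<close>
      then have "min (real (card (\<Delta> j)) * sqrt (real j)) (real CHAR('f)) \<le> 6576 * real V"
        using vals_le[OF U(1)] unfolding U(2) by linarith
      then show False
        using V_less j by linarith
    next
      case False
      then have "real (card (\<Delta> j)) * sqrt (real j) \<le> 1 * sqrt (real j)"
        unfolding D_def by (intro mult_right_mono) auto
      also have "sqrt (real j) \<le> real j"
        using j(1) by (intro real_le_lsqrt) (auto simp: power2_eq_square)
      finally show False
        using j V_less(1) by simp
    qed
  qed
qed

end

section \<open>From fields given by records to field types, and transfer along embeddings\<close>

text \<open>A natural number is determined by its multiples, so this criterion compares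
  characteristics without a separate case for infinite order.\<close>

lemma characteristic_dvd_iff:
  assumes "field F"
  shows "characteristic F dvd n \<longleftrightarrow> \<one>\<^bsub>F\<^esub> [^]\<^bsub>add_monoid F\<^esub> n = \<zero>\<^bsub>F\<^esub>"
proof -
  interpret field F
    by fact
  show ?thesis
    unfolding characteristic_def
    using group.pow_eq_id[OF a_group, of "\<one>\<^bsub>F\<^esub>" n] by simp
qed

lemma ring_hom_multiples_of_one:
  assumes "field G" "field F" "h \<in> ring_hom G F"
  shows "\<one>\<^bsub>G\<^esub> [^]\<^bsub>add_monoid G\<^esub> n \<in> carrier G
    \<and> h (\<one>\<^bsub>G\<^esub> [^]\<^bsub>add_monoid G\<^esub> n) = \<one>\<^bsub>F\<^esub> [^]\<^bsub>add_monoid F\<^esub> (n::nat)"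
proof -
  interpret G: field G
    by fact
  interpret F: field F
    by fact
  interpret ring_hom_cring G F h
    by unfold_locales (rule assms(3))
  show ?thesis
    by (induction n) (auto simp: nat_pow_def)
qed

lemma characteristic_eq:
  assumes "field G" "field F" "h \<in> ring_hom G F" "inj_on h (carrier G)"
  shows "characteristic G = characteristic F"
proof -
  interpret G: field G
    by fact
  interpret F: field F
    by fact
  interpret ring_hom_cring G F h
    by unfold_locales (rule assms(3))
  have "characteristic G dvd n \<longleftrightarrow> characteristic F dvd n" for n
  proof -
    have "\<one>\<^bsub>G\<^esub> [^]\<^bsub>add_monoid G\<^esub> n = \<zero>\<^bsub>G\<^esub> \<longleftrightarrow> h (\<one>\<^bsub>G\<^esub> [^]\<^bsub>add_monoid G\<^esub> n) = h \<zero>\<^bsub>G\<^esub>"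
      using ring_hom_multiples_of_one[OF assms(1-3), of n] assms(4) G.zero_closed by (metis inj_onD)
    then show ?thesis
      using ring_hom_multiples_of_one[OF assms(1-3), of n]
      by (simp add: characteristic_dvd_iff[OF assms(1)] characteristic_dvd_iff[OF assms(2)])
  qed
  then show ?thesis
    by (meson dvd_antisym dvd_refl)
qed

lemma origin_line:
  assumes "field F" "l \<in> lines_through_origin F"
  shows "\<exists>d\<in>carrier (plane F). d \<noteq> \<zero>\<^bsub>plane F\<^esub> \<and> l = {t \<odot>\<^bsub>plane F\<^esub> d | t. t \<in> carrier F}"
proof -
  interpret F: field F
    by fact
  obtain a d where ad: "a \<in> carrier (plane F)" "d \<in> carrier (plane F)" "d \<noteq> \<zero>\<^bsub>plane F\<^esub>"
    "l = {a \<oplus>\<^bsub>plane F\<^esub> (t \<odot>\<^bsub>plane F\<^esub> d) | t. t \<in> carrier F}" and l0: "\<zero>\<^bsub>plane F\<^esub> \<in> l"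
    using assms(2) unfolding lines_through_origin_def plane_lines_def by blast
  obtain t0 where t0: "t0 \<in> carrier F" "\<zero>\<^bsub>plane F\<^esub> = a \<oplus>\<^bsub>plane F\<^esub> (t0 \<odot>\<^bsub>plane F\<^esub> d)"
    using l0 unfolding ad(4) by blast
  obtain a1 a2 d1 d2 where c: "a = (a1, a2)" "d = (d1, d2)"
    by (cases a; cases d)
  have cc: "a1 \<in> carrier F" "a2 \<in> carrier F" "d1 \<in> carrier F" "d2 \<in> carrier F"
    using ad(1,2) by (simp_all add: c plane_def)
  have "a1 \<oplus>\<^bsub>F\<^esub> t0 \<otimes>\<^bsub>F\<^esub> d1 = \<zero>\<^bsub>F\<^esub>" "a2 \<oplus>\<^bsub>F\<^esub> t0 \<otimes>\<^bsub>F\<^esub> d2 = \<zero>\<^bsub>F\<^esub>"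
    using t0(2)[symmetric] by (simp_all add: c plane_def)
  then have "\<ominus>\<^bsub>F\<^esub> (t0 \<otimes>\<^bsub>F\<^esub> d1) = a1" "\<ominus>\<^bsub>F\<^esub> (t0 \<otimes>\<^bsub>F\<^esub> d2) = a2"
    using cc t0(1) by (auto intro!: F.minus_equality)
  then have a12: "a1 = (\<ominus>\<^bsub>F\<^esub> t0) \<otimes>\<^bsub>F\<^esub> d1" "a2 = (\<ominus>\<^bsub>F\<^esub> t0) \<otimes>\<^bsub>F\<^esub> d2"
    using cc t0(1) by (simp_all add: F.l_minus)
  have eq: "a \<oplus>\<^bsub>plane F\<^esub> (t \<odot>\<^bsub>plane F\<^esub> d) = ((\<ominus>\<^bsub>F\<^esub> t0) \<oplus>\<^bsub>F\<^esub> t) \<odot>\<^bsub>plane F\<^esub> d" if "t \<in> carrier F" for t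
    using that cc t0(1) unfolding c a12 by (simp add: plane_def F.l_distr)
  have "l = {t \<odot>\<^bsub>plane F\<^esub> d | t. t \<in> carrier F}"
  proof (intro equalityI subsetI)
    fix x
    assume "x \<in> l"
    then obtain t where "t \<in> carrier F" "x = a \<oplus>\<^bsub>plane F\<^esub> (t \<odot>\<^bsub>plane F\<^esub> d)"
      unfolding ad(4) by blast
    moreover have "(\<ominus>\<^bsub>F\<^esub> t0) \<oplus>\<^bsub>F\<^esub> t \<in> carrier F"
      using t0 \<open>t \<in> carrier F\<close> by simp
    ultimately show "x \<in> {t \<odot>\<^bsub>plane F\<^esub> d | t. t \<in> carrier F}"
      using eq by blast
  next
    fix x
    assume "x \<in> {t \<odot>\<^bsub>plane F\<^esub> d | t. t \<in> carrier F}"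
    then obtain t where t: "t \<in> carrier F" "x = t \<odot>\<^bsub>plane F\<^esub> d"
      by blast
    have "(\<ominus>\<^bsub>F\<^esub> t0) \<oplus>\<^bsub>F\<^esub> (t0 \<oplus>\<^bsub>F\<^esub> t) = t"
      using t t0 by (simp add: F.r_neg1 F.r_neg2)
    then have "x = a \<oplus>\<^bsub>plane F\<^esub> ((t0 \<oplus>\<^bsub>F\<^esub> t) \<odot>\<^bsub>plane F\<^esub> d)"
      using eq[of "t0 \<oplus>\<^bsub>F\<^esub> t"] t t0 by simp
    then show "x \<in> l"
      unfolding ad(4) using t t0 F.add.m_closed by blast
  qed
  then show ?thesis
    using ad by blast
qed

text \<open>For the full field of a type the form is given by its matrix in the standard basis,
  which brings the statement into the locale \<open>bilin\<close>.\<close>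

lemma form_values_bound_type_field:
  "form_values_bound (1 / 30000) (ring_of_type_algebra :: 'f::field ring)"
  unfolding form_values_bound_def
proof (intro allI impI)
  fix p :: nat and \<omega> :: "'f vec2 \<Rightarrow> 'f vec2 \<Rightarrow> 'f" and S
  let ?F = "ring_of_type_algebra :: 'f ring"
  have F: "field ?F"
    by (rule field_from_type_algebra)
  note rec = ring_of_type_algebra_def plane_def
  assume asm: "prime p \<and> odd p \<and> characteristic ?F = p \<and> bilinear_form ?F \<omega> \<and> nondegenerate_form ?F \<omega> \<and>
    (symmetric_form ?F \<omega> \<or> skew_symmetric_form ?F \<omega>) \<and>
    finite S \<and> S \<subseteq> carrier (plane ?F) \<and> \<not> (\<exists>l\<in>plane_lines ?F. S \<subseteq> l)"
  then have p: "prime p" "characteristic ?F = p" and bil: "bilinear_form ?F \<omega>" and nondeg: "nondegenerate_form ?F \<omega>"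
    and sym: "symmetric_form ?F \<omega> \<or> skew_symmetric_form ?F \<omega>" and fin: "finite S"
    and noline: "\<not> (\<exists>l\<in>plane_lines ?F. S \<subseteq> l)"
    by auto
  have uminus: "\<ominus>\<^bsub>?F\<^esub> x = - x" for x
  proof -
    interpret field ?F by (rule F)
    have "- x \<oplus>\<^bsub>?F\<^esub> x = \<zero>\<^bsub>?F\<^esub>" "x \<in> carrier ?F" "- x \<in> carrier ?F"
      by (simp_all add: ring_of_type_algebra_def)
    then show ?thesis
      by (rule minus_equality)
  qed
  have add: "\<omega> (a + a', b + b') w = \<omega> (a, b) w + \<omega> (a', b') w" "\<omega> w (a + a', b + b') = \<omega> w (a, b) + \<omega> w (a', b')"
    for a b a' b' w
    using bil unfolding bilinear_form_def rec by (cases w; auto)+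
  have scale: "\<omega> (t * a, t * b) w = t * \<omega> (a, b) w" "\<omega> w (t * a, t * b) = t * \<omega> w (a, b)" for t a b w
    using bil unfolding bilinear_form_def rec by (cases w; auto)+
  define w11 where "w11 = \<omega> (1, 0) (1, 0)"
  define w12 where "w12 = \<omega> (1, 0) (0, 1)"
  define w21 where "w21 = \<omega> (0, 1) (1, 0)"
  define w22 where "w22 = \<omega> (0, 1) (0, 1)"
  have lin1: "\<omega> (a, b) w = a * \<omega> (1, 0) w + b * \<omega> (0, 1) w" for a b w
    using add(1)[of "a * 1" "b * 0" "a * 0" "b * 1" w] scale(1)[of a 1 0 w] scale(1)[of b 0 1 w] by simp
  have lin2: "\<omega> w (a, b) = a * \<omega> w (1, 0) + b * \<omega> w (0, 1)" for a b w
    using add(2)[of w "a * 1" "b * 0" "a * 0" "b * 1"] scale(2)[of w a 1 0] scale(2)[of w b 0 1] by simp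
  have \<omega>: "\<omega> u v = w11 * fst u * fst v + w12 * fst u * snd v + w21 * snd u * fst v + w22 * snd u * snd v" for u v
  proof -
    have "\<omega> u v = \<omega> (fst u, snd u) (fst v, snd v)"
      by simp
    also have "\<dots> = fst u * (fst v * w11 + snd v * w12) + snd u * (fst v * w21 + snd v * w22)"
      by (simp only: lin1[of "fst u"] lin2[of _ "fst v"] w11_def w12_def w21_def w22_def) (simp add: algebra_simps)
    finally show ?thesis
      by (simp add: algebra_simps)
  qed
  have no_kernel: "u = (0, 0)" if "\<And>v. \<omega> u v = 0" for u
  proof -
    have "\<forall>u\<in>carrier (plane ?F). (\<forall>v\<in>carrier (plane ?F). \<omega> u v = \<zero>\<^bsub>?F\<^esub>) \<longrightarrow> u = \<zero>\<^bsub>plane ?F\<^esub>"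
      using nondeg unfolding nondegenerate_form_def by blast
    from bspec[OF this, of u] show ?thesis
      using that by (simp add: rec)
  qed
  \<comment> \<open>If the determinant vanished, (w21, - w11) and (w22, - w12) would be in the left
    kernel, hence zero, and the whole form would be zero.\<close>
  have det: "w11 * w22 - w12 * w21 \<noteq> 0"
  proof
    assume d: "w11 * w22 - w12 * w21 = 0"
    then have d': "w11 * w22 = w12 * w21"
      by simp
    have "\<omega> (w21, - w11) v = 0" for v
      using d' by (simp add: \<omega> algebra_simps)
    then have 1: "w21 = 0" "w11 = 0"
      using no_kernel[of "(w21, - w11)"] by auto
    have "\<omega> (w22, - w12) v = 0" for v
      using d' by (simp add: \<omega> algebra_simps)
    then have "w22 = 0" "w12 = 0"
      using no_kernel[of "(w22, - w12)"] by auto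
    then have "\<omega> (1, 0) v = 0" for v
      by (simp add: \<omega> 1)
    then show False
      using no_kernel[of "(1, 0)"] by auto
  qed
  have inC: "u \<in> carrier (plane ?F)" for u
    by (simp add: rec mem_Times_iff)
  have "\<exists>\<epsilon>. bilin w11 w12 w21 w22 \<epsilon>"
    using sym
  proof
    assume "symmetric_form ?F \<omega>"
    then have "\<omega> u v = \<omega> v u" for u v
      unfolding symmetric_form_def using inC by blast
    then have "w12 = w21"
      by (simp add: w12_def w21_def)
    then have "bilin w11 w12 w21 w22 1"
      using det by unfold_locales auto
    then show ?thesis ..
  next
    assume "skew_symmetric_form ?F \<omega>"
    then have "\<omega> u v = - \<omega> v u" for u v
      unfolding skew_symmetric_form_def uminus using inC by blast
    then have "w12 = - w21" "w21 = - w12" "w11 = - w11" "w22 = - w22"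
      unfolding w12_def w21_def w11_def w22_def by blast+
    then have "bilin w11 w12 w21 w22 (- 1)"
      using det by unfold_locales simp_all
    then show ?thesis ..
  qed
  then obtain \<epsilon> where "bilin w11 w12 w21 w22 \<epsilon>"
    by blast
  then interpret bilin w11 w12 w21 w22 \<epsilon> .
  have om: "\<omega> = om"
    by (intro ext) (simp add: \<omega> om_def)
  have vals: "form_values \<omega> T = vals T" for T
    unfolding form_values_def vals_def om by auto
  have pow: "\<one>\<^bsub>?F\<^esub> [^]\<^bsub>add_monoid ?F\<^esub> n = of_nat n" for n :: nat
    by (induction n) (simp_all add: nat_pow_def ring_of_type_algebra_def algebra_simps)
  have CHAR: "CHAR('f) = p"
  proof (rule dvd_antisym)
    have pn: "p dvd n \<longleftrightarrow> of_nat n = (0::'f)" for n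
    proof -
      have "\<zero>\<^bsub>?F\<^esub> = 0"
        by (simp add: ring_of_type_algebra_def)
      then show ?thesis
        using characteristic_dvd_iff[OF F, of n] unfolding p(2) pow by simp
    qed
    show "CHAR('f) dvd p"
      using pn[of p] dvd_refl[of p] unfolding of_nat_eq_0_iff_char_dvd by blast
    show "p dvd CHAR('f)"
      using pn[of "CHAR('f)"] dvd_refl[of "CHAR('f)"] unfolding of_nat_eq_0_iff_char_dvd by blast
  qed
  have nl: "\<not> S \<subseteq> range (\<lambda>t. (fst a + t * fst d, snd a + t * snd d))" if d: "d \<noteq> (0, 0)" for a d
  proof
    assume "S \<subseteq> range (\<lambda>t. (fst a + t * fst d, snd a + t * snd d))"
    moreover have "range (\<lambda>t. (fst a + t * fst d, snd a + t * snd d)) \<in> plane_lines ?F"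
      unfolding plane_lines_def using d
      by (simp add: rec) (intro exI[of _ "fst a"] exI[of _ "snd a"] exI[of _ "fst d"] exI[of _ "snd d"], auto simp: prod_eq_iff)
    ultimately show False
      using noline by blast
  qed
  have "min (real (card S) powr (2/3)) (real CHAR('f)) \<le> 30000 * real (card (vals S))"
    using fin nl p CHAR by (intro vals_lower_bound) (auto dest: prime_gt_0_nat)
  then have first: "1 / 30000 * min (real (card S) powr (2/3)) (real p) \<le> real (card (form_values \<omega> S))"
    by (simp add: vals CHAR)
  have "1 / 30000 * real (card S') \<le> real (card (form_values \<omega> S))"
    if S': "S' \<subseteq> S" "on_distinct_lines_through_origin ?F S'" for S'
  proof (cases "S' = {}")
    case True
    then show ?thesis
      by simp
  next
    case False
    obtain l where l: "inj_on l S'" "\<And>s. s \<in> S' \<Longrightarrow> l s \<in> lines_through_origin ?F \<and> s \<in> l s"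
      using S'(2) unfolding on_distinct_lines_through_origin_def by blast
    have ls: "l s = range (\<lambda>t. scale2 t (dir2 s))" if s: "s \<in> S'" "s \<noteq> (0, 0)" for s
    proof -
      obtain d where d: "d \<noteq> (0, 0)" "l s = range (\<lambda>t. scale2 t d)"
      proof -
        obtain d where d: "d \<noteq> \<zero>\<^bsub>plane ?F\<^esub>" "l s = {t \<odot>\<^bsub>plane ?F\<^esub> d | t. t \<in> carrier ?F}"
          using origin_line[OF F conjunct1[OF l(2)[OF s(1)]]] by blast
        have "d \<noteq> (0, 0)"
          using d(1) by (simp add: rec)
        moreover have "l s = range (\<lambda>t. scale2 t d)"
          unfolding d(2) by (cases d) (auto simp: rec scale2_def)
        ultimately show thesis
          using that by blast
      qed
      obtain t where t: "s = scale2 t d"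
        using l(2)[OF s(1)] d by blast
      have "t \<noteq> 0"
        using s(2) t by (auto simp: scale2_def)
      then have "dir2 s = dir2 d"
        unfolding t by (rule dir2_scale2)
      then have d1: "d = scale2 (size2 d) (dir2 s)"
        using scale2_size2_dir2[OF d(1)] by simp
      have d2: "size2 d \<noteq> 0"
        by (rule size2_nonzero[OF d(1)])
      have "range (\<lambda>t. scale2 t d) = range (\<lambda>t. scale2 t (dir2 s))"
      proof (intro equalityI subsetI)
        fix x
        assume "x \<in> range (\<lambda>t. scale2 t d)"
        then obtain r where "x = scale2 r d"
          by blast
        also have "\<dots> = scale2 r (scale2 (size2 d) (dir2 s))"
          using d1 by (rule arg_cong)
        finally have "x = scale2 (r * size2 d) (dir2 s)"
          by (simp only: scale2_scale2)
        then show "x \<in> range (\<lambda>t. scale2 t (dir2 s))"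
          by blast
      next
        fix x
        assume "x \<in> range (\<lambda>t. scale2 t (dir2 s))"
        then obtain r where "x = scale2 r (dir2 s)"
          by blast
        also have "\<dots> = scale2 (r / size2 d) (scale2 (size2 d) (dir2 s))"
          by (simp add: scale2_scale2 d2)
        also have "\<dots> = scale2 (r / size2 d) d"
          using d1[symmetric] by (rule arg_cong)
        finally show "x \<in> range (\<lambda>t. scale2 t d)"
          by blast
      qed
      then show ?thesis
        using d by simp
    qed
    have finS': "finite S'"
      using fin S' finite_subset by blast
    \<comment> \<open>The origin may be one of the points but has no direction. It is set aside and
      paid for by one value, which makes the factor 3 instead of 2.\<close>
    have "inj_on dir2 (S' - {(0, 0)})"
    proof (rule inj_onI)
      fix s t
      assume st: "s \<in> S' - {(0, 0)}" "t \<in> S' - {(0, 0)}" "dir2 s = dir2 t"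
      have "l s = l t"
        using ls[of s] ls[of t] st by simp
      then show "s = t"
        using l(1) st by (simp add: inj_on_eq_iff)
    qed
    then have "card (S' - {(0, 0)}) \<le> 2 * card (vals (S' - {(0, 0)}))"
      using finS' by (intro card_le_twice_vals) auto
    moreover have "card (vals (S' - {(0, 0)})) \<le> card (vals S)"
      using S' by (intro card_mono finite_vals vals_mono fin) auto
    moreover have "card S' \<le> card (S' - {(0, 0)}) + 1"
      using card_Diff_singleton_if[of S' "(0, 0)"] by (simp split: if_splits)
    moreover have "card (vals S) \<ge> 1"
    proof -
      have "vals S \<noteq> {}"
        using False S' by (auto simp: vals_def)
      then show ?thesis
        using finite_vals[OF fin] by (simp add: Suc_le_eq card_gt_0_iff)
    qed
    ultimately have "card S' \<le> 3 * card (vals S)"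
      by linarith
    then show ?thesis
      by (simp add: vals)
  qed
  then show "1 / 30000 * min (real (card S) powr (2/3)) (real p) \<le> real (card (form_values \<omega> S)) \<and>
    (\<forall>S'. S' \<subseteq> S \<and> card S' < p \<and> on_distinct_lines_through_origin ?F S' \<longrightarrow>
      1 / 30000 * real (card S') \<le> real (card (form_values \<omega> S)))"
    using first by blast
qed

abbreviation pmap :: "('a \<Rightarrow> 'b) \<Rightarrow> 'a \<times> 'a \<Rightarrow> 'b \<times> 'b" where
  "pmap h \<equiv> map_prod h h"

lemma form_values_bound_transfer:
  fixes G :: "'g ring" and F :: "'a ring"
  assumes G: "field G" and F: "field F" and hom: "h \<in> ring_hom G F" and inj: "inj_on h (carrier G)"
    and bound: "form_values_bound c G"
    and p: "prime p" "odd p" "characteristic F = p"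
    and form: "bilinear_form F \<omega>" "nondegenerate_form F \<omega>" "symmetric_form F \<omega> \<or> skew_symmetric_form F \<omega>"
    and fin: "finite S" and S: "S \<subseteq> pmap h ` carrier (plane G)" and noline: "\<not> (\<exists>l\<in>plane_lines F. S \<subseteq> l)"
    and \<omega>K: "\<And>u v. u \<in> carrier (plane G) \<Longrightarrow> v \<in> carrier (plane G) \<Longrightarrow> \<omega> (pmap h u) (pmap h v) \<in> h ` carrier G"
  shows "c * min (real (card S) powr (2/3)) (real p) \<le> real (card (form_values \<omega> S))"
    and "\<And>S' d. S' \<subseteq> S \<Longrightarrow> card S' < p \<Longrightarrow>
      (\<And>s. s \<in> S' \<Longrightarrow> d s \<in> pmap h ` carrier (plane G) \<and> d s \<noteq> \<zero>\<^bsub>plane F\<^esub> \<and> (\<exists>t\<in>carrier F. s = t \<odot>\<^bsub>plane F\<^esub> d s)) \<Longrightarrow>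
      inj_on (\<lambda>s. {t \<odot>\<^bsub>plane F\<^esub> d s | t. t \<in> carrier F}) S' \<Longrightarrow>
      c * real (card S') \<le> real (card (form_values \<omega> S))"
proof -
  interpret G: field G
    by fact
  interpret F: field F
    by fact
  interpret h: ring_hom_cring G F h
    by unfold_locales (rule hom)
  define g where "g = inv_into (carrier G) h"
  have gh: "g (h x) = x" if "x \<in> carrier G" for x
    using that inj by (simp add: g_def)
  have hg: "h (g y) = y" "g y \<in> carrier G" if "y \<in> h ` carrier G" for y
    using that by (simp_all add: g_def f_inv_into_f inv_into_into)
  have planeG: "carrier (plane G) = carrier G \<times> carrier G" and planeF: "carrier (plane F) = carrier F \<times> carrier F"
    by (simp_all add: plane_def)
  have h2_closed: "pmap h u \<in> carrier (plane F)" if "u \<in> carrier (plane G)" for u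
    using that by (auto simp: planeG planeF)
  have g2h2: "pmap g (pmap h u) = u" if "u \<in> carrier (plane G)" for u
    using that gh by (auto simp: planeG)
  have h2g2: "pmap h (pmap g v) = v" "pmap g v \<in> carrier (plane G)" if "v \<in> pmap h ` carrier (plane G)" for v
    using that gh by (auto simp: planeG)
  have h2_add: "pmap h (u \<oplus>\<^bsub>plane G\<^esub> v) = pmap h u \<oplus>\<^bsub>plane F\<^esub> pmap h v"
    if "u \<in> carrier (plane G)" "v \<in> carrier (plane G)" for u v
    using that by (cases u; cases v) (simp add: plane_def)
  have h2_smult: "pmap h (t \<odot>\<^bsub>plane G\<^esub> u) = h t \<odot>\<^bsub>plane F\<^esub> pmap h u"
    if "t \<in> carrier G" "u \<in> carrier (plane G)" for t u
    using that by (cases u) (simp add: plane_def)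
  have h2_zero: "pmap h \<zero>\<^bsub>plane G\<^esub> = \<zero>\<^bsub>plane F\<^esub>"
    by (simp add: plane_def)
  have h2_inj: "u = v" if "pmap h u = pmap h v" "u \<in> carrier (plane G)" "v \<in> carrier (plane G)" for u v
    using that g2h2 by metis
  have G_closed: "u \<oplus>\<^bsub>plane G\<^esub> v \<in> carrier (plane G)" "t \<odot>\<^bsub>plane G\<^esub> u \<in> carrier (plane G)"
    if "u \<in> carrier (plane G)" "v \<in> carrier (plane G)" "t \<in> carrier G" for u v t
    using that by (cases u; cases v; auto simp: plane_def)+
  define \<omega>' where "\<omega>' u v = g (\<omega> (pmap h u) (pmap h v))" for u v
  have h\<omega>: "h (\<omega>' u v) = \<omega> (pmap h u) (pmap h v)" "\<omega>' u v \<in> carrier G"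
    if "u \<in> carrier (plane G)" "v \<in> carrier (plane G)" for u v
    using hg[OF \<omega>K[OF that]] by (simp_all add: \<omega>'_def)
  have eqI: "x = y" if "h x = h y" "x \<in> carrier G" "y \<in> carrier G" for x y
    using that inj by (rule inj_onD[rotated])
  have form_add: "\<omega> (u \<oplus>\<^bsub>plane F\<^esub> v) w = \<omega> u w \<oplus>\<^bsub>F\<^esub> \<omega> v w" "\<omega> w (u \<oplus>\<^bsub>plane F\<^esub> v) = \<omega> w u \<oplus>\<^bsub>F\<^esub> \<omega> w v"
    if "u \<in> carrier (plane F)" "v \<in> carrier (plane F)" "w \<in> carrier (plane F)" for u v w
    using form(1) that unfolding bilinear_form_def by blast+
  have form_smult: "\<omega> (t \<odot>\<^bsub>plane F\<^esub> u) v = t \<otimes>\<^bsub>F\<^esub> \<omega> u v" "\<omega> u (t \<odot>\<^bsub>plane F\<^esub> v) = t \<otimes>\<^bsub>F\<^esub> \<omega> u v"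
    if "t \<in> carrier F" "u \<in> carrier (plane F)" "v \<in> carrier (plane F)" for t u v
    using form(1) that unfolding bilinear_form_def by blast+
  have bil': "bilinear_form G \<omega>'"
    unfolding bilinear_form_def
  proof (intro conjI ballI)
    fix u v
    assume "u \<in> carrier (plane G)" "v \<in> carrier (plane G)"
    then show "\<omega>' u v \<in> carrier G"
      by (rule h\<omega>)
  next
    fix u v w
    assume uvw: "u \<in> carrier (plane G)" "v \<in> carrier (plane G)" "w \<in> carrier (plane G)"
    show "\<omega>' (u \<oplus>\<^bsub>plane G\<^esub> v) w = \<omega>' u w \<oplus>\<^bsub>G\<^esub> \<omega>' v w"
      by (rule eqI) (simp_all add: uvw h\<omega> G_closed(1)[OF uvw(1,2) G.zero_closed] h2_add h2_closed form_add)
    show "\<omega>' w (u \<oplus>\<^bsub>plane G\<^esub> v) = \<omega>' w u \<oplus>\<^bsub>G\<^esub> \<omega>' w v"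
      by (rule eqI) (simp_all add: uvw h\<omega> G_closed(1)[OF uvw(1,2) G.zero_closed] h2_add h2_closed form_add)
  next
    fix t u v
    assume tuv: "t \<in> carrier G" "u \<in> carrier (plane G)" "v \<in> carrier (plane G)"
    show "\<omega>' (t \<odot>\<^bsub>plane G\<^esub> u) v = t \<otimes>\<^bsub>G\<^esub> \<omega>' u v"
      by (rule eqI) (simp_all add: tuv h\<omega> G_closed(2)[OF tuv(2,2,1)] h2_smult h2_closed form_smult)
    show "\<omega>' u (t \<odot>\<^bsub>plane G\<^esub> v) = t \<otimes>\<^bsub>G\<^esub> \<omega>' u v"
      by (rule eqI) (simp_all add: tuv h\<omega> G_closed(2)[OF tuv(3,3,1)] h2_smult h2_closed form_smult)
  qed
  have e: "(\<one>\<^bsub>G\<^esub>, \<zero>\<^bsub>G\<^esub>) \<in> carrier (plane G)" "(\<zero>\<^bsub>G\<^esub>, \<one>\<^bsub>G\<^esub>) \<in> carrier (plane G)"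
    by (simp_all add: planeG)
  have basis: "v = (fst v \<odot>\<^bsub>plane F\<^esub> (\<one>\<^bsub>F\<^esub>, \<zero>\<^bsub>F\<^esub>)) \<oplus>\<^bsub>plane F\<^esub> (snd v \<odot>\<^bsub>plane F\<^esub> (\<zero>\<^bsub>F\<^esub>, \<one>\<^bsub>F\<^esub>))"
    if "v \<in> carrier (plane F)" for v
    using that by (cases v) (simp add: plane_def)
  have eF: "(\<one>\<^bsub>F\<^esub>, \<zero>\<^bsub>F\<^esub>) \<in> carrier (plane F)" "(\<zero>\<^bsub>F\<^esub>, \<one>\<^bsub>F\<^esub>) \<in> carrier (plane F)"
    by (simp_all add: planeF)
  have sc: "t \<odot>\<^bsub>plane F\<^esub> u \<in> carrier (plane F)" if "t \<in> carrier F" "u \<in> carrier (plane F)" for t u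
    using that by (cases u) (simp add: plane_def)
  have ker: "pmap h u = \<zero>\<^bsub>plane F\<^esub> \<Longrightarrow> u = \<zero>\<^bsub>plane G\<^esub>" if "u \<in> carrier (plane G)" for u
    using that h2_inj[of u "\<zero>\<^bsub>plane G\<^esub>"] h2_zero by (simp add: planeG) (simp add: plane_def)
  have nondeg': "nondegenerate_form G \<omega>'"
    unfolding nondegenerate_form_def
  proof (intro conjI ballI impI)
    fix u
    assume u: "u \<in> carrier (plane G)" and z: "\<forall>v\<in>carrier (plane G). \<omega>' u v = \<zero>\<^bsub>G\<^esub>"
    have z1: "\<omega> (pmap h u) (\<one>\<^bsub>F\<^esub>, \<zero>\<^bsub>F\<^esub>) = \<zero>\<^bsub>F\<^esub>" "\<omega> (pmap h u) (\<zero>\<^bsub>F\<^esub>, \<one>\<^bsub>F\<^esub>) = \<zero>\<^bsub>F\<^esub>"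
      using h\<omega>(1)[OF u e(1)] h\<omega>(1)[OF u e(2)] z e by simp_all
    \<comment> \<open>The standard basis is defined over G, so vanishing on the plane over G implies
      vanishing on the plane over F.\<close>
    have "\<omega> (pmap h u) v = \<zero>\<^bsub>F\<^esub>" if v: "v \<in> carrier (plane F)" for v
    proof -
      have "fst v \<in> carrier F" "snd v \<in> carrier F"
        using v by (auto simp: planeF)
      then show ?thesis
        by (subst basis[OF v]) (simp add: form_add form_smult sc eF h2_closed[OF u] z1)
    qed
    then have "pmap h u = \<zero>\<^bsub>plane F\<^esub>"
      using form(2) h2_closed[OF u] unfolding nondegenerate_form_def by blast
    then show "u = \<zero>\<^bsub>plane G\<^esub>"
      by (rule ker[OF u])
  next
    fix u
    assume u: "u \<in> carrier (plane G)" and z: "\<forall>v\<in>carrier (plane G). \<omega>' v u = \<zero>\<^bsub>G\<^esub>"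
    have z1: "\<omega> (\<one>\<^bsub>F\<^esub>, \<zero>\<^bsub>F\<^esub>) (pmap h u) = \<zero>\<^bsub>F\<^esub>" "\<omega> (\<zero>\<^bsub>F\<^esub>, \<one>\<^bsub>F\<^esub>) (pmap h u) = \<zero>\<^bsub>F\<^esub>"
      using h\<omega>(1)[OF e(1) u] h\<omega>(1)[OF e(2) u] z e by simp_all
    have "\<omega> v (pmap h u) = \<zero>\<^bsub>F\<^esub>" if v: "v \<in> carrier (plane F)" for v
    proof -
      have "fst v \<in> carrier F" "snd v \<in> carrier F"
        using v by (auto simp: planeF)
      then show ?thesis
        by (subst basis[OF v]) (simp add: form_add form_smult sc eF h2_closed[OF u] z1)
    qed
    then have "pmap h u = \<zero>\<^bsub>plane F\<^esub>"
      using form(2) h2_closed[OF u] unfolding nondegenerate_form_def by blast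
    then show "u = \<zero>\<^bsub>plane G\<^esub>"
      by (rule ker[OF u])
  qed
  have sym': "symmetric_form G \<omega>' \<or> skew_symmetric_form G \<omega>'"
    using form(3)
  proof
    assume "symmetric_form F \<omega>"
    then have "symmetric_form G \<omega>'"
      unfolding symmetric_form_def using h2_closed by (auto simp: \<omega>'_def)
    then show ?thesis ..
  next
    assume sk: "skew_symmetric_form F \<omega>"
    have "skew_symmetric_form G \<omega>'"
      unfolding skew_symmetric_form_def
    proof (intro ballI)
      fix u v
      assume uv: "u \<in> carrier (plane G)" "v \<in> carrier (plane G)"
      have "\<omega> (pmap h u) (pmap h v) = \<ominus>\<^bsub>F\<^esub> \<omega> (pmap h v) (pmap h u)"
        using sk h2_closed uv unfolding skew_symmetric_form_def by blast
      then show "\<omega>' u v = \<ominus>\<^bsub>G\<^esub> \<omega>' v u"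
        by (intro eqI) (simp_all add: uv h\<omega>)
    qed
    then show ?thesis ..
  qed
  define S1 where "S1 = pmap g ` S"
  have fin1: "finite S1"
    using fin by (simp add: S1_def)
  have S1_sub: "S1 \<subseteq> carrier (plane G)"
  proof
    fix x
    assume "x \<in> S1"
    then obtain s where s: "s \<in> S" "x = pmap g s"
      unfolding S1_def by (rule imageE)
    show "x \<in> carrier (plane G)"
      unfolding s(2) by (rule h2g2(2)[OF subsetD[OF S s(1)]])
  qed
  have g2_inj: "inj_on (pmap g) (pmap h ` carrier (plane G))"
    by (rule inj_on_inverseI[of _ "pmap h"]) (rule h2g2(1))
  have cardS1: "card S1 = card S"
    unfolding S1_def by (intro card_image inj_on_subset[OF g2_inj] S)
  have noline1: "\<not> (\<exists>l\<in>plane_lines G. S1 \<subseteq> l)"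
  proof
    assume "\<exists>l\<in>plane_lines G. S1 \<subseteq> l"
    then obtain a d where ad: "a \<in> carrier (plane G)" "d \<in> carrier (plane G)" "d \<noteq> \<zero>\<^bsub>plane G\<^esub>"
      "S1 \<subseteq> {a \<oplus>\<^bsub>plane G\<^esub> (t \<odot>\<^bsub>plane G\<^esub> d) | t. t \<in> carrier G}"
      unfolding plane_lines_def by blast
    have "S \<subseteq> {pmap h a \<oplus>\<^bsub>plane F\<^esub> (t \<odot>\<^bsub>plane F\<^esub> pmap h d) | t. t \<in> carrier F}"
    proof
      fix s
      assume s: "s \<in> S"
      then obtain t where t: "t \<in> carrier G" "pmap g s = a \<oplus>\<^bsub>plane G\<^esub> (t \<odot>\<^bsub>plane G\<^esub> d)"
        using ad(4) unfolding S1_def by blast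
      have "s = pmap h (pmap g s)"
        using h2g2(1) s S by (metis subsetD)
      also have "\<dots> = pmap h a \<oplus>\<^bsub>plane F\<^esub> (h t \<odot>\<^bsub>plane F\<^esub> pmap h d)"
        unfolding t(2) using h2_add[OF ad(1) G_closed(2)[OF ad(2) ad(2) t(1)]] h2_smult[OF t(1) ad(2)] by simp
      finally show "s \<in> {pmap h a \<oplus>\<^bsub>plane F\<^esub> (t \<odot>\<^bsub>plane F\<^esub> pmap h d) | t. t \<in> carrier F}"
        using h.hom_closed[OF t(1)] by blast
    qed
    moreover have "pmap h d \<noteq> \<zero>\<^bsub>plane F\<^esub>"
      using ker[OF ad(2)] ad(3) by blast
    ultimately show False
      using noline h2_closed ad(1,2) unfolding plane_lines_def by blast
  qed
  have vals: "form_values \<omega>' S1 = g ` form_values \<omega> S"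
  proof -
    have "\<omega>' (pmap g s) (pmap g t) = g (\<omega> s t)" if "s \<in> S" "t \<in> S" for s t
      using h2g2(1) S that unfolding \<omega>'_def by (metis subsetD)
    note \<omega>g = this
    show ?thesis
    proof (intro equalityI subsetI)
      fix x
      assume "x \<in> form_values \<omega>' S1"
      then obtain u v where uv: "u \<in> S1" "v \<in> S1" "x = \<omega>' u v"
        unfolding form_values_def by blast
      obtain s where s: "s \<in> S" "u = pmap g s"
        using uv(1) unfolding S1_def by (rule imageE)
      obtain t where t: "t \<in> S" "v = pmap g t"
        using uv(2) unfolding S1_def by (rule imageE)
      have "\<omega> s t \<in> form_values \<omega> S"
        unfolding form_values_def using s(1) t(1) by blast
      then show "x \<in> g ` form_values \<omega> S"
        unfolding uv(3) s(2) t(2) \<omega>g[OF s(1) t(1)] by (rule imageI)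
    next
      fix x
      assume "x \<in> g ` form_values \<omega> S"
      then obtain s t where st: "s \<in> S" "t \<in> S" "x = g (\<omega> s t)"
        unfolding form_values_def by blast
      show "x \<in> form_values \<omega>' S1"
        unfolding st(3) \<omega>g[OF st(1,2), symmetric] form_values_def S1_def mem_Collect_eq
        using imageI[OF st(1), of "pmap g"] imageI[OF st(2), of "pmap g"] by (intro exI conjI) (rule refl)
    qed
  qed
  have "form_values \<omega> S \<subseteq> h ` carrier G"
  proof
    fix x
    assume "x \<in> form_values \<omega> S"
    then obtain s t where st: "s \<in> S" "t \<in> S" "x = \<omega> s t"
      unfolding form_values_def by blast
    obtain u where u: "s = pmap h u" "u \<in> carrier (plane G)"
      using subsetD[OF S st(1)] by (rule imageE)
    obtain v where v: "t = pmap h v" "v \<in> carrier (plane G)"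
      using subsetD[OF S st(2)] by (rule imageE)
    show "x \<in> h ` carrier G"
      unfolding st(3) u(1) v(1) by (rule \<omega>K[OF u(2) v(2)])
  qed
  then have "inj_on g (form_values \<omega> S)"
    using hg(1) by (intro inj_on_inverseI[of _ h]) auto
  then have cardV: "card (form_values \<omega>' S1) = card (form_values \<omega> S)"
    unfolding vals by (rule card_image)
  have char: "characteristic G = p"
    using characteristic_eq[OF G F hom inj] p(3) by simp
  have main: "c * min (real (card S1) powr (2/3)) (real p) \<le> real (card (form_values \<omega>' S1)) \<and>
    (\<forall>S'. S' \<subseteq> S1 \<and> card S' < p \<and> on_distinct_lines_through_origin G S' \<longrightarrow>
      c * real (card S') \<le> real (card (form_values \<omega>' S1)))"
    using bound p(1,2) char bil' nondeg' sym' fin1 S1_sub noline1 unfolding form_values_bound_def by blast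
  then show "c * min (real (card S) powr (2/3)) (real p) \<le> real (card (form_values \<omega> S))"
    by (simp add: cardS1 cardV)
  fix S' d
  assume S': "S' \<subseteq> S" "card S' < p" and injl: "inj_on (\<lambda>s. {t \<odot>\<^bsub>plane F\<^esub> d s | t. t \<in> carrier F}) S'"
    and d: "\<And>s. s \<in> S' \<Longrightarrow> d s \<in> pmap h ` carrier (plane G) \<and> d s \<noteq> \<zero>\<^bsub>plane F\<^esub> \<and> (\<exists>t\<in>carrier F. s = t \<odot>\<^bsub>plane F\<^esub> d s)"
  define d1 where "d1 u = pmap g (d (pmap h u))" for u
  define l where "l u = {t \<odot>\<^bsub>plane G\<^esub> d1 u | t. t \<in> carrier G}" for u
  have S'_K: "S' \<subseteq> pmap h ` carrier (plane G)"
    by (rule order_trans[OF S'(1) S])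
  have dd: "d1 (pmap g s) = pmap g (d s)" "pmap h (pmap g (d s)) = d s" "pmap g (d s) \<in> carrier (plane G)"
    "pmap g (d s) \<noteq> \<zero>\<^bsub>plane G\<^esub>" if s: "s \<in> S'" for s
  proof -
    show "d1 (pmap g s) = pmap g (d s)"
      unfolding d1_def h2g2(1)[OF subsetD[OF S'_K s]] ..
    show 1: "pmap h (pmap g (d s)) = d s" and "pmap g (d s) \<in> carrier (plane G)"
      by (rule h2g2(1)[OF conjunct1[OF d[OF s]]]) (rule h2g2(2)[OF conjunct1[OF d[OF s]]])
    show "pmap g (d s) \<noteq> \<zero>\<^bsub>plane G\<^esub>"
      using 1 d[OF s] h2_zero by metis
  qed
  \<comment> \<open>The ratio of two proportional vectors over the subfield is a quotient of
    coordinates and hence lies in the subfield. So a point remains on its line when the line is cut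
    down to G.\<close>
  have coeff_in: "\<exists>t\<in>carrier G. u = t \<odot>\<^bsub>plane G\<^esub> v"
    if uv: "u \<in> carrier (plane G)" "v \<in> carrier (plane G)" "v \<noteq> \<zero>\<^bsub>plane G\<^esub>"
      and r: "r \<in> carrier F" "pmap h u = r \<odot>\<^bsub>plane F\<^esub> pmap h v" for u v r
  proof -
    obtain u1 u2 v1 v2 where c: "u = (u1, u2)" "v = (v1, v2)"
      by (cases u; cases v)
    have cc: "u1 \<in> carrier G" "u2 \<in> carrier G" "v1 \<in> carrier G" "v2 \<in> carrier G"
      using uv by (simp_all add: c planeG)
    have hr: "h u1 = r \<otimes>\<^bsub>F\<^esub> h v1" "h u2 = r \<otimes>\<^bsub>F\<^esub> h v2"
      using r(2) by (simp_all add: c plane_def)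
    have "\<exists>x y. x \<in> carrier G \<and> y \<in> carrier G \<and> y \<noteq> \<zero>\<^bsub>G\<^esub> \<and> h x = r \<otimes>\<^bsub>F\<^esub> h y"
    proof (cases "v1 = \<zero>\<^bsub>G\<^esub>")
      case True
      then have "v2 \<noteq> \<zero>\<^bsub>G\<^esub>"
        using uv(3) by (auto simp: c plane_def)
      then show ?thesis
        using cc hr by blast
    next
      case False
      then show ?thesis
        using cc hr by blast
    qed
    then obtain x y where xy: "x \<in> carrier G" "y \<in> carrier G" "y \<noteq> \<zero>\<^bsub>G\<^esub>" "h x = r \<otimes>\<^bsub>F\<^esub> h y"
      by blast
    define t where "t = x \<otimes>\<^bsub>G\<^esub> inv\<^bsub>G\<^esub> y"
    have yU: "y \<in> Units G"
      using xy G.field_Units by blast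
    have t: "t \<in> carrier G"
      using xy yU by (simp add: t_def)
    have "t \<otimes>\<^bsub>G\<^esub> y = x"
      using xy yU by (simp add: t_def G.m_assoc)
    then have "h t \<otimes>\<^bsub>F\<^esub> h y = r \<otimes>\<^bsub>F\<^esub> h y"
      using xy t h.hom_mult by metis
    moreover have "h y \<noteq> \<zero>\<^bsub>F\<^esub>"
      using xy eqI[of y "\<zero>\<^bsub>G\<^esub>"] by auto
    ultimately have "h t = r"
      using xy t r(1) by (metis F.m_rcancel h.hom_closed)
    then have "pmap h (t \<odot>\<^bsub>plane G\<^esub> v) = pmap h u"
      using h2_smult[OF t uv(2)] r(2) by simp
    then show ?thesis
      using h2_inj G_closed(2)[OF uv(2,2) t] uv(1) t by metis
  qed
  have dist: "on_distinct_lines_through_origin G (pmap g ` S')"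
    unfolding on_distinct_lines_through_origin_def
  proof (intro exI[of _ l] conjI ballI)
    show "inj_on l (pmap g ` S')"
    proof (rule inj_onI)
      fix u v
      assume u: "u \<in> pmap g ` S'" and v: "v \<in> pmap g ` S'" and luv: "l u = l v"
      obtain s where s: "u = pmap g s" "s \<in> S'"
        using u by (rule imageE)
      obtain t where t: "v = pmap g t" "t \<in> S'"
        using v by (rule imageE)
      have one: "x \<in> {t \<odot>\<^bsub>plane G\<^esub> x | t. t \<in> carrier G}" if "x \<in> carrier (plane G)" for x
      proof -
        have "x = \<one>\<^bsub>G\<^esub> \<odot>\<^bsub>plane G\<^esub> x"
          using that by (cases x) (simp add: plane_def)
        then show ?thesis
          using G.one_closed by blast
      qed
      have sub: "{t \<odot>\<^bsub>plane F\<^esub> d s | t. t \<in> carrier F} \<subseteq> {r \<odot>\<^bsub>plane F\<^esub> d t | r. r \<in> carrier F}"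
        if st: "s \<in> S'" "t \<in> S'" "l (pmap g s) = l (pmap g t)" for s t
      proof -
        have "pmap g (d s) \<in> l (pmap g s)"
          unfolding l_def dd(1)[OF st(1)] by (rule one[OF dd(3)[OF st(1)]])
        then obtain r where r: "r \<in> carrier G" "pmap g (d s) = r \<odot>\<^bsub>plane G\<^esub> pmap g (d t)"
          unfolding st(3) unfolding l_def dd(1)[OF st(2)] by blast
        have ds: "d s = h r \<odot>\<^bsub>plane F\<^esub> d t"
          using h2_smult[OF r(1) dd(3)[OF st(2)]] r(2) dd(2)[OF st(1)] dd(2)[OF st(2)] by metis
        have dtF: "d t \<in> carrier (plane F)"
          using dd(2,3)[OF st(2)] h2_closed by metis
        have "x \<odot>\<^bsub>plane F\<^esub> d s = (x \<otimes>\<^bsub>F\<^esub> h r) \<odot>\<^bsub>plane F\<^esub> d t" if "x \<in> carrier F" for x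
          unfolding ds using dtF that h.hom_closed[OF r(1)] by (cases "d t") (simp add: plane_def F.m_assoc)
        then show ?thesis
          using F.m_closed h.hom_closed[OF r(1)] by blast
      qed
      have lst: "l (pmap g s) = l (pmap g t)"
        using luv s t by simp
      have "{x \<odot>\<^bsub>plane F\<^esub> d s | x. x \<in> carrier F} = {x \<odot>\<^bsub>plane F\<^esub> d t | x. x \<in> carrier F}"
        by (rule equalityI[OF sub[OF s(2) t(2) lst] sub[OF t(2) s(2) lst[symmetric]]])
      then have "s = t"
        by (rule inj_onD[OF injl _ s(2) t(2)])
      then show "u = v"
        using s t by simp
    qed
  next
    fix u
    assume "u \<in> pmap g ` S'"
    then obtain s where s: "s \<in> S'" "u = pmap g s"
      by (metis imageE)
    have lu: "l u = {t \<odot>\<^bsub>plane G\<^esub> pmap g (d s) | t. t \<in> carrier G}"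
      unfolding l_def s(2) dd(1)[OF s(1)] ..
    have z0: "\<zero>\<^bsub>plane G\<^esub> \<in> carrier (plane G)"
      by (simp add: plane_def)
    have *: "\<zero>\<^bsub>plane G\<^esub> \<oplus>\<^bsub>plane G\<^esub> (t \<odot>\<^bsub>plane G\<^esub> pmap g (d s)) = t \<odot>\<^bsub>plane G\<^esub> pmap g (d s)" if "t \<in> carrier G" for t
      using that dd(3)[OF s(1)] by (cases "d s") (simp add: plane_def)
    have "l u = {\<zero>\<^bsub>plane G\<^esub> \<oplus>\<^bsub>plane G\<^esub> (t \<odot>\<^bsub>plane G\<^esub> pmap g (d s)) | t. t \<in> carrier G}"
      unfolding lu by (rule Collect_cong, rule ex_cong1) (metis *)
    then have "l u \<in> plane_lines G"
      unfolding plane_lines_def using z0 dd(3,4)[OF s(1)] by blast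
    moreover have "\<zero>\<^bsub>plane G\<^esub> = \<zero>\<^bsub>G\<^esub> \<odot>\<^bsub>plane G\<^esub> pmap g (d s)"
      using dd(3)[OF s(1)] by (cases "d s") (simp add: plane_def)
    then have "\<zero>\<^bsub>plane G\<^esub> \<in> l u"
      unfolding lu using G.zero_closed by blast
    ultimately show "l u \<in> lines_through_origin G"
      by (simp add: lines_through_origin_def)
    obtain r where r: "r \<in> carrier F" "s = r \<odot>\<^bsub>plane F\<^esub> d s"
      using d[OF s(1)] by blast
    have sK: "pmap h (pmap g s) = s" "pmap g s \<in> carrier (plane G)"
      by (rule h2g2(1)[OF subsetD[OF S'_K s(1)]]) (rule h2g2(2)[OF subsetD[OF S'_K s(1)]])
    have "pmap h (pmap g s) = r \<odot>\<^bsub>plane F\<^esub> pmap h (pmap g (d s))"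
      unfolding sK dd(2)[OF s(1)] by (rule r(2))
    from coeff_in[OF sK(2) dd(3,4)[OF s(1)] r(1) this]
    have "pmap g s \<in> {t \<odot>\<^bsub>plane G\<^esub> pmap g (d s) | t. t \<in> carrier G}"
      by blast
    then show "u \<in> l u"
      unfolding lu unfolding s(2) .
  qed
  have "card (pmap g ` S') = card S'"
    by (intro card_image inj_on_subset[OF g2_inj] S'_K)
  moreover have "pmap g ` S' \<subseteq> S1"
    unfolding S1_def by (rule image_mono[OF S'(1)])
  ultimately show "c * real (card S') \<le> real (card (form_values \<omega> S))"
    using main dist S'(2) by (metis cardV)
qed

section \<open>Reduction to fields on the natural numbers\<close>

text \<open>Formal field expressions in countably many generators. There are countably many, so a
  finitely generated field is countable.\<close>

datatype field_term = Gen nat | One | Neg field_term | Inv field_term | Add field_term field_term | Mul field_term field_term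

instance field_term :: countable
  by countable_datatype

primrec field_term_val :: "'a ring \<Rightarrow> (nat \<Rightarrow> 'a) \<Rightarrow> field_term \<Rightarrow> 'a" where
  "field_term_val F a (Gen n) = a n"
| "field_term_val F a One = \<one>\<^bsub>F\<^esub>"
| "field_term_val F a (Neg s) = \<ominus>\<^bsub>F\<^esub> field_term_val F a s"
| "field_term_val F a (Inv s) = inv\<^bsub>F\<^esub> field_term_val F a s"
| "field_term_val F a (Add s t) = field_term_val F a s \<oplus>\<^bsub>F\<^esub> field_term_val F a t"
| "field_term_val F a (Mul s t) = field_term_val F a s \<otimes>\<^bsub>F\<^esub> field_term_val F a t"

lemma countable_generate_field:
  fixes F :: "'a ring"
  assumes "finite H"
  shows "countable (generate_field F H)"
proof (rule countable_subset)
  let ?v = "field_term_val F (from_nat_into H)"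
  show "generate_field F H \<subseteq> range ?v"
  proof
    fix x
    assume "x \<in> generate_field F H"
    then show "x \<in> range ?v"
    proof induction
      case one
      show ?case
        by (rule range_eqI[of _ _ One]) simp
    next
      case (incl x)
      then obtain n where "x = from_nat_into H n"
        using from_nat_into_surj[OF countable_finite[OF assms]] by metis
      then show ?case
        by (intro range_eqI[of _ _ "Gen n"]) simp
    next
      case (a_inv x)
      then obtain s where "x = ?v s"
        by blast
      then show ?case
        by (intro range_eqI[of _ _ "Neg s"]) simp
    next
      case (m_inv x)
      then obtain s where "x = ?v s"
        by blast
      then show ?case
        by (intro range_eqI[of _ _ "Inv s"]) simp
    next
      case (eng_add x y)
      then obtain s t where "x = ?v s" "y = ?v t"
        by blast
      then show ?case
        by (intro range_eqI[of _ _ "Add s t"]) simp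
    next
      case (eng_mult x y)
      then obtain s t where "x = ?v s" "y = ?v t"
        by blast
      then show ?case
        by (intro range_eqI[of _ _ "Mul s t"]) simp
    qed
  qed
qed simp

text \<open>The field generated by H is countable, and an injection into the naturals carries its
  structure over; \<open>h\<close> is the inverse of that injection.\<close>

lemma countable_subfield:
  fixes F :: "'a ring"
  assumes "field F" "finite H" "H \<subseteq> carrier F"
  shows "\<exists>(G :: nat ring) h. field G \<and> h \<in> ring_hom G F \<and> inj_on h (carrier G) \<and> H \<subseteq> h ` carrier G"
proof -
  interpret field F
    by fact
  define K where "K = generate_field F H"
  define FK where "FK = F\<lparr>carrier := K\<rparr>"
  have FK: "field FK"
    unfolding FK_def K_def by (rule generate_field_is_field[OF assms(3)])
  have KF: "K \<subseteq> carrier F"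
    unfolding K_def by (rule generate_field_incl[OF assms(3)])
  have cK: "carrier FK = K"
    by (simp add: FK_def)
  define e where "e = to_nat_on K"
  have e: "inj_on e (carrier FK)"
    unfolding e_def cK K_def using countable_generate_field[OF assms(2)] by (rule inj_on_to_nat_on)
  define G where "G = image_ring e FK"
  have G: "field G"
    unfolding G_def by (rule field.inj_imp_image_ring_is_field[OF FK e])
  have iso: "e \<in> ring_iso FK G"
    unfolding G_def by (rule inj_imp_image_ring_iso[OF e])
  define h where "h = inv_into (carrier FK) e"
  have h: "h \<in> ring_iso G FK"
    unfolding h_def using iso FK by (intro ring_iso_set_sym) (auto simp: field_def domain_def cring_def)
  have h_bij: "bij_betw h (carrier G) K"
    using h by (simp add: ring_iso_def cK)
  have "h \<in> ring_hom G F"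
    using h KF unfolding ring_iso_def ring_hom_def by (auto simp: FK_def)
  moreover have "inj_on h (carrier G)" "h ` carrier G = K"
    using h_bij by (auto simp: bij_betw_def)
  moreover have "H \<subseteq> K"
    unfolding K_def by (auto intro: generate_field.incl)
  ultimately show ?thesis
    using G by blast
qed

lemma distinct_lines_directions:
  assumes "field F" "on_distinct_lines_through_origin F T"
  shows "\<exists>d. (\<forall>s\<in>T. d s \<in> carrier (plane F) \<and> d s \<noteq> \<zero>\<^bsub>plane F\<^esub> \<and> (\<exists>t\<in>carrier F. s = t \<odot>\<^bsub>plane F\<^esub> d s)) \<and>
    inj_on (\<lambda>s. {t \<odot>\<^bsub>plane F\<^esub> d s | t. t \<in> carrier F}) T"
proof -
  obtain l where l: "inj_on l T" "\<And>s. s \<in> T \<Longrightarrow> l s \<in> lines_through_origin F \<and> s \<in> l s"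
    using assms(2) unfolding on_distinct_lines_through_origin_def by blast
  have "\<forall>s\<in>T. \<exists>d. d \<in> carrier (plane F) \<and> d \<noteq> \<zero>\<^bsub>plane F\<^esub> \<and> l s = {t \<odot>\<^bsub>plane F\<^esub> d | t. t \<in> carrier F}"
    using origin_line[OF assms(1)] l(2) by blast
  from bchoice[OF this] obtain d where "\<forall>s\<in>T. d s \<in> carrier (plane F) \<and> d s \<noteq> \<zero>\<^bsub>plane F\<^esub> \<and>
      l s = {t \<odot>\<^bsub>plane F\<^esub> d s | t. t \<in> carrier F}"
    by (rule exE)
  then have d: "d s \<in> carrier (plane F) \<and> d s \<noteq> \<zero>\<^bsub>plane F\<^esub> \<and> l s = {t \<odot>\<^bsub>plane F\<^esub> d s | t. t \<in> carrier F}"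
    if "s \<in> T" for s
    using that by (rule bspec)
  have "inj_on l T = inj_on (\<lambda>s. {t \<odot>\<^bsub>plane F\<^esub> d s | t. t \<in> carrier F}) T"
    by (rule inj_on_cong) (use d in simp)
  then have "inj_on (\<lambda>s. {t \<odot>\<^bsub>plane F\<^esub> d s | t. t \<in> carrier F}) T"
    using l(1) by (rule iffD1)
  moreover have "\<exists>t\<in>carrier F. s = t \<odot>\<^bsub>plane F\<^esub> d s" if "s \<in> T" for s
    using l(2)[OF that] d[OF that] by blast
  ultimately show ?thesis
    using d by blast
qed

lemma bilinear_form_expand:
  assumes F: "field F" and bil: "bilinear_form F \<omega>" and u: "a \<in> carrier F" "b \<in> carrier F" and v: "c \<in> carrier F" "d \<in> carrier F"
  shows "\<omega> (a, b) (c, d)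
    = a \<otimes>\<^bsub>F\<^esub> (c \<otimes>\<^bsub>F\<^esub> \<omega> (\<one>\<^bsub>F\<^esub>, \<zero>\<^bsub>F\<^esub>) (\<one>\<^bsub>F\<^esub>, \<zero>\<^bsub>F\<^esub>) \<oplus>\<^bsub>F\<^esub> d \<otimes>\<^bsub>F\<^esub> \<omega> (\<one>\<^bsub>F\<^esub>, \<zero>\<^bsub>F\<^esub>) (\<zero>\<^bsub>F\<^esub>, \<one>\<^bsub>F\<^esub>)) \<oplus>\<^bsub>F\<^esub>
      b \<otimes>\<^bsub>F\<^esub> (c \<otimes>\<^bsub>F\<^esub> \<omega> (\<zero>\<^bsub>F\<^esub>, \<one>\<^bsub>F\<^esub>) (\<one>\<^bsub>F\<^esub>, \<zero>\<^bsub>F\<^esub>) \<oplus>\<^bsub>F\<^esub> d \<otimes>\<^bsub>F\<^esub> \<omega> (\<zero>\<^bsub>F\<^esub>, \<one>\<^bsub>F\<^esub>) (\<zero>\<^bsub>F\<^esub>, \<one>\<^bsub>F\<^esub>))"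
proof -
  interpret field F
    by fact
  let ?e = "(\<one>\<^bsub>F\<^esub>, \<zero>\<^bsub>F\<^esub>)" and ?f = "(\<zero>\<^bsub>F\<^esub>, \<one>\<^bsub>F\<^esub>)"
  have C: "?e \<in> carrier (plane F)" "?f \<in> carrier (plane F)"
    by (simp_all add: plane_def)
  have sc: "t \<odot>\<^bsub>plane F\<^esub> w \<in> carrier (plane F)" if "t \<in> carrier F" "w \<in> carrier (plane F)" for t w
    using that by (cases w) (simp add: plane_def)
  have b: "(x, y) = (x \<odot>\<^bsub>plane F\<^esub> ?e) \<oplus>\<^bsub>plane F\<^esub> (y \<odot>\<^bsub>plane F\<^esub> ?f)" if "x \<in> carrier F" "y \<in> carrier F" for x y
    using that by (simp add: plane_def)
  have add: "\<omega> (u \<oplus>\<^bsub>plane F\<^esub> v) w = \<omega> u w \<oplus>\<^bsub>F\<^esub> \<omega> v w" "\<omega> w (u \<oplus>\<^bsub>plane F\<^esub> v) = \<omega> w u \<oplus>\<^bsub>F\<^esub> \<omega> w v"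
    if "u \<in> carrier (plane F)" "v \<in> carrier (plane F)" "w \<in> carrier (plane F)" for u v w
    using bil that unfolding bilinear_form_def by blast+
  have smult: "\<omega> (t \<odot>\<^bsub>plane F\<^esub> u) v = t \<otimes>\<^bsub>F\<^esub> \<omega> u v" "\<omega> u (t \<odot>\<^bsub>plane F\<^esub> v) = t \<otimes>\<^bsub>F\<^esub> \<omega> u v"
    if "t \<in> carrier F" "u \<in> carrier (plane F)" "v \<in> carrier (plane F)" for t u v
    using bil that unfolding bilinear_form_def by blast+
  have cd: "(c, d) \<in> carrier (plane F)"
    using v by (simp add: plane_def)
  have right: "\<omega> w (c, d) = c \<otimes>\<^bsub>F\<^esub> \<omega> w ?e \<oplus>\<^bsub>F\<^esub> d \<otimes>\<^bsub>F\<^esub> \<omega> w ?f" if "w \<in> carrier (plane F)" for w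
    unfolding b[OF v] by (simp only: add(2)[OF sc[OF v(1) C(1)] sc[OF v(2) C(2)] that] smult(2)[OF v(1) that C(1)] smult(2)[OF v(2) that C(2)])
  have "\<omega> (a, b) (c, d) = a \<otimes>\<^bsub>F\<^esub> \<omega> ?e (c, d) \<oplus>\<^bsub>F\<^esub> b \<otimes>\<^bsub>F\<^esub> \<omega> ?f (c, d)"
    unfolding b[OF u] by (simp only: add(1)[OF sc[OF u(1) C(1)] sc[OF u(2) C(2)] cd] smult(1)[OF u(1) C(1) cd] smult(1)[OF u(2) C(2) cd])
  then show ?thesis
    by (simp only: right[OF C(1)] right[OF C(2)])
qed

text \<open>An instance of the bound involves finitely many elements: the coordinates of the points
  and directions and the four matrix entries of the form. They lie in a countable subfield, which
  has a copy on the natural numbers.\<close>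

lemma form_values_bound_of_nat_fields:
  fixes F :: "'a ring"
  assumes bound: "\<And>G :: nat ring. field G \<Longrightarrow> form_values_bound c G" and F: "field F"
  shows "form_values_bound c F"
  unfolding form_values_bound_def
proof (intro allI impI)
  fix p \<omega> S
  interpret F: field F
    by fact
  assume asm: "prime p \<and> odd p \<and> characteristic F = p \<and> bilinear_form F \<omega> \<and> nondegenerate_form F \<omega> \<and>
    (symmetric_form F \<omega> \<or> skew_symmetric_form F \<omega>) \<and>
    finite S \<and> S \<subseteq> carrier (plane F) \<and> \<not> (\<exists>l\<in>plane_lines F. S \<subseteq> l)"
  then have p: "prime p" "odd p" "characteristic F = p" and form: "bilinear_form F \<omega>" "nondegenerate_form F \<omega>"
      "symmetric_form F \<omega> \<or> skew_symmetric_form F \<omega>" and fin: "finite S" and S: "S \<subseteq> carrier (plane F)"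
    and noline: "\<not> (\<exists>l\<in>plane_lines F. S \<subseteq> l)"
    by auto
  have planeF: "carrier (plane F) = carrier F \<times> carrier F"
    by (simp add: plane_def)
  let ?e = "(\<one>\<^bsub>F\<^esub>, \<zero>\<^bsub>F\<^esub>)" and ?f = "(\<zero>\<^bsub>F\<^esub>, \<one>\<^bsub>F\<^esub>)"
  have covered: "\<exists>(G :: nat ring) h. field G \<and> h \<in> ring_hom G F \<and> inj_on h (carrier G) \<and> T \<subseteq> pmap h ` carrier (plane G) \<and>
    (\<forall>u\<in>carrier (plane G). \<forall>v\<in>carrier (plane G). \<omega> (pmap h u) (pmap h v) \<in> h ` carrier G)"
    if T: "finite T" "T \<subseteq> carrier (plane F)" for T
  proof -
    define W where "W = {\<omega> ?e ?e, \<omega> ?e ?f, \<omega> ?f ?e, \<omega> ?f ?f}"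
    have C: "?e \<in> carrier (plane F)" "?f \<in> carrier (plane F)"
      by (simp_all add: plane_def)
    have "W \<subseteq> carrier F"
      using form(1) C unfolding W_def bilinear_form_def by blast
    moreover have "fst ` T \<subseteq> carrier F" "snd ` T \<subseteq> carrier F"
      using T(2) unfolding planeF by force+
    ultimately have sub: "fst ` T \<union> snd ` T \<union> W \<subseteq> carrier F"
      by (intro Un_least)
    have fin: "finite (fst ` T \<union> snd ` T \<union> W)"
      using T(1) by (simp add: W_def)
    obtain G :: "nat ring" and h where G: "field G" "h \<in> ring_hom G F" "inj_on h (carrier G)"
        "fst ` T \<union> snd ` T \<union> W \<subseteq> h ` carrier G"
      using countable_subfield[OF F fin sub] by (elim exE conjE)
    interpret G: field G
      by fact
    interpret h: ring_hom_cring G F h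
      by unfold_locales (rule G(2))
    have "T \<subseteq> pmap h ` carrier (plane G)"
    proof
      fix x
      assume x: "x \<in> T"
      have "fst x \<in> h ` carrier G" "snd x \<in> h ` carrier G"
        using G(4) x by blast+
      then obtain a b where ab: "a \<in> carrier G" "fst x = h a" "b \<in> carrier G" "snd x = h b"
        by blast
      have "x = pmap h (a, b)"
        using ab by (simp add: prod_eq_iff)
      then show "x \<in> pmap h ` carrier (plane G)"
        using ab by (intro image_eqI[of _ _ "(a, b)"]) (simp_all add: plane_def)
    qed
    moreover have "\<omega> (pmap h u) (pmap h v) \<in> h ` carrier G" if uv: "u \<in> carrier (plane G)" "v \<in> carrier (plane G)" for u v
    proof -
      obtain a b c d where c: "u = (a, b)" "v = (c, d)"
        by (cases u; cases v)
      have cc: "a \<in> carrier G" "b \<in> carrier G" "c \<in> carrier G" "d \<in> carrier G"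
        using uv by (simp_all add: c plane_def)
      have W: "\<omega> ?e ?e \<in> h ` carrier G" "\<omega> ?e ?f \<in> h ` carrier G" "\<omega> ?f ?e \<in> h ` carrier G" "\<omega> ?f ?f \<in> h ` carrier G"
        using G(4) unfolding W_def by blast+
      obtain g11 where g11: "\<omega> ?e ?e = h g11" "g11 \<in> carrier G"
        using W(1) by (rule imageE)
      obtain g12 where g12: "\<omega> ?e ?f = h g12" "g12 \<in> carrier G"
        using W(2) by (rule imageE)
      obtain g21 where g21: "\<omega> ?f ?e = h g21" "g21 \<in> carrier G"
        using W(3) by (rule imageE)
      obtain g22 where g22: "\<omega> ?f ?f = h g22" "g22 \<in> carrier G"
        using W(4) by (rule imageE)
      have "\<omega> (pmap h u) (pmap h v) = \<omega> (h a, h b) (h c, h d)"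
        by (simp add: c)
      also have "\<dots> = h (a \<otimes>\<^bsub>G\<^esub> (c \<otimes>\<^bsub>G\<^esub> g11 \<oplus>\<^bsub>G\<^esub> d \<otimes>\<^bsub>G\<^esub> g12) \<oplus>\<^bsub>G\<^esub> b \<otimes>\<^bsub>G\<^esub> (c \<otimes>\<^bsub>G\<^esub> g21 \<oplus>\<^bsub>G\<^esub> d \<otimes>\<^bsub>G\<^esub> g22))"
        by (simp add: bilinear_form_expand[OF F form(1)] cc g11 g12 g21 g22)
      finally show ?thesis
        by (rule image_eqI) (simp add: cc g11(2) g12(2) g21(2) g22(2))
    qed
    ultimately show ?thesis
      using G by blast
  qed
  show "c * min (real (card S) powr (2/3)) (real p) \<le> real (card (form_values \<omega> S)) \<and>
    (\<forall>S'. S' \<subseteq> S \<and> card S' < p \<and> on_distinct_lines_through_origin F S' \<longrightarrow>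
      c * real (card S') \<le> real (card (form_values \<omega> S)))"
  proof (intro conjI allI impI)
    obtain G :: "nat ring" and h where G: "field G" "h \<in> ring_hom G F" "inj_on h (carrier G)" "S \<subseteq> pmap h ` carrier (plane G)"
      "\<And>u v. u \<in> carrier (plane G) \<Longrightarrow> v \<in> carrier (plane G) \<Longrightarrow> \<omega> (pmap h u) (pmap h v) \<in> h ` carrier G"
      using covered[OF fin S] by blast
    show "c * min (real (card S) powr (2/3)) (real p) \<le> real (card (form_values \<omega> S))"
      by (rule form_values_bound_transfer(1)[OF G(1) F G(2,3) bound[OF G(1)] p form fin G(4) noline])
        (rule G(5))
  next
    fix S'
    assume S': "S' \<subseteq> S \<and> card S' < p \<and> on_distinct_lines_through_origin F S'"
    then obtain d where d: "\<And>s. s \<in> S' \<Longrightarrow> d s \<in> carrier (plane F) \<and> d s \<noteq> \<zero>\<^bsub>plane F\<^esub> \<and> (\<exists>t\<in>carrier F. s = t \<odot>\<^bsub>plane F\<^esub> d s)"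
      "inj_on (\<lambda>s. {t \<odot>\<^bsub>plane F\<^esub> d s | t. t \<in> carrier F}) S'"
      using distinct_lines_directions[OF F, of S'] by blast
    \<comment> \<open>For the second bound the subfield depends on \<open>S'\<close>, as it must
      contain the chosen direction vectors.\<close>
    have "finite S'"
      by (rule finite_subset[OF conjunct1[OF S'] fin])
    then have finU: "finite (S \<union> d ` S')"
      by (intro finite_UnI finite_imageI fin)
    have "d ` S' \<subseteq> carrier (plane F)"
      by (rule image_subsetI) (rule conjunct1[OF d(1)])
    then have subU: "S \<union> d ` S' \<subseteq> carrier (plane F)"
      by (rule Un_least[OF S])
    obtain G :: "nat ring" and h where G: "field G" "h \<in> ring_hom G F" "inj_on h (carrier G)"
      "S \<union> d ` S' \<subseteq> pmap h ` carrier (plane G)"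
      "\<forall>u\<in>carrier (plane G). \<forall>v\<in>carrier (plane G). \<omega> (pmap h u) (pmap h v) \<in> h ` carrier G"
      using covered[OF finU subU] by (elim exE conjE)
    have SG: "S \<subseteq> pmap h ` carrier (plane G)"
      using Un_upper1 G(4) by (rule subset_trans)
    have dG: "d s \<in> pmap h ` carrier (plane G)" if "s \<in> S'" for s
      by (rule subsetD[OF G(4) UnI2[OF imageI[OF that]]])
    show "c * real (card S') \<le> real (card (form_values \<omega> S))"
    proof (rule form_values_bound_transfer(2)[OF G(1) F G(2,3) bound[OF G(1)] p form fin SG noline _ _ _ _ d(2)])
      show "\<omega> (pmap h u) (pmap h v) \<in> h ` carrier G" if "u \<in> carrier (plane G)" "v \<in> carrier (plane G)" for u v
        by (rule bspec[OF bspec[OF G(5) that(1)] that(2)])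
      show "S' \<subseteq> S"
        by (rule conjunct1[OF S'])
      show "card S' < p"
        by (rule conjunct1[OF conjunct2[OF S']])
      show "d s \<in> pmap h ` carrier (plane G) \<and> d s \<noteq> \<zero>\<^bsub>plane F\<^esub> \<and> (\<exists>t\<in>carrier F. s = t \<odot>\<^bsub>plane F\<^esub> d s)" if "s \<in> S'" for s
        by (rule conjI[OF dG[OF that] conjunct2[OF d(1)[OF that]]])
    qed
  qed
qed

section \<open>One field type that settles all fields on the natural numbers\<close>

text \<open>The arguments above need a type of class \<^class>\<open>field\<close>. A type definition cannot depend on a
  variable, so it is made for a closed term: a field on the natural numbers that violates the bound,
  if there is one.\<close>

definition extremal_field :: "nat ring" where
  "extremal_field = (SOME F. field F \<and>
    (form_values_bound (1 / 30000) F \<longrightarrow> (\<forall>G :: nat ring. field G \<longrightarrow> form_values_bound (1 / 30000) G)))"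

text \<open>A field violating the bound qualifies because the implication is then vacuous. If there
  is none, every field qualifies, and a copy of the rationals shows that one exists.\<close>

lemma extremal_field:
  "field extremal_field"
  "form_values_bound (1 / 30000) extremal_field \<Longrightarrow> field (G :: nat ring) \<Longrightarrow> form_values_bound (1 / 30000) G"
proof -
  have "field (image_ring to_nat (ring_of_type_algebra :: rat ring))"
    by (rule field.inj_imp_image_ring_is_field[OF field_from_type_algebra]) (rule inj_on_subset[OF inj_to_nat], simp)
  then have "\<exists>F :: nat ring. field F \<and>
    (form_values_bound (1 / 30000) F \<longrightarrow> (\<forall>G :: nat ring. field G \<longrightarrow> form_values_bound (1 / 30000) G))"
    by blast
  from someI_ex[OF this] show "field extremal_field"
    "form_values_bound (1 / 30000) extremal_field \<Longrightarrow> field (G :: nat ring) \<Longrightarrow> form_values_bound (1 / 30000) G"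
    unfolding extremal_field_def by blast+
qed

typedef extremal = "carrier extremal_field" morphisms rep_extremal abs_extremal
  using ring.ring_simprules(6)[OF cring.axioms(1)[OF fieldE(1)[OF extremal_field(1)]]] by blast

instantiation extremal :: field
begin

definition "0 = abs_extremal \<zero>\<^bsub>extremal_field\<^esub>"
definition "1 = abs_extremal \<one>\<^bsub>extremal_field\<^esub>"
definition "x + y = abs_extremal (rep_extremal x \<oplus>\<^bsub>extremal_field\<^esub> rep_extremal y)"
definition "x * y = abs_extremal (rep_extremal x \<otimes>\<^bsub>extremal_field\<^esub> rep_extremal y)"
definition "- x = abs_extremal (\<ominus>\<^bsub>extremal_field\<^esub> rep_extremal x)"
definition "x - y = x + (- y)" for x y :: extremal
definition "inverse x = (if x = 0 then 0 else abs_extremal (inv\<^bsub>extremal_field\<^esub> rep_extremal x))"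
definition "x div y = x * inverse y" for x y :: extremal

lemma rep_extremal_closed [simp]: "rep_extremal x \<in> carrier extremal_field"
  by (rule rep_extremal)

lemma rep_extremal_simps [simp]:
  "rep_extremal 0 = \<zero>\<^bsub>extremal_field\<^esub>" "rep_extremal 1 = \<one>\<^bsub>extremal_field\<^esub>"
  "rep_extremal (x + y) = rep_extremal x \<oplus>\<^bsub>extremal_field\<^esub> rep_extremal y"
  "rep_extremal (x * y) = rep_extremal x \<otimes>\<^bsub>extremal_field\<^esub> rep_extremal y"
  "rep_extremal (- x) = \<ominus>\<^bsub>extremal_field\<^esub> rep_extremal x"
proof -
  interpret X: field extremal_field
    by (rule extremal_field(1))
  show "rep_extremal 0 = \<zero>\<^bsub>extremal_field\<^esub>" "rep_extremal 1 = \<one>\<^bsub>extremal_field\<^esub>"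
    "rep_extremal (x + y) = rep_extremal x \<oplus>\<^bsub>extremal_field\<^esub> rep_extremal y"
    "rep_extremal (x * y) = rep_extremal x \<otimes>\<^bsub>extremal_field\<^esub> rep_extremal y"
    "rep_extremal (- x) = \<ominus>\<^bsub>extremal_field\<^esub> rep_extremal x"
    by (simp_all add: zero_extremal_def one_extremal_def plus_extremal_def times_extremal_def uminus_extremal_def
        abs_extremal_inverse)
qed

instance
proof
  fix x y z :: extremal
  interpret X: field extremal_field
    by (rule extremal_field(1))
  note inj = rep_extremal_inject[THEN iffD1]
  show "x + y + z = x + (y + z)"
    by (rule inj) (simp add: X.a_assoc)
  show "x + y = y + x"
    by (rule inj) (simp add: X.a_comm)
  show "0 + x = x"
    by (rule inj) simp
  show "- x + x = 0"
    by (rule inj) (simp add: X.l_neg)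
  show "x - y = x + - y"
    by (simp add: minus_extremal_def)
  show "x * y * z = x * (y * z)"
    by (rule inj) (simp add: X.m_assoc)
  show "x * y = y * x"
    by (rule inj) (simp add: X.m_comm)
  show "1 * x = x"
    by (rule inj) simp
  show "(x + y) * z = x * z + y * z"
    by (rule inj) (simp add: X.l_distr)
  show "(0 :: extremal) \<noteq> 1"
    using X.one_not_zero by (metis rep_extremal_simps(1,2))
  show "inverse x * x = 1" if "x \<noteq> 0"
  proof (rule inj)
    have "rep_extremal x \<noteq> \<zero>\<^bsub>extremal_field\<^esub>"
      using that by (metis rep_extremal_inject rep_extremal_simps(1))
    then have "rep_extremal x \<in> Units extremal_field"
      using X.field_Units rep_extremal_closed by blast
    then show "rep_extremal (inverse x * x) = rep_extremal 1"
      using that by (simp add: inverse_extremal_def abs_extremal_inverse)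
  qed
  show "x div y = x * inverse y"
    by (simp add: divide_extremal_def)
  show "inverse (0 :: extremal) = 0"
    by (simp add: inverse_extremal_def)
qed

end

text \<open>\<open>rep_extremal\<close> is an isomorphism of the field of the type onto
  \<open>extremal_field\<close>, so every point, direction and form value lies in its image and the
  transfer applies without restriction.\<close>

lemma form_values_bound_extremal: "form_values_bound (1 / 30000) extremal_field"
  unfolding form_values_bound_def
proof (intro allI impI)
  fix p \<omega> S
  let ?G = "ring_of_type_algebra :: extremal ring"
  assume asm: "prime p \<and> odd p \<and> characteristic extremal_field = p \<and> bilinear_form extremal_field \<omega> \<and>
    nondegenerate_form extremal_field \<omega> \<and> (symmetric_form extremal_field \<omega> \<or> skew_symmetric_form extremal_field \<omega>) \<and>
    finite S \<and> S \<subseteq> carrier (plane extremal_field) \<and> \<not> (\<exists>l\<in>plane_lines extremal_field. S \<subseteq> l)"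
  then have p: "prime p" "odd p" "characteristic extremal_field = p"
    and form: "bilinear_form extremal_field \<omega>" "nondegenerate_form extremal_field \<omega>"
      "symmetric_form extremal_field \<omega> \<or> skew_symmetric_form extremal_field \<omega>"
    and fin: "finite S" and S: "S \<subseteq> carrier (plane extremal_field)"
    and noline: "\<not> (\<exists>l\<in>plane_lines extremal_field. S \<subseteq> l)"
    by auto
  have G: "field ?G"
    by (rule field_from_type_algebra)
  have hom: "rep_extremal \<in> ring_hom ?G extremal_field"
    by (rule ring_hom_memI) (simp_all add: ring_of_type_algebra_def)
  have inj: "inj_on rep_extremal (carrier ?G)"
    by (auto simp: inj_on_def rep_extremal_inject)
  have surj: "rep_extremal ` carrier ?G = carrier extremal_field"
    using type_definition.Rep_range[OF type_definition_extremal] by (simp add: ring_of_type_algebra_def)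
  have surj2: "pmap rep_extremal ` carrier (plane ?G) = carrier (plane extremal_field)"
    using surj by (simp add: plane_def map_prod_surj_on)
  have closed: "\<omega> (pmap rep_extremal u) (pmap rep_extremal v) \<in> rep_extremal ` carrier ?G"
    if "u \<in> carrier (plane ?G)" "v \<in> carrier (plane ?G)" for u v
  proof -
    have "pmap rep_extremal u \<in> carrier (plane extremal_field)" "pmap rep_extremal v \<in> carrier (plane extremal_field)"
      unfolding surj2[symmetric] using that by (blast intro: imageI)+
    then show ?thesis
      using form(1) unfolding surj bilinear_form_def by blast
  qed
  note transfer = form_values_bound_transfer[OF G extremal_field(1) hom inj form_values_bound_type_field p form fin
      S[folded surj2] noline]
  show "1 / 30000 * min (real (card S) powr (2/3)) (real p) \<le> real (card (form_values \<omega> S)) \<and>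
    (\<forall>S'. S' \<subseteq> S \<and> card S' < p \<and> on_distinct_lines_through_origin extremal_field S' \<longrightarrow>
      1 / 30000 * real (card S') \<le> real (card (form_values \<omega> S)))"
  proof (intro conjI allI impI)
    show "1 / 30000 * min (real (card S) powr (2/3)) (real p) \<le> real (card (form_values \<omega> S))"
      by (rule transfer(1)) (rule closed)
  next
    fix S'
    assume S': "S' \<subseteq> S \<and> card S' < p \<and> on_distinct_lines_through_origin extremal_field S'"
    then obtain d where d: "\<And>s. s \<in> S' \<Longrightarrow> d s \<in> carrier (plane extremal_field) \<and> d s \<noteq> \<zero>\<^bsub>plane extremal_field\<^esub>
        \<and> (\<exists>t\<in>carrier extremal_field. s = t \<odot>\<^bsub>plane extremal_field\<^esub> d s)"
      "inj_on (\<lambda>s. {t \<odot>\<^bsub>plane extremal_field\<^esub> d s | t. t \<in> carrier extremal_field}) S'"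
      using distinct_lines_directions[OF extremal_field(1), of S'] by blast
    show "1 / 30000 * real (card S') \<le> real (card (form_values \<omega> S))"
    proof (rule transfer(2)[OF _ _ _ _ d(2)])
      show "\<omega> (pmap rep_extremal u) (pmap rep_extremal v) \<in> rep_extremal ` carrier ?G"
        if "u \<in> carrier (plane ?G)" "v \<in> carrier (plane ?G)" for u v
        using that by (rule closed)
      show "S' \<subseteq> S" "card S' < p"
        using S' by simp_all
      show "d s \<in> pmap rep_extremal ` carrier (plane ?G) \<and> d s \<noteq> \<zero>\<^bsub>plane extremal_field\<^esub> \<and>
          (\<exists>t\<in>carrier extremal_field. s = t \<odot>\<^bsub>plane extremal_field\<^esub> d s)" if "s \<in> S'" for s
        unfolding surj2 by (rule d(1)[OF that])
    qed
  qed
qed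

theorem theorem13:
  shows "0 < absolute_constant \<and>
    (\<forall>F :: 'a ring. field F \<longrightarrow> form_values_bound absolute_constant F)"
proof -
  \<comment> \<open>The number 1 / 30000 only shows that the choice in
    \<open>absolute_constant\<close> is from a nonempty set. The chosen number may be another one,
    but it works for all fields on the naturals, and that is all the reduction requires.\<close>
  have "\<exists>c::real. 0 < c \<and> (\<forall>F :: nat ring. field F \<longrightarrow> form_values_bound c F)"
    using extremal_field(2)[OF form_values_bound_extremal] by (intro exI[of _ "1 / 30000"] conjI allI impI) simp_all
  from someI_ex[OF this]
  have "0 < absolute_constant \<and> (\<forall>F :: nat ring. field F \<longrightarrow> form_values_bound absolute_constant F)"
    unfolding absolute_constant_def .
  then show ?thesis
    using form_values_bound_of_nat_fields by blast
qed

end
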